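(* Let $Q(t,\xi)=[c_{j,k}(t)Q_{j,k}(\xi)]_{m\times m}$ be a strongly triangularizable symbol, with associated $\Lambda(t,\xi)=\mathrm{diag}(\lambda_1(t,\xi),\dots,\lambda_m(t,\xi))$, $\mathcal{N}(t,\xi)=[r_{j,k}(t,\xi)]_{m\times m}$ and $B(t,\xi)=S^{-1}(t,\xi)\cdot D_tS(t,\xi)=[b_{j,k}(t,\xi)]_{m\times m}$, and set $$\Lambda(t,D_x)=\mathrm{diag}(\lambda_1(t,D_x),\dots,\lambda_m(t,D_x)),\quad \mathcal{N}(t,D_x)=[r_{j,k}(t,D_x)]_{m\times m},\quad B(t,D_x)=[b_{j,k}(t,D_x)]_{m\times m}.$$ Then the following statements are equivalent: (a) the system $P=D_t+Q(t,D_x)$ is globally hypoelliptic; (b) the system $L=D_t+\Lambda(t,D_x)+\mathcal{N}(t,D_x)+B(t,D_x)$ is globally hypoelliptic; (c) the system $T=D_t+\Lambda(t,D_x)+\mathcal{N}(t,D_x)$ is globally hypoelliptic.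
   Context: Notation. $\mathbb{T}=\mathbb{R}/2\pi\mathbb{Z}$, $D_t=i^{-1}\partial_t$, variables $t\in\mathbb{T}$, $x\in\mathbb{T}^n$, dual variable $\xi\in\mathbb{Z}^n$; $\mathbb{Z}_+$ is the set of non-negative integers. $\mathcal{D}'_m(\mathbb{T}^{n+1})$ and $C^\infty_m(\mathbb{T}^{n+1})$ are the spaces of $m$-dimensional vectors with coordinates in $\mathcal{D}'(\mathbb{T}^{n+1})$ and $C^\infty(\mathbb{T}^{n+1})$. For $w\in\mathcal{D}'(\mathbb{T}^{n+1})$ the partial Fourier coefficients are $\widehat w(t,\xi)=(2\pi)^{-n}\langle w(t,\cdot),e^{-ix\cdot\xi}\rangle$. Operators. The functions $c_{j,k}$ are smooth and complex-valued on $\mathbb{T}$, and $Q_{j,k}(D_x)$ are pseudo-differential operators on $\mathbb{T}^n$, i.e. Fourier multipliers whose symbols satisfy $|Q_{j,k}(\xi)|\le C|\xi|^\nu$ for all $\xi\in\mathbb{Z}^n\setminus\{0\}$, for some $C>0$ and $\nu\in\mathbb{R}$. For $a:\mathbb{T}\times\mathbb{Z}^n\to\mathbb{C}$ with $a(\cdot,\xi)$ smooth and all $t$-derivatives polynomially bounded in $\xi$ (for large $|\xi|$, uniformly in $t$), $a(t,D_x)w=\sum_{\xi\in\mathbb{Z}^n}a(t,\xi)\widehat w(t,\xi)e^{ix\cdot\xi}$ defines an operator on $\mathcal{D}'(\mathbb{T}^{n+1})$. All of $\lambda_k,r_{j,k},b_{j,k}$ and the entries of $Q(t,\xi)$ are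 of this type; $Q(t,D_x)$ has entries $c_{j,k}(t)Q_{j,k}(D_x)$. Global hypoellipticity. An $m\times m$ system $A$ on $\mathbb{T}^{n+1}$ is globally hypoelliptic if $u\in\mathcal{D}'_m(\mathbb{T}^{n+1})$ and $Au\in C^\infty_m(\mathbb{T}^{n+1})$ imply $u\in C^\infty_m(\mathbb{T}^{n+1})$. Smoothness. $C^\infty(\mathbb{T}\times\mathbb{Z}^n)=\{f:\mathbb{T}\times\mathbb{Z}^n\to\mathbb{C};\ f(\cdot,\xi)\in C^\infty(\mathbb{T})\ \forall\xi\in\mathbb{Z}^n\}$; a matrix is smooth on $\mathbb{T}\times\mathbb{Z}^n$ if its entries belong to this space. Condition (A). $Q(t,\xi)$ satisfies condition (A) if, for each $k$, its eigenvalue $\lambda_k(t,\xi)$ (eigenvalues listed with multiplicity) satisfies: $\lambda_k\in C^\infty(\mathbb{T}\times\mathbb{Z}^n)$; and for each $\alpha\in\mathbb{Z}_+$ there are $C=C(\alpha,k)$ and $\mu_k=\mu_k(\alpha)$ such that $\sup_{t\in\mathbb{T}}|\partial_t^\alpha\lambda_k(t,\xi)|\le C|\xi|^{\mu_k}$ for all sufficiently large $|\xi|$. Strongly triangularizable. A symbol $Q(t,\xi)$ satisfying condition (A) is strongly triangularizable if: (B1) for each $\xi\in\mathbb{Z}^n$ there is a triangularization $S^{-1}(t,\xi)Q(t,\xi)S(t,\xi)=\Lambda(t,\xi)+\mathcal{N}(t,\xi)$, where $\Lambda=\mathrm{diag}(\lambda_1,\dots,\lambda_m)$ and $\mathcal{N}=[r_{j,k}(t,\xi)]$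 is a smooth strictly upper triangular matrix (zero diagonal); (B2) $S$ and $S^{-1}$ are smooth on $\mathbb{T}\times\mathbb{Z}^n$ and for any $\alpha\in\mathbb{Z}_+$ there are positive constants $C,R,\gamma$ with $\sup_{t}\|\partial_t^\alpha S(t,\xi)\|_{\mathbb{C}^{m\times m}}\le C|\xi|^\gamma$ and $\sup_{t}\|\partial_t^\alpha S^{-1}(t,\xi)\|_{\mathbb{C}^{m\times m}}\le C|\xi|^\gamma$ for all $|\xi|\ge R$; (B3) for all $\alpha\in\mathbb{Z}_+$ and $N>0$ there are positive constants $C,R$ with $\sup_t\|\partial_t^\alpha B(t,\xi)\|_{\mathbb{C}^{m\times m}}\le C|\xi|^{-N}$ for all $|\xi|\ge R$, where $B(t,\xi)=S^{-1}(t,\xi)\cdot D_tS(t,\xi)$. *)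

theory Defs
  imports "HOL-Analysis.Analysis"
begin

text \<open>
  The torus of dimension \<open>d\<close> is represented by a Euclidean space of dimension \<open>d\<close>: a function on
  the torus is a function on that space which is \<open>2 \<pi>\<close>-periodic in each coordinate. This is used
  for \<^typ>\<open>real\<close> (variable \<open>t\<close>) and for \<^typ>\<open>real \<times> (real ^ 'n)\<close> (variables \<open>(t, x)\<close>).
\<close>

definition pdiff :: "'a::euclidean_space \<Rightarrow> ('a \<Rightarrow> 'b::real_normed_vector) \<Rightarrow> 'a \<Rightarrow> 'b" where
  "pdiff b f = (\<lambda>z. frechet_derivative f (at z) b)"

text \<open>\<open>pdiffs [b\<^sub>1, \<dots>, b\<^sub>r] f\<close> is the iterated partial derivative
  \<open>\<partial>\<^bsub>b\<^sub>1\<^esub> \<dots> \<partial>\<^bsub>b\<^sub>r\<^esub> f\<close>; the lists of basis vectors play the role of multi-indices.\<close>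

definition pdiffs :: "'a::euclidean_space list \<Rightarrow> ('a \<Rightarrow> 'b::real_normed_vector) \<Rightarrow> 'a \<Rightarrow> 'b" where
  "pdiffs bs f = foldr pdiff bs f"

definition torus_smooth :: "('a::euclidean_space \<Rightarrow> 'b::real_normed_vector) \<Rightarrow> bool" where
  "torus_smooth f \<longleftrightarrow>
     (\<forall>z. \<forall>b\<in>Basis. f (z + (2 * pi) *\<^sub>R b) = f z) \<and>
     (\<forall>bs\<in>lists Basis. \<forall>z. pdiffs bs f differentiable (at z))"

definition torus_integral :: "('a::euclidean_space \<Rightarrow> complex) \<Rightarrow> complex" where
  "torus_integral f = integral (cbox 0 ((2 * pi) *\<^sub>R One)) f"

text \<open>
  A distribution is a linear functional on the smooth functions that is continuous for the
  \<open>C\<^sup>\<infinity>\<close> topology, i.e. bounded by finitely many of the seminorms \<open>sup \<bar>\<partial>\<^sup>\<alpha> \<phi>\<bar>\<close>.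
  Its values on functions that are not smooth and periodic are irrelevant and unconstrained.
\<close>

type_synonym 'n functional = "(real \<times> (real ^ 'n) \<Rightarrow> complex) \<Rightarrow> complex"

definition distribution :: "'n::finite functional \<Rightarrow> bool" where
  "distribution u \<longleftrightarrow>
     (\<forall>\<phi> \<psi>. torus_smooth \<phi> \<and> torus_smooth \<psi> \<longrightarrow> u (\<lambda>z. \<phi> z + \<psi> z) = u \<phi> + u \<psi>) \<and>
     (\<forall>c \<phi>. torus_smooth \<phi> \<longrightarrow> u (\<lambda>z. c * \<phi> z) = c * u \<phi>) \<and>
     (\<exists>C N. \<forall>\<phi>. torus_smooth \<phi> \<longrightarrow>
        norm (u \<phi>) \<le> C * (\<Sum>bs | bs \<in> lists Basis \<and> length bs \<le> N. SUP z. norm (pdiffs bs \<phi> z)))"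

definition smooth_distribution :: "'n::finite functional \<Rightarrow> bool" where
  "smooth_distribution u \<longleftrightarrow>
     (\<exists>f. torus_smooth f \<and>
        (\<forall>\<phi>. torus_smooth \<phi> \<longrightarrow> u \<phi> = torus_integral (\<lambda>z. f z * \<phi> z)))"

text \<open>\<open>D\<^sub>t = i\<^sup>-\<^sup>1 \<partial>\<^sub>t\<close> on distributions, by transposition.\<close>

definition D_t :: "'n::finite functional \<Rightarrow> 'n functional" where
  "D_t u = (\<lambda>\<phi>. - u (\<lambda>z. - \<i> * pdiff (1, 0) \<phi> z))"

definition freq :: "int ^ 'n \<Rightarrow> real ^ 'n::finite" where
  "freq \<xi> = (\<chi> i. of_int (\<xi> $ i))"

text \<open>The partial Fourier coefficient of \<open>w\<close> at \<open>\<xi>\<close> is a distribution in \<open>t\<close>, that is, a functional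
  on the smooth functions of \<open>t\<close>.\<close>

definition fourier_coeff :: "'n::finite functional \<Rightarrow> int ^ 'n \<Rightarrow> (real \<Rightarrow> complex) \<Rightarrow> complex" where
  "fourier_coeff w \<xi> =
     (\<lambda>\<theta>. w (\<lambda>(t, x). \<theta> t * cis (- (x \<bullet> freq \<xi>))) / of_real ((2 * pi) ^ CARD('n)))"

text \<open>
  \<open>a(t, D\<^sub>x) w = \<Sum>\<^sub>\<xi> a(t, \<xi>) w\<^sub>\<xi>(t) e\<^bsup>i x \<xi>\<^esup>\<close>, where \<open>w\<^sub>\<xi>\<close> denotes the partial Fourier coefficient
  and the series converges weakly, i.e. after pairing with a smooth function \<open>\<phi>\<close>. The pairing of
  \<open>a(\<cdot>, \<xi>) w\<^sub>\<xi> \<otimes> e\<^bsup>i x \<xi>\<^esup>\<close> with \<open>\<phi>\<close> is the value of \<open>w\<^sub>\<xi>\<close> at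
  \<open>t \<mapsto> a(t, \<xi>) \<integral> \<phi>(t, x) e\<^bsup>i x \<xi>\<^esup> dx\<close>.
\<close>

definition symbol_op :: "(real \<Rightarrow> int ^ 'n \<Rightarrow> complex) \<Rightarrow> 'n::finite functional \<Rightarrow> 'n functional" where
  "symbol_op a w = (\<lambda>\<phi>. \<Sum>\<^sub>\<infinity>\<xi>. fourier_coeff w \<xi>
     (\<lambda>t. a t \<xi> * torus_integral (\<lambda>x. \<phi> (t, x) * cis (x \<bullet> freq \<xi>))))"

type_synonym ('n, 'm) matrix_symbol = "real \<Rightarrow> int ^ 'n \<Rightarrow> complex ^ 'm ^ 'm"

type_synonym ('n, 'm) system = "('m \<Rightarrow> 'n functional) \<Rightarrow> ('m \<Rightarrow> 'n functional)"

definition matrix_op :: "('n::finite, 'm::finite) matrix_symbol \<Rightarrow> ('n, 'm) system" where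
  "matrix_op A u = (\<lambda>j \<phi>. \<Sum>k\<in>UNIV. symbol_op (\<lambda>t \<xi>. A t \<xi> $ j $ k) (u k) \<phi>)"

definition globally_hypoelliptic :: "('n::finite, 'm::finite) system \<Rightarrow> bool" where
  "globally_hypoelliptic A \<longleftrightarrow>
     (\<forall>u. (\<forall>j. distribution (u j)) \<and> (\<forall>j. smooth_distribution (A u j)) \<longrightarrow>
          (\<forall>j. smooth_distribution (u j)))"

definition smooth_symbol :: "(real \<Rightarrow> int ^ 'n::finite \<Rightarrow> complex) \<Rightarrow> bool" where
  "smooth_symbol a \<longleftrightarrow> (\<forall>\<xi>. torus_smooth (\<lambda>t. a t \<xi>))"

definition smooth_matrix_symbol :: "('n::finite, 'm::finite) matrix_symbol \<Rightarrow> bool" where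
  "smooth_matrix_symbol A \<longleftrightarrow> (\<forall>j k. smooth_symbol (\<lambda>t \<xi>. A t \<xi> $ j $ k))"

definition dt_symbol ::
  "nat \<Rightarrow> (real \<Rightarrow> int ^ 'n::finite \<Rightarrow> 'b::real_normed_vector) \<Rightarrow> real \<Rightarrow> int ^ 'n \<Rightarrow> 'b" where
  "dt_symbol \<alpha> a t \<xi> = (pdiff 1 ^^ \<alpha>) (\<lambda>s. a s \<xi>) t"

text \<open>The list \<open>lam\<close> of the eigenvalues of \<open>Q(t, \<xi>)\<close>, with multiplicity, is the list of roots of the
  characteristic polynomial.\<close>

definition condition_A ::
  "('n::finite, 'm::finite) matrix_symbol \<Rightarrow> ('m \<Rightarrow> real \<Rightarrow> int ^ 'n \<Rightarrow> complex) \<Rightarrow> bool" where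
  "condition_A Q lam \<longleftrightarrow>
     (\<forall>t \<xi> z. det (mat z - Q t \<xi>) = (\<Prod>k\<in>UNIV. z - lam k t \<xi>)) \<and>
     (\<forall>k. smooth_symbol (lam k)) \<and>
     (\<forall>k \<alpha>. \<exists>C \<mu> R. R > 0 \<and> (\<forall>\<xi>. norm (freq \<xi>) \<ge> R \<longrightarrow>
        (\<forall>t. norm (dt_symbol \<alpha> (lam k) t \<xi>) \<le> C * norm (freq \<xi>) powr \<mu>)))"

definition diag_symbol ::
  "('m::finite \<Rightarrow> real \<Rightarrow> int ^ 'n::finite \<Rightarrow> complex) \<Rightarrow> ('n, 'm) matrix_symbol" where
  "diag_symbol lam t \<xi> = (\<chi> j k. if j = k then lam j t \<xi> else 0)"

definition inv_symbol :: "('n::finite, 'm::finite) matrix_symbol \<Rightarrow> ('n, 'm) matrix_symbol" where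
  "inv_symbol S t \<xi> = matrix_inv (S t \<xi>)"

definition B_symbol :: "('n::finite, 'm::finite) matrix_symbol \<Rightarrow> ('n, 'm) matrix_symbol" where
  "B_symbol S t \<xi> = inv_symbol S t \<xi> ** (\<chi> j k. - \<i> * dt_symbol 1 (\<lambda>t \<xi>. S t \<xi> $ j $ k) t \<xi>)"

text \<open>\<open>Q\<close> is strongly triangularizable, with the associated eigenvalues \<open>lam\<close>, conjugating matrix
  \<open>S\<close> and strictly upper triangular part \<open>N\<close>. The rows and columns are indexed by a finite linearly
  ordered type. The matrix norm is the Euclidean one.\<close>

definition strong_triangularization ::
  "('n::finite, 'm::{finite,linorder}) matrix_symbol \<Rightarrow> ('m \<Rightarrow> real \<Rightarrow> int ^ 'n \<Rightarrow> complex) \<Rightarrow>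
   ('n, 'm) matrix_symbol \<Rightarrow> ('n, 'm) matrix_symbol \<Rightarrow> bool" where
  "strong_triangularization Q lam S N \<longleftrightarrow>
     condition_A Q lam \<and>
     (\<forall>t \<xi>. invertible (S t \<xi>) \<and>
        inv_symbol S t \<xi> ** Q t \<xi> ** S t \<xi> = diag_symbol lam t \<xi> + N t \<xi>) \<and>
     smooth_matrix_symbol N \<and>
     (\<forall>t \<xi> j k. k \<le> j \<longrightarrow> N t \<xi> $ j $ k = 0) \<and>
     smooth_matrix_symbol S \<and>
     smooth_matrix_symbol (inv_symbol S) \<and>
     (\<forall>\<alpha>. \<exists>C R \<gamma>. C > 0 \<and> R > 0 \<and> \<gamma> > 0 \<and> (\<forall>\<xi>. norm (freq \<xi>) \<ge> R \<longrightarrow>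
        (\<forall>t. norm (dt_symbol \<alpha> S t \<xi>) \<le> C * norm (freq \<xi>) powr \<gamma> \<and>
             norm (dt_symbol \<alpha> (inv_symbol S) t \<xi>) \<le> C * norm (freq \<xi>) powr \<gamma>))) \<and>
     (\<forall>\<alpha> M. M > 0 \<longrightarrow> (\<exists>C R. C > 0 \<and> R > 0 \<and> (\<forall>\<xi>. norm (freq \<xi>) \<ge> R \<longrightarrow>
        (\<forall>t. norm (dt_symbol \<alpha> (B_symbol S) t \<xi>) \<le> C * norm (freq \<xi>) powr (- M)))))"

end

theory Submission
  imports Defs
begin

text \<open>
  All operators act on the partial Fourier coefficients \<open>u\<^sub>\<xi>\<close>, which are distributions in \<open>t\<close>: the
  operator with symbol \<open>a\<close> multiplies \<open>u\<^sub>\<xi>\<close> by \<open>a(\<cdot>, \<xi>)\<close>, and \<open>u\<close> is determined by the \<open>u\<^sub>\<xi>\<close>. Hence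
  \<open>P S(t, D\<^sub>x) = S(t, D\<^sub>x) L\<close>, and as \<open>S(t, D\<^sub>x)\<close> is a bijection of the distributions that preserves
  smoothness in both directions, (a) and (b) are equivalent. The operators \<open>L\<close> and \<open>T\<close> differ by
  \<open>B(t, D\<^sub>x)\<close>, which smooths only in \<open>x\<close>. However, if \<open>T u\<close> or \<open>L u\<close> is smooth, the equation expresses
  \<open>D\<^sub>t u\<^sub>\<xi>\<close> by \<open>u\<^sub>\<xi>\<close> and a smooth function, so \<open>u\<^sub>\<xi>\<close> is smooth in \<open>t\<close> with polynomial bounds in \<open>\<xi>\<close>.
  Then \<open>B(t, D\<^sub>x) u\<close> is smooth, and \<open>L u\<close> is smooth if and only if \<open>T u\<close> is.
\<close>

section \<open>Smooth functions on the torus\<close>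

text \<open>Regularity in time is read off from the pairings of u_\<xi> with a * \<theta>^(p), where
  a is an auxiliary factor. For a general distribution their bound involves p + K derivatives of
  \<theta>; the equation removes p of them while the order K stays fixed, and testing with
  characters then turns p into decay. The obstacle is that a symbol may grow faster in \<xi> with
  each t-derivative taken, so the growth exponent m gained by induction depends on p. Against B this
  is harmless, since B decays faster than every power for each number of derivatives. For S and its
  inverse, which may grow, smoothness has to be used in the stronger form in which m is arbitrary
  once the number J of derivatives on the factor is fixed.

  Both the return from Fourier coefficients to distributions and the recognition of smooth ones rest
  on the fact that the Fourier series of a smooth function converges with all its
  derivatives.\<close>

definition torus_periodic :: "('a::euclidean_space \<Rightarrow> 'b) \<Rightarrow> bool" where
  "torus_periodic f \<longleftrightarrow> (\<forall>z. \<forall>b\<in>Basis. f (z + (2 * pi) *\<^sub>R b) = f z)"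

lemma pdiff_eqI: "(f has_derivative f') (at z) \<Longrightarrow> pdiff b f z = f' b"
  by (metis frechet_derivative_at pdiff_def)

lemma pdiffs_Nil [simp]: "pdiffs [] f = f"
  and pdiffs_Cons [simp]: "pdiffs (b # bs) f = pdiff b (pdiffs bs f)"
  and pdiffs_append: "pdiffs (bs @ cs) f = pdiffs bs (pdiffs cs f)"
  by (simp_all add: pdiffs_def)

text \<open>Smoothness is a greatest fixed point: instead of iterated derivatives one exhibits a
  class \<open>X\<close> of periodic differentiable functions that is stable under a single partial
  derivative. Below \<open>X\<close> is the shape that differentiation preserves, such as sums of
  products, multiples of a character or wave series.\<close>

lemma torus_smooth_coinduct [consumes 1, case_names periodic differentiable pdiff]:
  assumes "X f"
    and "\<And>g. X g \<Longrightarrow> torus_periodic g"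
    and "\<And>g z. X g \<Longrightarrow> g differentiable (at z)"
    and "\<And>g b. X g \<Longrightarrow> b \<in> Basis \<Longrightarrow> X (pdiff b g)"
  shows "torus_smooth f"
proof -
  have "X (pdiffs bs f)" if "bs \<in> lists Basis" for bs
    using that by (induction bs) (auto intro: assms)
  then show ?thesis
    unfolding torus_smooth_def using assms unfolding torus_periodic_def by blast
qed

lemma torus_smooth_differentiable: "torus_smooth f \<Longrightarrow> f differentiable (at z)"
  unfolding torus_smooth_def by (metis lists.Nil pdiffs_Nil)

lemma torus_smooth_has_derivative:
  "torus_smooth f \<Longrightarrow> (f has_derivative frechet_derivative f (at z)) (at z)"
  using torus_smooth_differentiable frechet_derivative_works by blast

lemma torus_smooth_continuous_on: "torus_smooth f \<Longrightarrow> continuous_on S f"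
  by (meson continuous_at_imp_continuous_on differentiable_imp_continuous_within
      torus_smooth_differentiable)

lemma torus_smooth_periodic: "torus_smooth f \<Longrightarrow> torus_periodic f"
  by (auto simp: torus_smooth_def torus_periodic_def)

text \<open>Periodicity of the derivative follows by differentiating the identity between
  \<open>f\<close> and its translate. The further derivatives are those of \<open>f\<close> along
  lists ending in \<open>b\<close>, since the last entry of a list acts first.\<close>

lemma torus_smooth_pdiff:
  assumes "torus_smooth f" "b \<in> Basis"
  shows "torus_smooth (pdiff b f)"
proof -
  have "frechet_derivative f (at (z + (2 * pi) *\<^sub>R c)) = frechet_derivative f (at z)"
    if "c \<in> Basis" for z c
  proof -
    have "((\<lambda>y. y + (2 * pi) *\<^sub>R c) has_derivative (\<lambda>y. y)) (at z)"
      by (auto intro!: derivative_eq_intros)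
    from has_derivative_compose[OF this torus_smooth_has_derivative[OF assms(1)]]
    have "((\<lambda>y. f (y + (2 * pi) *\<^sub>R c)) has_derivative
        frechet_derivative f (at (z + (2 * pi) *\<^sub>R c))) (at z)" .
    moreover have "(\<lambda>y. f (y + (2 * pi) *\<^sub>R c)) = f"
      using torus_smooth_periodic[OF assms(1)] that by (auto simp: torus_periodic_def)
    ultimately show ?thesis by (simp add: frechet_derivative_at)
  qed
  moreover have "pdiffs bs (pdiff b f) differentiable (at z)" if "bs \<in> lists Basis" for bs z
  proof -
    have "bs @ [b] \<in> lists Basis" using that assms by auto
    then have "pdiffs (bs @ [b]) f differentiable (at z)"
      using assms unfolding torus_smooth_def by blast
    then show ?thesis by (simp add: pdiffs_append)
  qed
  ultimately show ?thesis
    unfolding torus_smooth_def by (auto simp: pdiff_def)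
qed

lemma torus_smooth_pdiffs: "torus_smooth f \<Longrightarrow> bs \<in> lists Basis \<Longrightarrow> torus_smooth (pdiffs bs f)"
  by (induction bs) (auto intro: torus_smooth_pdiff)

section \<open>Closure under linear maps, sums, products and affine substitutions\<close>

lemma pdiff_linear:
  assumes "torus_smooth f" "bounded_linear h"
  shows "pdiff b (\<lambda>z. h (f z)) z = h (pdiff b f z)"
  by (rule pdiff_eqI[THEN trans])
    (use bounded_linear.has_derivative[OF assms(2) torus_smooth_has_derivative[OF assms(1)]]
     in \<open>auto simp: pdiff_def\<close>)

lemma torus_smooth_linear:
  assumes "torus_smooth f" "bounded_linear h"
  shows "torus_smooth (\<lambda>z. h (f z))"
proof -
  have "\<exists>g. torus_smooth g \<and> (\<lambda>z. h (f z)) = (\<lambda>z. h (g z))" using assms by blast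
  then show ?thesis
  proof (rule torus_smooth_coinduct[where X = "\<lambda>k. \<exists>g. torus_smooth g \<and> k = (\<lambda>z. h (g z))"])
    fix k assume "\<exists>g. torus_smooth g \<and> k = (\<lambda>z. h (g z))"
    then obtain g where g: "torus_smooth g" "k = (\<lambda>z. h (g z))" by blast
    show "torus_periodic k"
      using torus_smooth_periodic[OF g(1)] by (auto simp: g(2) torus_periodic_def)
    show "k differentiable (at z)" for z
      using bounded_linear.has_derivative[OF assms(2) torus_smooth_has_derivative[OF g(1)]] g(2)
      by (auto simp: differentiable_def)
    show "\<exists>g. torus_smooth g \<and> pdiff b k = (\<lambda>z. h (g z))" if "b \<in> Basis" for b
      using pdiff_linear[OF g(1) assms(2)] torus_smooth_pdiff[OF g(1) that] g(2) by auto
  qed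
qed

lemma pdiff_add:
  assumes "torus_smooth f" "torus_smooth g"
  shows "pdiff b (\<lambda>z. f z + g z) z = pdiff b f z + pdiff b g z"
  by (rule pdiff_eqI[THEN trans])
    (use has_derivative_add[OF assms[THEN torus_smooth_has_derivative]] in \<open>auto simp: pdiff_def\<close>)

lemma torus_smooth_add:
  assumes "torus_smooth f" "torus_smooth g"
  shows "torus_smooth (\<lambda>z. f z + g z)"
proof -
  define X where "X = (\<lambda>k. \<exists>f g :: 'a \<Rightarrow> 'b. torus_smooth f \<and> torus_smooth g \<and> k = (\<lambda>z. f z + g z))"
  have "X (\<lambda>z. f z + g z)" using assms by (auto simp: X_def)
  then show ?thesis
  proof (rule torus_smooth_coinduct)
    fix k assume "X k"
    then obtain f g where fg: "torus_smooth f" "torus_smooth g" "k = (\<lambda>z. f z + g z)"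
      by (auto simp: X_def)
    show "torus_periodic k"
      using fg(1,2)[THEN torus_smooth_periodic] by (auto simp: fg(3) torus_periodic_def)
    show "k differentiable (at z)" for z
      unfolding fg(3) using fg(1,2) by (intro differentiable_add torus_smooth_differentiable)
    show "X (pdiff b k)" if "b \<in> Basis" for b
    proof -
      have "pdiff b k = (\<lambda>z. pdiff b f z + pdiff b g z)"
        using pdiff_add[OF fg(1,2)] by (auto simp: fg(3))
      then show ?thesis using fg(1,2)[THEN torus_smooth_pdiff, OF that] by (auto simp: X_def)
    qed
  qed
qed

lemma pdiff_const: "pdiff b (\<lambda>z. c) = (\<lambda>z. 0)"
  by (simp add: pdiff_def)

lemma torus_smooth_const: "torus_smooth (\<lambda>z. c)"
proof -
  have "\<exists>d. (\<lambda>z. c) = (\<lambda>z. d)" by blast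
  then show ?thesis
    by (rule torus_smooth_coinduct[where X = "\<lambda>f. \<exists>d. f = (\<lambda>z. d)"])
      (auto simp: torus_periodic_def pdiff_const)
qed

lemma torus_smooth_cmult: "torus_smooth f \<Longrightarrow> torus_smooth (\<lambda>z. (c::complex) * f z)"
  by (rule torus_smooth_linear) (auto intro: bounded_linear_mult_right)

lemma pdiff_cmult: "torus_smooth f \<Longrightarrow> pdiff b (\<lambda>z. (c::complex) * f z) z = c * pdiff b f z"
  by (rule pdiff_linear) (auto intro: bounded_linear_mult_right)

lemma pdiff_mult:
  fixes f g :: "'a::euclidean_space \<Rightarrow> complex"
  assumes "torus_smooth f" "torus_smooth g"
  shows "pdiff b (\<lambda>z. f z * g z) z = pdiff b f z * g z + f z * pdiff b g z"
  by (rule pdiff_eqI[THEN trans])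
    (use has_derivative_mult[OF assms[THEN torus_smooth_has_derivative], of z] in
      \<open>auto simp: pdiff_def add.commute\<close>)

text \<open>Single products are not stable under differentiation, because the product rule yields a
  sum of two; closing under sums gives the class for the coinduction.\<close>

inductive product_span :: "('a::euclidean_space \<Rightarrow> complex) \<Rightarrow> bool" where
  "torus_smooth f \<Longrightarrow> torus_smooth g \<Longrightarrow> product_span (\<lambda>z. f z * g z)"
| "product_span f \<Longrightarrow> product_span g \<Longrightarrow> product_span (\<lambda>z. f z + g z)"

lemma product_span_pdiff:
  assumes "product_span f"
  shows "torus_periodic f \<and> (\<forall>z. f differentiable (at z)) \<and> (\<forall>b\<in>Basis. product_span (pdiff b f))"
  using assms
proof induction
  case (1 f g)
  have "product_span (pdiff b (\<lambda>z. f z * g z))" if "b \<in> Basis" for b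
  proof -
    have "pdiff b (\<lambda>z. f z * g z) = (\<lambda>z. pdiff b f z * g z + f z * pdiff b g z)"
      using pdiff_mult[OF 1] by auto
    then show ?thesis
      using 1 that by (auto intro!: product_span.intros torus_smooth_pdiff)
  qed
  then show ?case
    using 1[THEN torus_smooth_periodic] 1[THEN torus_smooth_differentiable]
    by (auto simp: torus_periodic_def intro!: differentiable_mult)
next
  case (2 f g)
  have "pdiff b (\<lambda>z. f z + g z) = (\<lambda>z. pdiff b f z + pdiff b g z)" for b
  proof
    fix z show "pdiff b (\<lambda>z. f z + g z) z = pdiff b f z + pdiff b g z"
      unfolding pdiff_def using 2
      by (intro pdiff_eqI[THEN trans, unfolded pdiff_def] has_derivative_add refl)
        (auto simp flip: frechet_derivative_works)
  qed
  then show ?case using 2 by (auto simp: torus_periodic_def intro!: product_span.intros)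
qed

lemma torus_smooth_mult:
  fixes f g :: "'a::euclidean_space \<Rightarrow> complex"
  assumes "torus_smooth f" "torus_smooth g"
  shows "torus_smooth (\<lambda>z. f z * g z)"
proof -
  have "product_span (\<lambda>z. f z * g z)" using assms by (rule product_span.intros)
  then show ?thesis
    by (rule torus_smooth_coinduct) (auto dest: product_span_pdiff)
qed

lemma torus_smooth_uminus: "torus_smooth f \<Longrightarrow> torus_smooth (\<lambda>z. - f z)"
  by (rule torus_smooth_linear) (auto intro: bounded_linear_minus bounded_linear_ident)

lemma torus_smooth_diff: "torus_smooth f \<Longrightarrow> torus_smooth g \<Longrightarrow> torus_smooth (\<lambda>z. f z - g z)"
  using torus_smooth_add[OF _ torus_smooth_uminus, of f g] by simp

lemma torus_smooth_sum:
  "(\<And>i. i \<in> I \<Longrightarrow> torus_smooth (f i)) \<Longrightarrow> torus_smooth (\<lambda>z. \<Sum>i\<in>I. f i z)"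
  by (induction I rule: infinite_finite_induct)
    (auto intro: torus_smooth_const torus_smooth_add)

lemma pdiff_affine:
  assumes "torus_smooth g" "bounded_linear h"
  shows "pdiff b (\<lambda>z. g (c + h z)) z = pdiff (h b) g (c + h z)"
proof (rule pdiff_eqI[THEN trans])
  have "((\<lambda>z. c + h z) has_derivative h) (at z)"
    using bounded_linear_imp_has_derivative[OF assms(2)] by (auto intro!: derivative_eq_intros)
  from has_derivative_compose[OF this torus_smooth_has_derivative[OF assms(1)]]
  show "((\<lambda>z. g (c + h z)) has_derivative (\<lambda>y. frechet_derivative g (at (c + h z)) (h y))) (at z)" .
qed (simp add: pdiff_def)

lemma pdiff_0: "torus_smooth f \<Longrightarrow> pdiff 0 f = (\<lambda>z. 0)"
  using linear_0[OF linear_frechet_derivative[OF torus_smooth_differentiable[of f]]]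
  by (auto simp: pdiff_def)

text \<open>The condition on \<open>h\<close> sends a coordinate period to a period of
  \<open>g\<close> or to 0, and it makes each partial derivative again a partial derivative of
  \<open>g\<close>, or 0. Projections from the product torus and inclusions of slices are of this
  kind.\<close>

lemma torus_smooth_affine:
  fixes h :: "'a::euclidean_space \<Rightarrow> 'b::euclidean_space"
  assumes "torus_smooth g" and h: "bounded_linear h"
    and B: "\<And>b. b \<in> Basis \<Longrightarrow> h b \<in> Basis \<or> h b = 0"
  shows "torus_smooth (\<lambda>z. g (c + h z))"
proof -
  have "\<exists>k. torus_smooth k \<and> (\<lambda>z. g (c + h z)) = (\<lambda>z. k (c + h z))" using assms by blast
  then show ?thesis
  proof (rule torus_smooth_coinduct[where X = "\<lambda>f. \<exists>k. torus_smooth k \<and> f = (\<lambda>z. k (c + h z))"])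
    fix f assume "\<exists>k. torus_smooth k \<and> f = (\<lambda>z. k (c + h z))"
    then obtain k where k: "torus_smooth k" "f = (\<lambda>z. k (c + h z))" by blast
    interpret h: bounded_linear h by fact
    show "torus_periodic f"
      unfolding torus_periodic_def k(2)
    proof (intro allI ballI)
      fix z and b :: 'a assume "b \<in> Basis"
      then show "k (c + h (z + (2 * pi) *\<^sub>R b)) = k (c + h z)"
        using B[of b] torus_smooth_periodic[OF k(1)]
        by (auto simp: h.add h.scaleR torus_periodic_def simp flip: add.assoc)
    qed
    show "f differentiable (at z)" for z
    proof -
      have "((\<lambda>z. c + h z) has_derivative h) (at z)"
        using bounded_linear_imp_has_derivative[OF h] by (auto intro!: derivative_eq_intros)
      from has_derivative_compose[OF this torus_smooth_has_derivative[OF k(1)]]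
      show ?thesis by (auto simp: k(2) differentiable_def)
    qed
    show "\<exists>l. torus_smooth l \<and> pdiff b f = (\<lambda>z. l (c + h z))" if "b \<in> Basis" for b
    proof -
      have "torus_smooth (pdiff (h b) k)"
        using B[OF that] torus_smooth_pdiff[OF k(1)]
        by (auto simp: pdiff_0[OF k(1)] torus_smooth_const)
      moreover have "pdiff b f = (\<lambda>z. pdiff (h b) k (c + h z))"
        using pdiff_affine[OF k(1) h] by (auto simp: k(2))
      ultimately show ?thesis by blast
    qed
  qed
qed

section \<open>Reduction to the fundamental box and boundedness\<close>

lemma torus_periodic_int:
  assumes "torus_periodic f" "b \<in> Basis"
  shows "f (z + (2 * pi * of_int n) *\<^sub>R b) = f z"
proof -
  have nat: "f (z + (2 * pi * real n) *\<^sub>R b) = f z" for z n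
  proof (induction n)
    case (Suc n)
    have "f (z + (2 * pi * real (Suc n)) *\<^sub>R b) = f ((z + (2 * pi * real n) *\<^sub>R b) + (2 * pi) *\<^sub>R b)"
      by (simp add: algebra_simps)
    also have "\<dots> = f z"
      using Suc assms by (simp add: torus_periodic_def)
    finally show ?case .
  qed simp
  show ?thesis
  proof (cases "n \<ge> 0")
    case True
    then show ?thesis using nat[of z "nat n"] by simp
  next
    case False
    then show ?thesis using nat[of "z + (2 * pi * of_int n) *\<^sub>R b" "nat (- n)"]
      by (simp add: algebra_simps)
  qed
qed

lemma torus_periodic_reduce:
  fixes f :: "'a::euclidean_space \<Rightarrow> 'b"
  assumes "torus_periodic f"
  obtains y where "y \<in> cbox 0 ((2 * pi) *\<^sub>R One)" "f y = f z"
proof -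
  define m where "m b = \<lfloor>(z \<bullet> b) / (2 * pi)\<rfloor>" for b
  have "f (z + (\<Sum>b\<in>B. (2 * pi * of_int (- m b)) *\<^sub>R b)) = f z" if "B \<subseteq> Basis" for B
    using finite_subset[OF that finite_Basis] that
  proof (induction B)
    case (insert b B)
    then have "f (z + (\<Sum>b\<in>insert b B. (2 * pi * of_int (- m b)) *\<^sub>R b)) =
        f ((z + (\<Sum>b\<in>B. (2 * pi * of_int (- m b)) *\<^sub>R b)) + (2 * pi * of_int (- m b)) *\<^sub>R b)"
      by (simp add: algebra_simps)
    also have "\<dots> = f (z + (\<Sum>b\<in>B. (2 * pi * of_int (- m b)) *\<^sub>R b))"
      using insert by (intro torus_periodic_int[OF assms]) auto
    finally show ?case using insert by simp
  qed simp
  then have "f (z + (\<Sum>b\<in>Basis. (2 * pi * of_int (- m b)) *\<^sub>R b)) = f z" by blast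
  moreover have "z + (\<Sum>b\<in>Basis. (2 * pi * of_int (- m b)) *\<^sub>R b) \<in> cbox 0 ((2 * pi) *\<^sub>R One)"
  proof -
    have "0 \<le> z \<bullet> b - 2 * pi * m b" "z \<bullet> b - 2 * pi * m b \<le> 2 * pi" for b
    proof -
      have "of_int (m b) \<le> (z \<bullet> b) / (2 * pi)" "(z \<bullet> b) / (2 * pi) < of_int (m b) + 1"
        unfolding m_def by linarith+
      then show "0 \<le> z \<bullet> b - 2 * pi * m b" "z \<bullet> b - 2 * pi * m b \<le> 2 * pi"
        by (auto simp: field_simps)
    qed
    then show ?thesis
      by (auto simp: mem_box inner_add_left inner_sum_left_Basis simp flip: scaleR_minus_left)
  qed
  ultimately show ?thesis using that by blast
qed

lemma torus_smooth_bounded: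
  assumes "torus_smooth f"
  obtains D where "D \<ge> 0" "\<And>z. norm (f z) \<le> D"
proof -
  have "compact (f ` cbox 0 ((2 * pi) *\<^sub>R One))"
    by (intro compact_continuous_image torus_smooth_continuous_on assms compact_cbox)
  then obtain D where D: "norm (f z) \<le> D" if "z \<in> cbox 0 ((2 * pi) *\<^sub>R One)" for z
    using compact_imp_bounded bounded_iff by (metis imageI)
  have "norm (f z) \<le> D" for z
    by (metis D torus_periodic_reduce torus_smooth_periodic assms)
  then show ?thesis using that by (meson norm_ge_zero order_trans)
qed

lemma bdd_above_torus_smooth: "torus_smooth f \<Longrightarrow> bdd_above (range (\<lambda>z. norm (f z)))"
  by (meson bdd_aboveI2 torus_smooth_bounded)

section \<open>Seminorm bounds\<close>

lemma finite_multiindices: "finite {bs. bs \<in> lists (Basis :: 'a::euclidean_space set) \<and> length bs \<le> N}"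
  using finite_lists_length_le[of "Basis :: 'a set" N] by (simp add: lists_eq_set)

text \<open>A relation with an explicit bound \<open>D\<close> instead of a supremum: smoothness is
  carried along, and estimates compose without boundedness side conditions.\<close>

definition seminorm_le :: "nat \<Rightarrow> real \<Rightarrow> ('a::euclidean_space \<Rightarrow> 'b::real_normed_vector) \<Rightarrow> bool" where
  "seminorm_le N D f \<longleftrightarrow> torus_smooth f \<and>
     (\<forall>bs\<in>lists Basis. length bs \<le> N \<longrightarrow> (\<forall>z. norm (pdiffs bs f z) \<le> D))"

lemma seminorm_le_mono: "seminorm_le N D f \<Longrightarrow> M \<le> N \<Longrightarrow> D \<le> E \<Longrightarrow> seminorm_le M E f"
  unfolding seminorm_le_def by (meson order_trans)

lemma seminorm_le_nonneg: "seminorm_le N D f \<Longrightarrow> 0 \<le> D"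
  unfolding seminorm_le_def using norm_ge_zero order_trans by (metis le0 list.size(3) lists.Nil)

lemma pdiff_funpow: "(pdiff b ^^ m) f = pdiffs (replicate m b) f"
  by (induction m) auto

lemma torus_smooth_funpow: "torus_smooth f \<Longrightarrow> b \<in> Basis \<Longrightarrow> torus_smooth ((pdiff b ^^ m) f)"
  unfolding pdiff_funpow by (intro torus_smooth_pdiffs) auto

lemma funpow_pdiff_Suc: "(pdiff b ^^ Suc m) f = (pdiff b ^^ m) (pdiff b f)"
  by (simp only: funpow_Suc_right o_apply)

lemma seminorm_le_pdiff:
  fixes f :: "'a::euclidean_space \<Rightarrow> 'b::real_normed_vector"
  assumes "seminorm_le (Suc K) D f" "b \<in> Basis"
  shows "seminorm_le K D (pdiff b f)"
  unfolding seminorm_le_def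
proof (intro conjI ballI impI allI)
  show "torus_smooth (pdiff b f)" using assms by (auto simp: seminorm_le_def intro: torus_smooth_pdiff)
  fix bs :: "'a list" and z assume "bs \<in> lists Basis" "length bs \<le> K"
  then have "bs @ [b] \<in> lists Basis" "length (bs @ [b]) \<le> Suc K" using assms by auto
  then have "norm (pdiffs (bs @ [b]) f z) \<le> D" using assms unfolding seminorm_le_def by blast
  then show "norm (pdiffs bs (pdiff b f) z) \<le> D" by (simp add: pdiffs_append)
qed

lemma seminorm_le_exists:
  assumes "torus_smooth f"
  obtains D where "seminorm_le K D f"
proof -
  have "\<forall>bs. \<exists>D. bs \<in> lists Basis \<longrightarrow> (\<forall>z. norm (pdiffs bs f z) \<le> D)"
    using torus_smooth_bounded torus_smooth_pdiffs[OF assms] by metis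
  then obtain D where D: "\<And>bs z. bs \<in> lists Basis \<Longrightarrow> norm (pdiffs bs f z) \<le> D bs" by metis
  let ?I = "{bs. bs \<in> lists (Basis :: 'a set) \<and> length bs \<le> K}"
  have "norm (pdiffs bs f z) \<le> Max (D ` ?I)" if "bs \<in> lists Basis" "length bs \<le> K" for bs z
    using that D finite_multiindices by (intro order_trans[OF D Max_ge]) auto
  then show ?thesis using assms that unfolding seminorm_le_def by blast
qed

lemma seminorm_le_real:
  fixes f :: "real \<Rightarrow> 'b::real_normed_vector"
  shows "seminorm_le K D f \<longleftrightarrow> torus_smooth f \<and> (\<forall>m\<le>K. \<forall>t. norm ((pdiff 1 ^^ m) f t) \<le> D)"
proof -
  have "(\<forall>bs\<in>lists {1 :: real}. length bs \<le> K \<longrightarrow> R bs) \<longleftrightarrow> (\<forall>m\<le>K. R (replicate m 1))" for R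
  proof (intro iffI ballI allI impI)
    fix bs :: "real list" assume "\<forall>m\<le>K. R (replicate m 1)" "bs \<in> lists {1}" "length bs \<le> K"
    moreover from this have "bs = replicate (length bs) 1" by (intro replicate_eqI) auto
    ultimately show "R bs" by metis
  qed (auto simp: in_lists_conv_set)
  then show ?thesis unfolding seminorm_le_def pdiff_funpow by simp
qed

lemma funpow_pdiff_add:
  assumes "torus_smooth f" "torus_smooth g" "b \<in> Basis"
  shows "(pdiff b ^^ m) (\<lambda>z. f z + g z) z = (pdiff b ^^ m) f z + (pdiff b ^^ m) g z"
proof (induction m arbitrary: z)
  case (Suc m)
  then have "(pdiff b ^^ m) (\<lambda>z. f z + g z) = (\<lambda>z. (pdiff b ^^ m) f z + (pdiff b ^^ m) g z)" by blast
  then show ?case by (simp add: pdiff_add torus_smooth_funpow assms)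
qed simp

text \<open>Each application of the product rule doubles the number of terms, whence the factor
  \<open>2 ^ m\<close>.\<close>

lemma norm_funpow_pdiff_mult_le:
  fixes f g :: "real \<Rightarrow> complex"
  assumes "seminorm_le m F f" "seminorm_le m G g"
  shows "norm ((pdiff 1 ^^ m) (\<lambda>t. f t * g t) t) \<le> 2 ^ m * F * G"
  using assms
proof (induction m arbitrary: f g)
  case 0
  then have "norm (f t) \<le> F" "norm (g t) \<le> G" "0 \<le> F"
    using seminorm_le_nonneg[OF 0(1)] by (auto simp: seminorm_le_real)
  then show ?case by (simp add: norm_mult mult_mono)
next
  case (Suc m)
  have sm: "torus_smooth f" "torus_smooth g" using Suc.prems by (auto simp: seminorm_le_def)
  have f: "seminorm_le m F f" "seminorm_le m F (pdiff 1 f)" and g: "seminorm_le m G g" "seminorm_le m G (pdiff 1 g)"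
    using Suc.prems by (auto elim: seminorm_le_mono intro: seminorm_le_pdiff)
  have "pdiff 1 (\<lambda>t. f t * g t) = (\<lambda>t. pdiff 1 f t * g t + f t * pdiff 1 g t)"
    using pdiff_mult[OF sm] by auto
  then have "(pdiff 1 ^^ Suc m) (\<lambda>t. f t * g t) t =
      (pdiff 1 ^^ m) (\<lambda>t. pdiff 1 f t * g t) t + (pdiff 1 ^^ m) (\<lambda>t. f t * pdiff 1 g t) t"
    unfolding funpow_pdiff_Suc
    by (simp add: funpow_pdiff_add torus_smooth_mult torus_smooth_pdiff sm)
  also have "norm \<dots> \<le> 2 ^ m * F * G + 2 ^ m * F * G"
    by (rule norm_triangle_mono[OF Suc.IH[OF f(2) g(1)] Suc.IH[OF f(1) g(2)]])
  also have "\<dots> = 2 ^ Suc m * F * G" by simp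
  finally show ?case .
qed

lemma seminorm_le_mult:
  fixes f g :: "real \<Rightarrow> complex"
  assumes "seminorm_le K F f" "seminorm_le K G g"
  shows "seminorm_le K (2 ^ K * F * G) (\<lambda>t. f t * g t)"
  unfolding seminorm_le_real
proof (intro conjI allI impI)
  show "torus_smooth (\<lambda>t. f t * g t)" using assms by (auto simp: seminorm_le_def intro: torus_smooth_mult)
  fix m t assume m: "m \<le> K"
  have "seminorm_le m F f" "seminorm_le m G g" using assms m by (auto elim: seminorm_le_mono)
  then have "norm ((pdiff 1 ^^ m) (\<lambda>t. f t * g t) t) \<le> 2 ^ m * F * G" by (rule norm_funpow_pdiff_mult_le)
  also have "\<dots> \<le> 2 ^ K * F * G"
    using m assms[THEN seminorm_le_nonneg] by (intro mult_right_mono power_increasing) auto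
  finally show "norm ((pdiff 1 ^^ m) (\<lambda>t. f t * g t) t) \<le> 2 ^ K * F * G" .
qed

lemma seminorm_le_add:
  assumes "seminorm_le K F f" "seminorm_le K G g"
  shows "seminorm_le K (F + G) (\<lambda>z. f z + g z)"
proof -
  have "pdiffs bs (\<lambda>z. f z + g z) = (\<lambda>z. pdiffs bs f z + pdiffs bs g z)" if "bs \<in> lists Basis" for bs
    using that
  proof (induction bs)
    case (Cons b bs)
    then show ?case
      using pdiff_add[of "pdiffs bs f" "pdiffs bs g"] assms
      by (auto simp: seminorm_le_def torus_smooth_pdiffs)
  qed simp
  moreover have "norm (pdiffs bs f z + pdiffs bs g z) \<le> F + G"
    if "bs \<in> lists Basis" "length bs \<le> K" for bs z
    using that assms unfolding seminorm_le_def by (intro norm_triangle_mono) blast+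
  ultimately show ?thesis
    using assms unfolding seminorm_le_def by (simp add: torus_smooth_add)
qed

lemma seminorm_le_const:
  "seminorm_le K (norm c) (\<lambda>z :: 'a::euclidean_space. c :: 'b::real_normed_vector)"
proof -
  have "pdiffs bs (\<lambda>z. c) = (if bs = [] then \<lambda>z. c else (\<lambda>z. 0))" for bs :: "'a list"
    by (induction bs) (auto simp: pdiff_const)
  then show ?thesis by (simp add: seminorm_le_def torus_smooth_const)
qed

section \<open>Integration over the torus\<close>

abbreviation torus_box :: "'a::euclidean_space set" where
  "torus_box \<equiv> cbox 0 ((2 * pi) *\<^sub>R One)"

lemma torus_integrable:
  fixes f :: "'a::euclidean_space \<Rightarrow> complex"
  shows "continuous_on UNIV f \<Longrightarrow> f integrable_on torus_box"
  by (metis continuous_on_subset integrable_continuous subset_UNIV)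

lemma content_torus_box: "measure lborel (torus_box :: 'a::euclidean_space set) = (2 * pi) ^ DIM('a)"
  by (subst content_cbox) (auto simp: inner_simps)

lemma torus_integral_add:
  "continuous_on UNIV f \<Longrightarrow> continuous_on UNIV g \<Longrightarrow>
    torus_integral (\<lambda>z. f z + g z) = torus_integral f + torus_integral g"
  unfolding torus_integral_def by (intro integral_add torus_integrable)

lemma torus_integral_cmult: "torus_integral (\<lambda>z. c * f z) = c * torus_integral f"
  unfolding torus_integral_def by (rule integral_mult_right)

lemma torus_integral_const:
  "torus_integral (\<lambda>z :: 'a::euclidean_space. c) = of_real ((2 * pi) ^ DIM('a)) * c"
  unfolding torus_integral_def integral_const content_torus_box by (simp add: scaleR_conv_of_real)

lemma norm_torus_integral_le:
  fixes f :: "'a::euclidean_space \<Rightarrow> complex"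
  assumes "continuous_on UNIV f" "\<And>z. norm (f z) \<le> D"
  shows "norm (torus_integral f) \<le> (2 * pi) ^ DIM('a) * D"
proof -
  have "0 \<le> D" using assms(2) norm_ge_zero order_trans by blast
  then show ?thesis
    using integrable_bound[OF _ torus_integrable[OF assms(1)]] assms(2)
    unfolding torus_integral_def content_torus_box by (simp add: mult.commute)
qed

text \<open>The shifted box is cut at the hyperplane where coordinate \<open>b\<close> equals 2 pi.
  The part beyond it, moved back by one period, fills exactly the slab of the original box that the
  shift has left.\<close>

lemma torus_integral_shift:
  fixes f :: "'a::euclidean_space \<Rightarrow> complex"
  assumes f: "continuous_on UNIV f" "torus_periodic f" and b: "b \<in> Basis" and s: "0 \<le> s" "s \<le> 2 * pi"
  shows "torus_integral (\<lambda>z. f (z + s *\<^sub>R b)) = torus_integral f"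
proof -
  let ?P = "(2 * pi) *\<^sub>R One :: 'a"
  have Basis_split: "(\<forall>i\<in>Basis. R i) \<longleftrightarrow> R b \<and> (\<forall>i. i \<in> Basis \<longrightarrow> b \<noteq> i \<longrightarrow> R i)" for R
    using b by blast
  have int: "f integrable_on cbox u v" for u v
    by (meson continuous_on_subset f(1) integrable_continuous subset_UNIV)
  have "torus_integral (\<lambda>z. f (z + s *\<^sub>R b)) = integral (cbox (s *\<^sub>R b) (?P + s *\<^sub>R b)) f"
    using integral_shift_cbox_plus[of 0 ?P f "s *\<^sub>R b"]
    unfolding torus_integral_def o_def by (simp add: add.commute)
  also have "\<dots> = integral (cbox (s *\<^sub>R b) (?P + s *\<^sub>R b) \<inter> {x. x \<bullet> b \<le> 2 * pi}) f +
      integral (cbox (s *\<^sub>R b) (?P + s *\<^sub>R b) \<inter> {x. x \<bullet> b \<ge> 2 * pi}) f"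
    by (rule integral_split[OF int b])
  also have "cbox (s *\<^sub>R b) (?P + s *\<^sub>R b) \<inter> {x. x \<bullet> b \<le> 2 * pi} = torus_box \<inter> {x. x \<bullet> b \<ge> s}"
    using b s by (auto simp: mem_box Basis_split inner_simps inner_Basis)
  also have "cbox (s *\<^sub>R b) (?P + s *\<^sub>R b) \<inter> {x. x \<bullet> b \<ge> 2 * pi} =
      cbox (0 + (2 * pi) *\<^sub>R b) ((?P - (2 * pi - s) *\<^sub>R b) + (2 * pi) *\<^sub>R b)"
    using b s by (auto simp: mem_box Basis_split inner_simps inner_Basis)
  also have "integral \<dots> f = integral (cbox 0 (?P - (2 * pi - s) *\<^sub>R b)) (f \<circ> (+) ((2 * pi) *\<^sub>R b))"
    by (rule integral_shift_cbox_plus[symmetric])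
  also have "f \<circ> (+) ((2 * pi) *\<^sub>R b) = f"
    using f(2) b by (auto simp: torus_periodic_def o_def add.commute)
  also have "cbox 0 (?P - (2 * pi - s) *\<^sub>R b) = torus_box \<inter> {x. x \<bullet> b \<le> s}"
    using b s by (auto simp: mem_box Basis_split inner_simps inner_Basis)
  also have "integral (torus_box \<inter> {x. x \<bullet> b \<ge> s}) f + integral (torus_box \<inter> {x. x \<bullet> b \<le> s}) f =
      integral torus_box f"
    using integral_split[OF int b, of _ _ s] by (simp add: add.commute)
  finally show ?thesis by (simp add: torus_integral_def)
qed

text \<open>By periodicity the integral of the translate of \<open>f\<close> by s b does not depend
  on s in [0, 1]. Differentiating under the integral sign at s = 0 gives the claim.\<close>

lemma torus_integral_pdiff:
  fixes f :: "'a::euclidean_space \<Rightarrow> complex"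
  assumes f: "torus_smooth f" and b: "b \<in> Basis"
  shows "torus_integral (pdiff b f) = 0"
proof -
  have "((\<lambda>s. integral torus_box (\<lambda>z. f (z + s *\<^sub>R b))) has_vector_derivative
      integral torus_box (\<lambda>z. pdiff b f (z + 0 *\<^sub>R b))) (at 0 within cbox 0 1)"
  proof (rule leibniz_rule_vector_derivative)
    fix s :: real and z :: 'a
    have lin: "(frechet_derivative f (at w)) (x *\<^sub>R b) = x *\<^sub>R frechet_derivative f (at w) b" for w x
      using linear_frechet_derivative[OF torus_smooth_differentiable[OF f]] linear_scale by blast
    have "((\<lambda>s. z + s *\<^sub>R b) has_derivative (\<lambda>x. x *\<^sub>R b)) (at s)"
      by (auto intro!: derivative_eq_intros)
    from has_derivative_compose[OF this torus_smooth_has_derivative[OF f]]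
    show "((\<lambda>s. f (z + s *\<^sub>R b)) has_vector_derivative pdiff b f (z + s *\<^sub>R b)) (at s within cbox 0 1)"
      unfolding has_vector_derivative_def pdiff_def lin by (rule has_derivative_at_withinI)
  next
    show "(\<lambda>z. f (z + s *\<^sub>R b)) integrable_on torus_box" for s
      by (intro torus_integrable continuous_on_compose2[OF torus_smooth_continuous_on[OF f, of UNIV]]
          continuous_intros) auto
    show "continuous_on (cbox 0 1 \<times> torus_box) (\<lambda>(s, z). pdiff b f (z + s *\<^sub>R b))"
      unfolding split_beta
      by (intro continuous_on_compose2[OF torus_smooth_continuous_on[OF torus_smooth_pdiff[OF f b], of UNIV]]
          continuous_intros) auto
  qed auto
  moreover have "((\<lambda>s. integral torus_box (\<lambda>z. f (z + s *\<^sub>R b))) has_vector_derivative 0) (at 0 within cbox 0 1)"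
  proof (rule has_vector_derivative_transform[OF _ _ has_vector_derivative_const[of "torus_integral f"]])
    show "integral torus_box (\<lambda>z. f (z + s *\<^sub>R b)) = torus_integral f" if "s \<in> cbox 0 1" for s
    proof -
      have "0 \<le> s" "s \<le> 2 * pi" using that pi_gt3 by auto
      from torus_integral_shift[OF torus_smooth_continuous_on[OF f] torus_smooth_periodic[OF f] b this]
      show ?thesis unfolding torus_integral_def .
    qed
  qed simp
  ultimately have "integral torus_box (\<lambda>z. pdiff b f (z + 0 *\<^sub>R b)) = 0"
    by (rule vector_derivative_unique_within_closed_interval[rotated 2]) auto
  then show ?thesis by (simp add: torus_integral_def)
qed

lemma torus_integral_by_parts:
  fixes f g :: "'a::euclidean_space \<Rightarrow> complex"
  assumes f: "torus_smooth f" and g: "torus_smooth g" and b: "b \<in> Basis"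
  shows "torus_integral (\<lambda>z. f z * pdiff b g z) = - torus_integral (\<lambda>z. pdiff b f z * g z)"
proof -
  have "0 = torus_integral (pdiff b (\<lambda>z. f z * g z))"
    by (simp add: torus_integral_pdiff[OF torus_smooth_mult[OF f g] b])
  also have "\<dots> = torus_integral (\<lambda>z. pdiff b f z * g z + f z * pdiff b g z)"
    by (simp add: pdiff_mult[OF f g, abs_def])
  also have "\<dots> = torus_integral (\<lambda>z. pdiff b f z * g z) + torus_integral (\<lambda>z. f z * pdiff b g z)"
    by (intro torus_integral_add torus_smooth_continuous_on torus_smooth_mult torus_smooth_pdiff f g b)
  finally show ?thesis by (simp add: eq_neg_iff_add_eq_0 add.commute)
qed

section \<open>Characters and uniqueness of Fourier coefficients\<close>

definition wave :: "'a::euclidean_space \<Rightarrow> 'a \<Rightarrow> complex" where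
  "wave k z = cis (z \<bullet> k)"

definition lattice :: "'a::euclidean_space set" where
  "lattice = {k. \<forall>b\<in>Basis. k \<bullet> b \<in> \<int>}"

lemma wave_add: "wave (k + l) z = wave k z * wave l z"
  by (simp add: wave_def inner_add_right cis_mult)

lemma norm_wave [simp]: "norm (wave k z) = 1"
  by (simp add: wave_def)

lemma wave_0 [simp]: "wave 0 z = 1"
  by (simp add: wave_def)

lemma continuous_on_wave [continuous_intros]: "continuous_on S (wave k)"
  unfolding wave_def cis_conv_exp by (intro continuous_intros)

lemma wave_has_derivative: "(wave k has_derivative (\<lambda>h. \<i> * of_real (h \<bullet> k) * wave k z)) (at z)"
proof -
  have "((\<lambda>z. \<i> * of_real (z \<bullet> k)) has_derivative (\<lambda>h. \<i> * of_real (h \<bullet> k))) (at z)"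
    by (intro bounded_linear_imp_has_derivative bounded_linear_const_mult bounded_linear_of_real[THEN bounded_linear_compose]
        bounded_linear_inner_left)
  from has_derivative_compose[OF this DERIV_exp[unfolded has_field_derivative_def]]
  show ?thesis unfolding wave_def cis_conv_exp by (simp add: mult_ac)
qed

lemma pdiff_wave: "pdiff b (wave k) z = \<i> * of_real (k \<bullet> b) * wave k z"
  by (rule pdiff_eqI[OF wave_has_derivative, THEN trans]) (simp add: inner_commute)

lemma lattice_uminus: "k \<in> lattice \<Longrightarrow> - k \<in> lattice"
  and lattice_add: "k \<in> lattice \<Longrightarrow> l \<in> lattice \<Longrightarrow> k + l \<in> lattice"
  and lattice_Basis: "b \<in> Basis \<Longrightarrow> b \<in> lattice"
  by (auto simp: lattice_def inner_simps inner_Basis)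

lemma torus_periodic_wave:
  fixes k :: "'a::euclidean_space"
  shows "k \<in> lattice \<Longrightarrow> torus_periodic (wave k)"
  unfolding torus_periodic_def
proof (intro allI ballI)
  fix z b :: 'a assume "k \<in> lattice" "b \<in> Basis"
  then have "b \<bullet> k \<in> \<int>" by (simp add: lattice_def inner_commute)
  then have "cis (2 * pi * (b \<bullet> k)) = 1" by (rule cis_multiple_2pi)
  then show "wave k (z + (2 * pi) *\<^sub>R b) = wave k z"
    by (simp add: wave_def inner_add_left flip: cis_mult)
qed

lemma torus_smooth_wave:
  assumes "k \<in> lattice"
  shows "torus_smooth (wave k)"
proof -
  have "\<exists>c. wave k = (\<lambda>z. c * wave k z)" by (rule exI[of _ 1]) simp
  then show ?thesis
  proof (rule torus_smooth_coinduct[where X = "\<lambda>f. \<exists>c. f = (\<lambda>z. c * wave k z)"])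
    fix f assume "\<exists>c. f = (\<lambda>z. c * wave k z)"
    then obtain c where c: "f = (\<lambda>z. c * wave k z)" by blast
    have D: "(f has_derivative (\<lambda>h. c * (\<i> * of_real (h \<bullet> k) * wave k z))) (at z)" for z
      unfolding c by (intro has_derivative_mult_right wave_has_derivative)
    show "torus_periodic f"
      using torus_periodic_wave[OF assms] by (auto simp: c torus_periodic_def)
    show "f differentiable (at z)" for z using D differentiable_def by blast
    show "\<exists>d. pdiff b f = (\<lambda>z. d * wave k z)" for b
      by (rule exI[of _ "c * (\<i> * of_real (b \<bullet> k))"]) (auto intro!: pdiff_eqI[OF D, THEN trans])
  qed
qed

lemma torus_integral_wave:
  fixes k :: "'a::euclidean_space"
  assumes "k \<in> lattice"
  shows "torus_integral (wave k) = (if k = 0 then of_real ((2 * pi) ^ DIM('a)) else 0)"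
proof (cases "k = 0")
  case True
  moreover have "wave 0 = (\<lambda>z :: 'a. 1)" by auto
  ultimately show ?thesis using torus_integral_const[of 1, where 'a = 'a] by simp
next
  case False
  then obtain b where b: "b \<in> Basis" "k \<bullet> b \<noteq> 0"
    by (metis euclidean_all_zero_iff)
  have "0 = torus_integral (pdiff b (wave k))"
    by (simp add: torus_integral_pdiff[OF torus_smooth_wave[OF assms] b(1)])
  also have "\<dots> = \<i> * of_real (k \<bullet> b) * torus_integral (wave k)"
    unfolding pdiff_wave[abs_def] by (rule torus_integral_cmult)
  finally show ?thesis using b False by simp
qed

text \<open>If \<open>F\<close> has vanishing Fourier coefficients, it is orthogonal to the powers of a nonnegative
  trigonometric polynomial with a strict maximum at a given interior point \<open>p\<close>; these concentrate
  at \<open>p\<close>, which forces \<open>F p = 0\<close>.\<close>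

lemma fourier_uniqueness_interior:
  fixes F :: "'a::euclidean_space \<Rightarrow> complex"
  assumes F: "continuous_on UNIV F"
    and ortho: "\<And>k. k \<in> lattice \<Longrightarrow> torus_integral (\<lambda>z. F z * wave k z) = 0"
    and p: "p \<in> box 0 ((2 * pi) *\<^sub>R One)"
  shows "F p = 0"
proof (rule ccontr)
  assume "F p \<noteq> 0"
  define T where "T z = (\<Prod>b\<in>Basis. (1 + cos (z \<bullet> b - p \<bullet> b)) / 2)" for z :: 'a
  \<comment> \<open>\<open>Z G\<close> says that F G is orthogonal to all characters. A factor (1 +
    cos) / 2 is a combination of the characters with frequencies 0, b and - b, so multiplication by
    it only shifts the frequency and preserves \<open>Z\<close>.\<close>
  define Z where "Z G \<longleftrightarrow> continuous_on UNIV G \<and>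
      (\<forall>k\<in>lattice. torus_integral (\<lambda>z. F z * G z * wave k z) = 0)" for G :: "'a \<Rightarrow> complex"
  have Z_cos: "Z (\<lambda>z. G z * of_real ((1 + cos (z \<bullet> b - p \<bullet> b)) / 2))" if "Z G" "b \<in> Basis" for G b
  proof -
    have cG: "continuous_on UNIV G" and iG: "\<And>k. k \<in> lattice \<Longrightarrow> torus_integral (\<lambda>z. F z * G z * wave k z) = 0"
      using that by (auto simp: Z_def)
    have "torus_integral (\<lambda>z. F z * (G z * of_real ((1 + cos (z \<bullet> b - p \<bullet> b)) / 2)) * wave k z) = 0"
      if k: "k \<in> lattice" for k
    proof -
      have E: "F z * (G z * of_real ((1 + cos (z \<bullet> b - p \<bullet> b)) / 2)) * wave k z =
          (1 / 2) * (F z * G z * wave k z) +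
          (((cis (- (p \<bullet> b)) / 4) * (F z * G z * wave (b + k) z)) +
           ((cis (p \<bullet> b) / 4) * (F z * G z * wave (- b + k) z)))" for z
      proof -
        have c: "complex_of_real ((1 + cos (z \<bullet> b - p \<bullet> b)) / 2) =
            1 / 2 + (cis (- (p \<bullet> b)) / 4 * wave b z + cis (p \<bullet> b) / 4 * wave (- b) z)"
          by (simp add: wave_def cis_mult complex_eq_iff cos_diff sin_diff field_simps)
        show ?thesis unfolding wave_add c by (simp only: algebra_simps times_divide_eq_left mult_1_left)
      qed
      have lat: "b + k \<in> lattice" "- b + k \<in> lattice"
        using k \<open>b \<in> Basis\<close> by (blast intro: lattice_add lattice_uminus lattice_Basis)+
      have cont: "continuous_on UNIV (\<lambda>z. c * (F z * G z * wave l z))" for c l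
        by (intro continuous_intros F cG)
      show ?thesis
        unfolding E by (simp only: torus_integral_add torus_integral_cmult cont continuous_on_add
            iG[OF k] iG[OF lat(1)] iG[OF lat(2)]) simp
    qed
    then show ?thesis
      unfolding Z_def using cG by (intro conjI continuous_intros ballI) auto
  qed
  have Z_prod: "Z (\<lambda>z. G z * of_real (\<Prod>b\<in>B. (1 + cos (z \<bullet> b - p \<bullet> b)) / 2))"
    if "Z G" "B \<subseteq> Basis" for G B
    using finite_subset[OF that(2) finite_Basis] that
  proof (induction B)
    case (insert b B)
    have "Z (\<lambda>z. (G z * of_real (\<Prod>b\<in>B. (1 + cos (z \<bullet> b - p \<bullet> b)) / 2)) *
        of_real ((1 + cos (z \<bullet> b - p \<bullet> b)) / 2))"
      using insert by (intro Z_cos) auto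
    then show ?case using insert by (simp add: mult_ac)
  qed simp
  have Z_T: "Z (\<lambda>z. of_real (T z ^ N))" for N
  proof (induction N)
    case 0
    then show ?case using ortho by (auto simp: Z_def intro: continuous_intros)
  next
    case (Suc N)
    from Z_prod[OF this, of Basis] show ?case by (simp add: T_def mult.commute)
  qed
  have T_cont: "continuous_on S T" for S unfolding T_def by (intro continuous_intros) auto
  have T_p: "T p = 1" by (simp add: T_def)
  have T_le1: "(1 + cos x) / 2 \<le> 1" "0 \<le> (1 + cos x) / 2" for x :: real
    using cos_le_one[of x] cos_ge_minus_one[of x] by (simp_all, linarith)
  have T_nonneg: "0 \<le> T z" for z
    unfolding T_def using T_le1 by (intro prod_nonneg) blast
  have T_less: "T z < 1" if z: "z \<in> torus_box" "z \<noteq> p" for z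
  proof -
    obtain b where b: "b \<in> Basis" "z \<bullet> b \<noteq> p \<bullet> b" using z(2) euclidean_eqI by blast
    \<comment> \<open>The strict inequality uses that \<open>p\<close> is interior. For a boundary
      point the opposite face would contain a second maximum of \<open>T\<close>.\<close>
    have "\<bar>z \<bullet> b - p \<bullet> b\<bar> < 2 * pi"
      using z(1) p b(1) by (fastforce simp: mem_box inner_simps)
    have "cos (z \<bullet> b - p \<bullet> b) \<noteq> 1"
    proof
      assume "cos (z \<bullet> b - p \<bullet> b) = 1"
      then obtain n :: int where n: "z \<bullet> b - p \<bullet> b = of_int n * 2 * pi"
        using cos_one_2pi_int by blast
      then have "\<bar>real_of_int n\<bar> * (2 * pi) < 1 * (2 * pi)"
        using \<open>\<bar>z \<bullet> b - p \<bullet> b\<bar> < 2 * pi\<close> by (simp add: abs_mult)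
      then have "\<bar>real_of_int n\<bar> < 1"
        by (rule mult_right_less_imp_less) simp
      then have "n = 0" by linarith
      then show False using n b(2) by simp
    qed
    then have "cos (z \<bullet> b - p \<bullet> b) < 1" by (meson cos_le_one le_neq_trans)
    then have "(1 + cos (z \<bullet> b - p \<bullet> b)) / 2 < 1" by simp
    moreover have "T z \<le> (1 + cos (z \<bullet> b - p \<bullet> b)) / 2"
    proof -
      have "T z = (1 + cos (z \<bullet> b - p \<bullet> b)) / 2 * (\<Prod>c\<in>Basis - {b}. (1 + cos (z \<bullet> c - p \<bullet> c)) / 2)"
        unfolding T_def using b(1) by (subst prod.remove) auto
      also have "\<dots> \<le> (1 + cos (z \<bullet> b - p \<bullet> b)) / 2 * 1"
        using T_le1 by (intro mult_left_mono prod_le_1) auto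
      finally show ?thesis by simp
    qed
    ultimately show ?thesis by simp
  qed
  \<comment> \<open>Multiplying by \<open>cnj (F p)\<close> makes the value at \<open>p\<close> the
    positive number |F p|^2, so that signs can be compared.\<close>
  define H where "H z = Re (cnj (F p) * F z)" for z
  have H_cont: "continuous_on S H" for S
    unfolding H_def by (intro continuous_intros continuous_on_subset[OF F]) auto
  define e where "e = H p / 2"
  have "H p = (norm (F p))\<^sup>2"
    unfolding H_def cmod_power2 by (simp add: power2_eq_square)
  then have e: "e > 0" "H p > e" using \<open>F p \<noteq> 0\<close> by (auto simp: e_def)
  have "open {z. H z > e}"
    using open_Collect_less[OF continuous_on_const H_cont] .
  then have "open ({z. H z > e} \<inter> box 0 ((2 * pi) *\<^sub>R One))" by (intro open_Int open_box)
  moreover have "p \<in> {z. H z > e} \<inter> box 0 ((2 * pi) *\<^sub>R One)" using p e by simp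
  ultimately obtain d where d: "d > 0" "ball p d \<subseteq> {z. H z > e} \<inter> box 0 ((2 * pi) *\<^sub>R One)"
    by (meson open_contains_ball)
  define K where "K = torus_box - ball p d"
  have "\<exists>r>0. r < 1 \<and> (\<forall>z\<in>K. T z \<le> r)"
  proof (cases "K = {}")
    case True
    then show ?thesis by (intro exI[of _ "1 / 2"]) simp
  next
    case False
    have "compact K" unfolding K_def by (intro compact_diff) auto
    from continuous_attains_sup[OF this False T_cont]
    obtain w where w: "w \<in> K" "\<And>z. z \<in> K \<Longrightarrow> T z \<le> T w" by blast
    have "T w < 1" using w(1) d(1) by (intro T_less) (auto simp: K_def)
    then show ?thesis using w(2) by (intro exI[of _ "max (1 / 2) (T w)"]) (auto simp: le_max_iff_disj)
  qed
  then obtain r where r: "r > 0" "r < 1" "\<And>z. z \<in> torus_box - ball p d \<Longrightarrow> T z \<le> r"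
    unfolding K_def by blast
  \<comment> \<open>A level strictly between \<open>r\<close> and the maximum 1: \<open>T\<close>
    exceeds \<open>r'\<close> on a small box around \<open>p\<close> and is at most \<open>r\<close>
    off the ball, so the powers of \<open>T\<close> separate the two regions geometrically.\<close>
  define r' where "r' = (1 + r) / 2"
  have r': "r < r'" "r' < 1" using r by (auto simp: r'_def)
  have "open ({z. T z > r'} \<inter> ball p d)"
    by (intro open_Int open_ball open_Collect_less[OF continuous_on_const T_cont])
  moreover have "p \<in> {z. T z > r'} \<inter> ball p d" using T_p r' d by simp
  ultimately obtain u v where uv: "p \<in> box u v" "cbox u v \<subseteq> {z. T z > r'} \<inter> ball p d"
    by (metis open_contains_cbox)
  have content_pos: "measure lborel (cbox u v) > 0"
    using uv(1) by (subst content_pos_lt_eq) (auto simp: mem_box dest: bspec intro: less_trans)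
  have uv_sub: "cbox u v \<subseteq> torus_box" using uv(2) d(2) box_subset_cbox by blast
  obtain M where M: "M \<ge> 0" "\<And>z. z \<in> torus_box \<Longrightarrow> \<bar>H z\<bar> \<le> M"
  proof -
    have "compact (H ` torus_box)" by (intro compact_continuous_image H_cont compact_cbox)
    then obtain M where "\<And>z. z \<in> torus_box \<Longrightarrow> norm (H z) \<le> M"
      using compact_imp_bounded bounded_iff by (metis imageI)
    then show ?thesis using that[of "max 0 M"] by (force simp: le_max_iff_disj)
  qed
  \<comment> \<open>The integral of H T^N is 0, yet its integrand is at least e r'^N on the small
    box, non-negative on the rest of the ball and at least - M r^N elsewhere. As r' > r, this fails
    for large N.\<close>
  have bound: "e * r' ^ N * measure lborel (cbox u v) \<le> M * r ^ N * measure lborel (torus_box :: 'a set)" for N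
  proof -
    have int: "((\<lambda>z. H z * T z ^ N) has_integral 0) torus_box"
    proof -
      have 0: "torus_integral (\<lambda>z. F z * of_real (T z ^ N)) = 0"
        using bspec[OF conjunct2[OF Z_T[of N, unfolded Z_def]], of 0] by (simp add: lattice_def)
      have "(\<lambda>z. cnj (F p) * (F z * of_real (T z ^ N))) integrable_on torus_box"
        by (intro torus_integrable continuous_intros F T_cont)
      then have "((\<lambda>z. cnj (F p) * (F z * of_real (T z ^ N))) has_integral
          torus_integral (\<lambda>z. cnj (F p) * (F z * of_real (T z ^ N)))) torus_box"
        unfolding torus_integral_def by (rule integrable_integral)
      then have "((\<lambda>z. cnj (F p) * (F z * of_real (T z ^ N))) has_integral 0) torus_box"
        unfolding torus_integral_cmult 0 by simp
      from has_integral_linear[OF this bounded_linear_Re]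
      show ?thesis by (simp add: o_def H_def algebra_simps)
    qed
    have "((\<lambda>z. if z \<in> cbox u v then e * r' ^ N else 0) has_integral measure lborel (cbox u v) *\<^sub>R (e * r' ^ N)) torus_box"
      by (intro has_integral_restrict_closed_subinterval uv_sub has_integral_const)
    from has_integral_diff[OF this has_integral_const[of "M * r ^ N" 0 "(2 * pi) *\<^sub>R One"]]
    have "((\<lambda>z. (if z \<in> cbox u v then e * r' ^ N else 0) - M * r ^ N) has_integral
        measure lborel (cbox u v) *\<^sub>R (e * r' ^ N) - measure lborel (torus_box :: 'a set) *\<^sub>R (M * r ^ N)) torus_box" .
    then have "measure lborel (cbox u v) *\<^sub>R (e * r' ^ N) - measure lborel (torus_box :: 'a set) *\<^sub>R (M * r ^ N) \<le> 0"
    proof (rule has_integral_le[OF _ int])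
      fix z :: 'a assume z: "z \<in> torus_box"
      have Mr: "0 \<le> M * r ^ N" using M r by simp
      consider "z \<in> cbox u v" | "z \<in> ball p d" "z \<notin> cbox u v" | "z \<in> torus_box - ball p d"
        using z by blast
      then show "(if z \<in> cbox u v then e * r' ^ N else 0) - M * r ^ N \<le> H z * T z ^ N"
      proof cases
        case 1
        then have "e \<le> H z" "r' \<le> T z" using uv(2) d(2) by force+
        then have "e * r' ^ N \<le> H z * T z ^ N"
          using e r r' by (intro mult_mono power_mono) auto
        then show ?thesis using 1 Mr by simp
      next
        case 2
        then have "0 \<le> H z" using d(2) e by force
        then have "0 \<le> H z * T z ^ N" using T_nonneg by simp
        then show ?thesis using 2(2) Mr by simp
      next
        case 3
        then have "z \<notin> cbox u v" using uv(2) by blast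
        have "\<bar>H z * T z ^ N\<bar> \<le> M * r ^ N"
          unfolding abs_mult using 3 r(3) M T_nonneg by (intro mult_mono) (auto simp: power_mono)
        then show ?thesis using \<open>z \<notin> cbox u v\<close> by auto
      qed
    qed
    then show ?thesis by (simp add: mult_ac)
  qed
  let ?K = "M * measure lborel (torus_box :: 'a set) / (e * measure lborel (cbox u v))"
  have "(r' / r) ^ N \<le> ?K" for N
    using bound[of N] r e content_pos by (simp add: field_simps)
  moreover obtain N where "?K < (r' / r) ^ N"
    using real_arch_pow[of "r' / r" ?K] r r' by auto
  ultimately show False using not_less by blast
qed

text \<open>Periodicity moves \<open>z\<close> into the closed box, and continuity carries the
  vanishing from its interior to the boundary.\<close>

lemma fourier_uniqueness:
  fixes F :: "'a::euclidean_space \<Rightarrow> complex"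
  assumes F: "torus_smooth F"
    and ortho: "\<And>k. k \<in> lattice \<Longrightarrow> torus_integral (\<lambda>z. F z * wave k z) = 0"
  shows "F z = 0"
proof -
  obtain y where y: "y \<in> torus_box" "F y = F z"
    using torus_periodic_reduce[OF torus_smooth_periodic[OF F]] .
  have ne: "box 0 ((2 * pi) *\<^sub>R One :: 'a) \<noteq> {}" by (simp add: box_ne_empty)
  have "F y = 0"
  proof (rule continuous_constant_on_closure[of "box 0 ((2 * pi) *\<^sub>R One)" F])
    show "continuous_on (closure (box 0 ((2 * pi) *\<^sub>R One))) F"
      by (rule torus_smooth_continuous_on[OF F])
    show "F x = 0" if "x \<in> box 0 ((2 * pi) *\<^sub>R One)" for x
      using fourier_uniqueness_interior[OF torus_smooth_continuous_on[OF F] ortho that] .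
    show "y \<in> closure (box 0 ((2 * pi) *\<^sub>R One))" using y(1) closure_box[OF ne] by simp
  qed
  then show ?thesis using y(2) by simp
qed

lemma torus_integral_pdiffs_wave:
  fixes f :: "'a::euclidean_space \<Rightarrow> complex"
  assumes "torus_smooth f" "b \<in> Basis" "k \<in> lattice"
  shows "torus_integral (\<lambda>z. pdiffs (replicate q b) f z * wave k z) =
    (- \<i> * of_real (k \<bullet> b)) ^ q * torus_integral (\<lambda>z. f z * wave k z)"
proof (induction q)
  case (Suc q)
  let ?g = "pdiffs (replicate q b) f"
  have g: "torus_smooth ?g" using assms by (intro torus_smooth_pdiffs) auto
  have "torus_integral (\<lambda>z. pdiffs (replicate (Suc q) b) f z * wave k z) =
      - torus_integral (\<lambda>z. ?g z * pdiff b (wave k) z)"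
    using torus_integral_by_parts[OF g torus_smooth_wave[OF assms(3)] assms(2)] by simp
  also have "\<dots> = - (\<i> * of_real (k \<bullet> b)) * torus_integral (\<lambda>z. ?g z * wave k z)"
    using torus_integral_cmult[of "\<i> * of_real (k \<bullet> b)" "\<lambda>z. ?g z * wave k z"]
    by (simp add: pdiff_wave mult_ac)
  finally show ?case using Suc by simp
qed simp

text \<open>Integration by parts in the direction of the largest coordinate of \<open>k\<close>.
  Derivatives are bounded only along coordinates where \<open>k\<close> does not vanish: one
  application has a frequency with time component 0 and an integrand whose time derivatives are not
  controlled.\<close>

lemma fourier_decay:
  fixes f :: "'a::euclidean_space \<Rightarrow> complex"
  assumes f: "torus_smooth f" and k: "k \<in> lattice"
    and D: "\<And>b m z. b \<in> Basis \<Longrightarrow> m \<le> q \<Longrightarrow> m = 0 \<or> k \<bullet> b \<noteq> 0 \<Longrightarrow>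
      norm (pdiffs (replicate m b) f z) \<le> D"
  shows "norm (torus_integral (\<lambda>z. f z * wave k z)) * (1 + norm k) ^ q \<le>
    (1 + real DIM('a)) ^ q * (2 * pi) ^ DIM('a) * D"
proof -
  let ?I = "norm (torus_integral (\<lambda>z. f z * wave k z))"
  have *: "?I * \<bar>k \<bullet> b\<bar> ^ m \<le> (2 * pi) ^ DIM('a) * D" if "b \<in> Basis" "m \<le> q" "m = 0 \<or> k \<bullet> b \<noteq> 0" for b m
  proof -
    have "?I * \<bar>k \<bullet> b\<bar> ^ m = norm (torus_integral (\<lambda>z. pdiffs (replicate m b) f z * wave k z))"
      unfolding torus_integral_pdiffs_wave[OF f that(1) k]
      by (simp add: norm_mult norm_power power_mult_distrib mult.commute)
    also have "\<dots> \<le> (2 * pi) ^ DIM('a) * D"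
    proof (rule norm_torus_integral_le)
      show "continuous_on UNIV (\<lambda>z. pdiffs (replicate m b) f z * wave k z)"
        using that f by (intro continuous_intros torus_smooth_continuous_on torus_smooth_pdiffs) auto
      show "norm (pdiffs (replicate m b) f z * wave k z) \<le> D" for z
        using D[of b m z] that by (simp add: norm_mult)
    qed
    finally show ?thesis .
  qed
  define m where "m = Max ((\<lambda>b. \<bar>k \<bullet> b\<bar>) ` Basis)"
  have "m \<in> (\<lambda>b. \<bar>k \<bullet> b\<bar>) ` Basis" unfolding m_def by (intro Max_in) auto
  then obtain b where b: "b \<in> Basis" "m = \<bar>k \<bullet> b\<bar>" by blast
  have "norm k \<le> (\<Sum>b\<in>Basis. \<bar>k \<bullet> b\<bar>)" by (rule norm_le_l1)
  also have "\<dots> \<le> (\<Sum>b\<in>(Basis::'a set). m)" unfolding m_def by (intro sum_mono Max_ge) auto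
  finally have nk: "norm k \<le> DIM('a) * m" by simp
  \<comment> \<open>If the largest coordinate is at most 1, then norm k is at most the dimension and
    l = 0 suffices, which includes k = 0. Otherwise all l = q integrations by parts are
    used.\<close>
  have "\<exists>l\<le>q. (l = 0 \<or> m \<noteq> 0) \<and> (1 + norm k) ^ q \<le> (1 + real DIM('a)) ^ q * m ^ l"
  proof (cases "m \<le> 1")
    case True
    then have "DIM('a) * m \<le> DIM('a)" using mult_left_mono[of m 1 "real DIM('a)"] by simp
    then have "norm k \<le> DIM('a)" using nk by linarith
    then have "(1 + norm k) ^ q \<le> (1 + real DIM('a)) ^ q" by (intro power_mono) auto
    then show ?thesis by (intro exI[of _ 0]) auto
  next
    case False
    then have "1 + norm k \<le> (1 + real DIM('a)) * m" using nk by (simp add: algebra_simps)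
    then have "(1 + norm k) ^ q \<le> ((1 + real DIM('a)) * m) ^ q" by (intro power_mono) auto
    then show ?thesis using False by (intro exI[of _ q]) (auto simp: power_mult_distrib)
  qed
  then obtain l where l: "l \<le> q" "l = 0 \<or> m \<noteq> 0" "(1 + norm k) ^ q \<le> (1 + real DIM('a)) ^ q * m ^ l" by blast
  have "?I * (1 + norm k) ^ q \<le> ?I * ((1 + real DIM('a)) ^ q * m ^ l)"
    using l by (intro mult_left_mono) auto
  also have "\<dots> = (1 + real DIM('a)) ^ q * (?I * \<bar>k \<bullet> b\<bar> ^ l)" by (simp add: b(2))
  also have "\<dots> \<le> (1 + real DIM('a)) ^ q * ((2 * pi) ^ DIM('a) * D)"
    using *[OF b(1) l(1)] l(2) b(2) by (intro mult_left_mono) auto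
  finally show ?thesis by (simp add: mult.assoc)
qed

section \<open>Fourier series with rapidly decreasing coefficients\<close>

text \<open>The exponent provides a factor (1 + |k . b|)^(-2) for each coordinate b. A finite set of
  frequencies lies in a grid with finitely many values per coordinate, and over the grid the sum of
  products is a power of a one-dimensional sum.\<close>

lemma summable_lattice:
  "(\<lambda>k. 1 / (1 + norm k) ^ (2 * DIM('a))) summable_on (lattice :: 'a::euclidean_space set)"
proof (rule nonneg_bdd_above_summable_on)
  define g where "g x = 1 / (1 + \<bar>x\<bar>)\<^sup>2" for x :: real
  have g_nonneg: "0 \<le> g x" for x by (simp add: g_def)
  have summ: "summable (\<lambda>n. g (real n))"
  proof -
    have "summable (\<lambda>n. inverse ((real (Suc n))\<^sup>2))"
      using inverse_power_summable[of 2, where 'a = real] by (subst summable_Suc_iff) auto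
    then show ?thesis by (simp add: g_def field_simps)
  qed
  \<comment> \<open>The absolute value is injective on the non-negative and on the negative integers
    separately, whence the factor 2.\<close>
  define G where "G = 2 * (\<Sum>n. g (real n))"
  have half: "(\<Sum>i\<in>W. g (of_int i)) \<le> (\<Sum>n. g (real n))"
    if "finite W" "inj_on (\<lambda>i. nat \<bar>i\<bar>) W" for W :: "int set"
  proof -
    have "(\<Sum>i\<in>W. g (of_int i)) = (\<Sum>n\<in>(\<lambda>i. nat \<bar>i\<bar>) ` W. g (real n))"
      by (subst sum.reindex[OF that(2)]) (auto simp: g_def)
    also have "\<dots> \<le> (\<Sum>n. g (real n))"
      by (rule sum_le_suminf) (use that(1) summ g_nonneg in auto)
    finally show ?thesis .
  qed
  have G: "(\<Sum>x\<in>V. g x) \<le> G" if V: "finite V" "V \<subseteq> \<int>" for V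
  proof -
    obtain W :: "int set" where W: "V = of_int ` W"
      using V(2) by (metis Ints_def subset_imageE)
    have "finite W"
      using V(1) unfolding W by (rule finite_imageD) (auto simp: inj_on_def)
    have "(\<Sum>x\<in>V. g x) = (\<Sum>i\<in>W. g (of_int i))"
      unfolding W by (subst sum.reindex) (auto simp: inj_on_def)
    also have "\<dots> = (\<Sum>i\<in>{i\<in>W. 0 \<le> i}. g (of_int i)) + (\<Sum>i\<in>{i\<in>W. \<not> 0 \<le> i}. g (of_int i))"
      using \<open>finite W\<close> by (subst sum.union_disjoint[symmetric]) (auto intro!: sum.cong)
    also have "\<dots> \<le> G"
      unfolding G_def mult_2 using \<open>finite W\<close> by (intro add_mono half) (auto simp: inj_on_def)
    finally show ?thesis .
  qed
  show "bdd_above (sum (\<lambda>k. 1 / (1 + norm k) ^ (2 * DIM('a))) ` {F. F \<subseteq> (lattice :: 'a set) \<and> finite F})"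
  proof (rule bdd_aboveI2, safe)
    fix F :: "'a set" assume F: "F \<subseteq> lattice" "finite F"
    define V where "V = (\<Union>k\<in>F. (\<lambda>b. k \<bullet> b) ` Basis)"
    have V: "finite V" "V \<subseteq> \<int>" using F by (auto simp: V_def lattice_def)
    let ?coords = "\<lambda>k. restrict (\<lambda>b. k \<bullet> b) Basis"
    have inj: "inj_on ?coords F"
    proof (rule inj_onI)
      fix k l assume eq: "?coords k = ?coords l"
      have "k \<bullet> b = l \<bullet> b" if "b \<in> Basis" for b
        using fun_cong[OF eq, of b] that by simp
      then show "k = l" by (rule euclidean_eqI)
    qed
    have "1 / (1 + norm k) ^ (2 * DIM('a)) \<le> (\<Prod>b\<in>Basis. g (?coords k b))" for k :: 'a
    proof -
      have "(\<Prod>b\<in>(Basis :: 'a set). 1 / (1 + norm k)\<^sup>2) \<le> (\<Prod>b\<in>Basis. g (?coords k b))"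
        by (intro prod_mono) (auto simp: g_def Basis_le_norm add_pos_nonneg intro!: frac_le power_mono)
      then show ?thesis by (simp add: power_one_over power_mult)
    qed
    then have "(\<Sum>k\<in>F. 1 / (1 + norm k) ^ (2 * DIM('a))) \<le> (\<Sum>k\<in>F. \<Prod>b\<in>Basis. g (?coords k b))"
      by (intro sum_mono)
    also have "\<dots> = (\<Sum>x\<in>?coords ` F. \<Prod>b\<in>Basis. g (x b))"
      by (subst sum.reindex[OF inj]) simp
    also have "\<dots> \<le> (\<Sum>x\<in>PiE (Basis :: 'a set) (\<lambda>_. V). \<Prod>b\<in>Basis. g (x b))"
      by (rule sum_mono2) (use V g_nonneg in \<open>auto simp: V_def intro!: finite_PiE prod_nonneg\<close>)
    also have "\<dots> = (\<Sum>x\<in>V. g x) ^ DIM('a)"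
      using V by (subst prod_sum_PiE[symmetric]) auto
    also have "\<dots> \<le> G ^ DIM('a)"
      by (rule power_mono) (use G[OF V] g_nonneg in \<open>auto intro!: sum_nonneg\<close>)
    finally show "(\<Sum>k\<in>F. 1 / (1 + norm k) ^ (2 * DIM('a))) \<le> G ^ DIM('a)" .
  qed
qed simp

definition rapidly_decreasing :: "('a::euclidean_space \<Rightarrow> complex) \<Rightarrow> bool" where
  "rapidly_decreasing c \<longleftrightarrow> (\<forall>q. \<exists>C. \<forall>k\<in>lattice. norm (c k) * (1 + norm k) ^ q \<le> C)"

definition wave_series :: "('a::euclidean_space \<Rightarrow> complex) \<Rightarrow> 'a \<Rightarrow> complex" where
  "wave_series c z = (\<Sum>\<^sub>\<infinity>k\<in>lattice. c k * wave k z)"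

lemma rapidly_decreasing_summable:
  fixes c :: "'a::euclidean_space \<Rightarrow> complex"
  assumes "rapidly_decreasing c"
  shows "(\<lambda>k. norm (c k) * (1 + norm k) ^ q) summable_on lattice"
proof -
  obtain C where C: "\<And>k. k \<in> lattice \<Longrightarrow> norm (c k) * (1 + norm k) ^ (q + 2 * DIM('a)) \<le> C"
    using assms unfolding rapidly_decreasing_def by blast
  show ?thesis
  proof (rule summable_on_comparison_test)
    show "(\<lambda>k. C * (1 / (1 + norm k) ^ (2 * DIM('a)))) summable_on (lattice :: 'a set)"
      by (intro summable_on_cmult_right summable_lattice)
    show "norm (c k) * (1 + norm k) ^ q \<le> C * (1 / (1 + norm k) ^ (2 * DIM('a)))" if "k \<in> lattice" for k
    proof -
      have "0 < (1 + norm k) ^ (2 * DIM('a))" by (intro zero_less_power) (simp add: add_pos_nonneg)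
      then show ?thesis using C[OF that] by (simp add: field_simps power_add)
    qed
  qed auto
qed

lemma rapidly_decreasing_bounded_mult:
  assumes "rapidly_decreasing c" and "\<And>k. norm (m k) \<le> B * (1 + norm k) ^ p" and "0 \<le> B"
  shows "rapidly_decreasing (\<lambda>k. m k * c k)"
  unfolding rapidly_decreasing_def
proof
  fix q
  obtain C where C: "\<And>k. k \<in> lattice \<Longrightarrow> norm (c k) * (1 + norm k) ^ (p + q) \<le> C"
    using assms unfolding rapidly_decreasing_def by blast
  have "norm (m k * c k) * (1 + norm k) ^ q \<le> B * C" if "k \<in> lattice" for k
  proof -
    have "norm (m k * c k) * (1 + norm k) ^ q \<le> B * (1 + norm k) ^ p * norm (c k) * (1 + norm k) ^ q"
      unfolding norm_mult using assms(2) by (intro mult_right_mono) auto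
    also have "\<dots> = B * (norm (c k) * (1 + norm k) ^ (p + q))" by (simp add: power_add mult_ac)
    also have "\<dots> \<le> B * C" using C[OF that] assms(3) by (rule mult_left_mono)
    finally show ?thesis .
  qed
  then show "\<exists>C. \<forall>k\<in>lattice. norm (m k * c k) * (1 + norm k) ^ q \<le> C" by blast
qed

lemma rapidly_decreasing_abs_summable:
  assumes "rapidly_decreasing c" "\<And>k. norm (m k) \<le> B * (1 + norm k) ^ p"
  shows "(\<lambda>k. norm (m k * c k)) summable_on lattice"
proof (rule summable_on_comparison_test)
  show "(\<lambda>k. B * (norm (c k) * (1 + norm k) ^ p)) summable_on lattice"
    by (intro summable_on_cmult_right rapidly_decreasing_summable assms)
  show "norm (m k * c k) \<le> B * (norm (c k) * (1 + norm k) ^ p)" for k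
    using mult_right_mono[OF assms(2)[of k], of "norm (c k)"] by (simp add: norm_mult mult_ac)
qed simp

lemma rapidly_decreasing_has_sum:
  assumes "rapidly_decreasing c" "\<And>k. norm (m k) \<le> B * (1 + norm k) ^ p"
  shows "((\<lambda>k. m k * c k) has_sum (\<Sum>\<^sub>\<infinity>k\<in>lattice. m k * c k)) lattice"
  by (rule has_sum_infsum[OF abs_summable_summable[OF rapidly_decreasing_abs_summable[OF assms]]])

lemma norm_cis_remainder: "norm (cis x - 1 - \<i> * of_real x) \<le> x\<^sup>2"
  using Taylor_exp[of "\<i> * of_real x" 1] by (simp add: cis_conv_exp norm_mult power2_eq_square diff_diff_eq)

text \<open>Termwise differentiation by a direct remainder estimate: |cis x - 1 - i x| is at most
  x^2, so the total remainder is at most |y - z|^2 times the sum of |c_k| (1 + |k|)^2.\<close>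

lemma has_derivative_wave_series:
  fixes c :: "'a::euclidean_space \<Rightarrow> complex"
  assumes c: "rapidly_decreasing c"
  shows "(wave_series c has_derivative (\<lambda>h. \<Sum>\<^sub>\<infinity>k\<in>lattice. (\<i> * of_real (h \<bullet> k) * wave k z) * c k)) (at z)"
proof -
  let ?D = "\<lambda>h. \<Sum>\<^sub>\<infinity>k\<in>lattice. (\<i> * of_real (h \<bullet> k) * wave k z) * c k"
  let ?K1 = "\<Sum>\<^sub>\<infinity>k\<in>lattice. norm (c k) * (1 + norm k) ^ 1"
  let ?K2 = "\<Sum>\<^sub>\<infinity>k\<in>lattice. norm (c k) * (1 + norm k) ^ 2"
  have bd: "norm (\<i> * of_real (h \<bullet> k) * wave k z) \<le> norm h * (1 + norm k) ^ 1" for h k :: 'a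
    using Cauchy_Schwarz_ineq2[of h k] mult_left_mono[of "norm k" "1 + norm k" "norm h"]
    by (simp add: norm_mult)
  have D: "((\<lambda>k. (\<i> * of_real (h \<bullet> k) * wave k z) * c k) has_sum ?D h) lattice" for h
    by (rule rapidly_decreasing_has_sum[OF c bd])
  have S: "((\<lambda>k. wave k y * c k) has_sum wave_series c y) lattice" for y
    using rapidly_decreasing_has_sum[OF c, of "\<lambda>k. wave k y" 1 0]
    by (simp add: wave_series_def mult.commute)
  have "bounded_linear ?D"
  proof (rule bounded_linear_intro[where K = ?K1])
    show "?D (h + h') = ?D h + ?D h'" for h h'
      using has_sum_add[OF D[of h] D[of h']] infsumI
      by (fastforce simp: inner_add_left algebra_simps)
    show "?D (r *\<^sub>R h) = r *\<^sub>R ?D h" for r h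
      using has_sum_cmult_right[OF D[of h], of "of_real r"] infsumI
      by (fastforce simp: scaleR_conv_of_real algebra_simps)
    show "norm (?D h) \<le> norm h * ?K1" for h
    proof (rule norm_infsum_le[OF D])
      show "((\<lambda>k. norm h * (norm (c k) * (1 + norm k) ^ 1)) has_sum norm h * ?K1) lattice"
        by (intro has_sum_cmult_right has_sum_infsum rapidly_decreasing_summable c)
      show "norm (\<i> * of_real (h \<bullet> k) * wave k z * c k) \<le> norm h * (norm (c k) * (1 + norm k) ^ 1)" for k
        using mult_right_mono[OF bd[of h k], of "norm (c k)"] by (simp add: norm_mult mult_ac)
    qed
  qed
  moreover have "norm (wave_series c y - wave_series c z - ?D (y - z)) \<le> (norm (y - z))\<^sup>2 * ?K2" for y
  proof (rule norm_infsum_le)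
    show "((\<lambda>k. wave k y * c k - wave k z * c k - (\<i> * of_real ((y - z) \<bullet> k) * wave k z) * c k) has_sum
        wave_series c y - wave_series c z - ?D (y - z)) lattice"
      unfolding diff_conv_add_uminus by (intro has_sum_add S D has_sum_uminusI)
    show "((\<lambda>k. (norm (y - z))\<^sup>2 * (norm (c k) * (1 + norm k) ^ 2)) has_sum (norm (y - z))\<^sup>2 * ?K2) lattice"
      by (intro has_sum_cmult_right has_sum_infsum rapidly_decreasing_summable c)
    fix k :: 'a
    have "wave k y = wave k z * cis ((y - z) \<bullet> k)"
      by (simp add: wave_def cis_mult inner_diff_left)
    then have "wave k y * c k - wave k z * c k - (\<i> * of_real ((y - z) \<bullet> k) * wave k z) * c k =
        wave k z * ((cis ((y - z) \<bullet> k) - 1 - \<i> * of_real ((y - z) \<bullet> k)) * c k)"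
      by (simp only: algebra_simps mult_1_left mult_1_right)
    then have "norm (wave k y * c k - wave k z * c k - (\<i> * of_real ((y - z) \<bullet> k) * wave k z) * c k) =
        norm (cis ((y - z) \<bullet> k) - 1 - \<i> * of_real ((y - z) \<bullet> k)) * norm (c k)"
      by (simp only: norm_mult norm_wave mult_1_left)
    also have "\<dots> \<le> ((y - z) \<bullet> k)\<^sup>2 * norm (c k)"
      by (intro mult_right_mono norm_cis_remainder) simp
    also have "\<dots> \<le> (norm (y - z) * (1 + norm k))\<^sup>2 * norm (c k)"
    proof (intro mult_right_mono)
      have "\<bar>(y - z) \<bullet> k\<bar> \<le> norm (y - z) * (1 + norm k)"
        using Cauchy_Schwarz_ineq2[of "y - z" k] mult_left_mono[of "norm k" "1 + norm k" "norm (y - z)"] by simp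
      then show "((y - z) \<bullet> k)\<^sup>2 \<le> (norm (y - z) * (1 + norm k))\<^sup>2"
        by (metis abs_le_square_iff abs_of_nonneg abs_ge_zero order_trans)
    qed simp
    finally show "norm (wave k y * c k - wave k z * c k - (\<i> * of_real ((y - z) \<bullet> k) * wave k z) * c k)
        \<le> (norm (y - z))\<^sup>2 * (norm (c k) * (1 + norm k) ^ 2)"
      by (simp add: power_mult_distrib mult_ac)
  qed
  then have "norm (wave_series c y - wave_series c z - ?D (y - z)) / norm (y - z) \<le> norm (y - z) * ?K2"
    if "y \<noteq> z" for y
    using that by (simp add: divide_le_eq power2_eq_square mult_ac)
  moreover have "((\<lambda>y. norm (y - z) * ?K2) \<longlongrightarrow> 0) (at z)"
    by (auto intro!: tendsto_eq_intros)
  ultimately show ?thesis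
    by (intro has_derivativeI_sandwich[of 1]) auto
qed

lemma pdiff_wave_series:
  assumes "rapidly_decreasing c"
  shows "pdiff b (wave_series c) = wave_series (\<lambda>k. \<i> * of_real (b \<bullet> k) * c k)"
  by (rule ext, rule pdiff_eqI[OF has_derivative_wave_series[OF assms], THEN trans])
    (simp add: wave_series_def mult_ac)

lemma rapidly_decreasing_pdiff:
  assumes "rapidly_decreasing c" "b \<in> Basis"
  shows "rapidly_decreasing (\<lambda>k. \<i> * of_real (b \<bullet> k) * c k)"
  using assms(2) by (intro rapidly_decreasing_bounded_mult[OF assms(1), of _ 1 1])
    (auto simp: norm_mult inner_commute intro: order_trans[OF Basis_le_norm])

lemma torus_smooth_wave_series:
  fixes c :: "'a::euclidean_space \<Rightarrow> complex"
  assumes "rapidly_decreasing c"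
  shows "torus_smooth (wave_series c)"
proof -
  have "\<exists>d. rapidly_decreasing d \<and> wave_series c = wave_series d" using assms by blast
  then show ?thesis
  proof (rule torus_smooth_coinduct[where X = "\<lambda>f. \<exists>d. rapidly_decreasing d \<and> f = wave_series d"])
    fix f :: "'a \<Rightarrow> complex" assume "\<exists>d. rapidly_decreasing d \<and> f = wave_series d"
    then obtain d where d: "rapidly_decreasing d" "f = wave_series d" by blast
    show "torus_periodic f"
      using torus_periodic_wave[where 'a = 'a] unfolding d(2) wave_series_def torus_periodic_def
      by (auto intro!: infsum_cong)
    show "f differentiable (at z)" for z
      using has_derivative_wave_series[OF d(1)] d(2) by (auto simp: differentiable_def)
    show "\<exists>e. rapidly_decreasing e \<and> pdiff b f = wave_series e" if "b \<in> Basis" for b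
      using pdiff_wave_series[OF d(1)] rapidly_decreasing_pdiff[OF d(1) that] d(2) by blast
  qed
qed

text \<open>Bounds all seminorms of order \<open>q\<close> by one weighted absolute sum of the
  coefficients. Applied to a tail of the series, this is convergence in the smooth topology.\<close>

lemma norm_pdiffs_wave_series_le:
  assumes "rapidly_decreasing c" "bs \<in> lists Basis" "length bs \<le> q"
  shows "norm (pdiffs bs (wave_series c) z) \<le> (\<Sum>\<^sub>\<infinity>k\<in>lattice. norm (c k) * (1 + norm k) ^ q)"
proof -
  define m where "m bs k = (\<Prod>b\<leftarrow>bs. \<i> * complex_of_real (b \<bullet> k))" for bs and k :: 'a
  have m: "norm (m bs k) \<le> 1 * (1 + norm k) ^ length bs" if "bs \<in> lists Basis" for bs k
    using that
  proof (induction bs)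
    case (Cons b bs)
    have "norm (m (b # bs) k) = \<bar>k \<bullet> b\<bar> * norm (m bs k)" by (simp add: m_def norm_mult inner_commute)
    also have "\<dots> \<le> (1 + norm k) * (1 * (1 + norm k) ^ length bs)"
      using Cons by (intro mult_mono) (auto intro: order_trans[OF Basis_le_norm])
    finally show ?case by simp
  qed (simp add: m_def)
  have "pdiffs bs (wave_series c) = wave_series (\<lambda>k. m bs k * c k)" if "bs \<in> lists Basis" for bs
    using that
  proof (induction bs)
    case (Cons b bs)
    then show ?case
      using pdiff_wave_series[OF rapidly_decreasing_bounded_mult[OF assms(1) m]]
      by (simp add: m_def mult_ac)
  qed (simp add: m_def)
  then have "pdiffs bs (wave_series c) z = (\<Sum>\<^sub>\<infinity>k\<in>lattice. (wave k z * m bs k) * c k)"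
    using assms(2) by (simp add: wave_series_def mult_ac)
  also have "norm \<dots> \<le> (\<Sum>\<^sub>\<infinity>k\<in>lattice. norm (c k) * (1 + norm k) ^ q)"
  proof (rule norm_infsum_le)
    show "((\<lambda>k. norm (c k) * (1 + norm k) ^ q) has_sum (\<Sum>\<^sub>\<infinity>k\<in>lattice. norm (c k) * (1 + norm k) ^ q)) lattice"
      by (intro has_sum_infsum rapidly_decreasing_summable assms(1))
    have bd: "norm (wave k z * m bs k) \<le> 1 * (1 + norm k) ^ length bs" for k
      using m[OF assms(2)] by (simp add: norm_mult)
    show "((\<lambda>k. (wave k z * m bs k) * c k) has_sum (\<Sum>\<^sub>\<infinity>k\<in>lattice. (wave k z * m bs k) * c k)) lattice"
      by (rule rapidly_decreasing_has_sum[OF assms(1) bd])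
    show "norm (wave k z * m bs k * c k) \<le> norm (c k) * (1 + norm k) ^ q" for k
    proof -
      have "norm (wave k z * m bs k) \<le> (1 + norm k) ^ q"
        using bd[of k] power_increasing[OF assms(3), of "1 + norm k"] by simp
      then show ?thesis unfolding norm_mult[of _ "c k"]
        by (subst mult.commute) (rule mult_left_mono, auto)
    qed
  qed
  finally show ?thesis .
qed

text \<open>The pairing has no complex conjugation, so it selects the frequency \<open>- l\<close>.
  Finite partial sums converge uniformly, and their integrals are constant as soon as the finite set
  contains \<open>- l\<close>.\<close>

lemma torus_integral_wave_series:
  fixes c :: "'a::euclidean_space \<Rightarrow> complex"
  assumes c: "rapidly_decreasing c" and l: "l \<in> lattice"
  shows "torus_integral (\<lambda>z. wave_series c z * wave l z) = of_real ((2 * pi) ^ DIM('a)) * c (- l)"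
proof -
  let ?f = "\<lambda>F z. \<Sum>k\<in>F. c k * wave k z * wave l z"
  have "uniform_limit torus_box ?f (\<lambda>z. \<Sum>\<^sub>\<infinity>k\<in>lattice. c k * wave k z * wave l z) (finite_subsets_at_top lattice)"
  proof (rule Weierstrass_m_test_general)
    show "(\<lambda>k. norm (c k)) summable_on lattice"
      using rapidly_decreasing_summable[OF c, of 0] by simp
  qed (simp add: norm_mult)
  moreover have "(\<lambda>z. \<Sum>\<^sub>\<infinity>k\<in>lattice. c k * wave k z * wave l z) = (\<lambda>z. wave_series c z * wave l z)"
    unfolding wave_series_def by (simp add: infsum_cmult_left')
  ultimately have U: "uniform_limit torus_box ?f (\<lambda>z. wave_series c z * wave l z) (finite_subsets_at_top lattice)"
    by simp
  have "continuous_on torus_box (?f F)" for F by (intro continuous_intros)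
  from uniform_limit_integral_cbox[OF U this finite_subsets_at_top_neq_bot]
  obtain I J where IJ: "\<And>F. (?f F has_integral I F) torus_box"
    "((\<lambda>z. wave_series c z * wave l z) has_integral J) torus_box" "(I \<longlongrightarrow> J) (finite_subsets_at_top lattice)"
    by blast
  let ?V = "complex_of_real ((2 * pi) ^ DIM('a))"
  have "I F = ?V * c (- l)" if F: "finite F" "{- l} \<subseteq> F" "F \<subseteq> lattice" for F
  proof -
    have "(?f F has_integral (\<Sum>k\<in>F. c k * torus_integral (wave (k + l)))) torus_box"
    proof (intro has_integral_sum F)
      fix k
      have "(wave (k + l) has_integral torus_integral (wave (k + l))) torus_box"
        unfolding torus_integral_def by (intro integrable_integral torus_integrable continuous_intros)
      from has_integral_mult_right[OF this, of "c k"]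
      show "((\<lambda>z. c k * wave k z * wave l z) has_integral c k * torus_integral (wave (k + l))) torus_box"
        by (simp add: wave_add mult.assoc)
    qed
    then have "I F = (\<Sum>k\<in>F. c k * torus_integral (wave (k + l)))"
      using IJ(1) has_integral_unique by blast
    also have "\<dots> = (\<Sum>k\<in>F. if k = - l then ?V * c (- l) else 0)"
    proof (rule sum.cong[OF refl])
      fix k assume "k \<in> F"
      then have "k + l \<in> lattice" using F l lattice_add by blast
      then show "c k * torus_integral (wave (k + l)) = (if k = - l then ?V * c (- l) else 0)"
        by (simp add: torus_integral_wave add_eq_0_iff2)
    qed
    finally show ?thesis using F by simp
  qed
  then have "eventually (\<lambda>F. I F = ?V * c (- l)) (finite_subsets_at_top lattice)"
    using l unfolding eventually_finite_subsets_at_top by (intro exI[of _ "{- l}"]) (auto intro: lattice_uminus)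
  then have "(I \<longlongrightarrow> ?V * c (- l)) (finite_subsets_at_top lattice)"
    by (rule tendsto_eventually)
  then have "J = ?V * c (- l)"
    using IJ(3) tendsto_unique finite_subsets_at_top_neq_bot by blast
  then show ?thesis using IJ(2) unfolding torus_integral_def by (simp add: integral_unique)
qed

text \<open>Decay of the coefficients makes the Fourier series a smooth function. The difference to
  \<open>f\<close> then has vanishing coefficients, and uniqueness identifies the two.\<close>

lemma torus_smooth_fourier_series:
  fixes f :: "'a::euclidean_space \<Rightarrow> complex"
  assumes f: "torus_smooth f"
  obtains c where "rapidly_decreasing c" "f = wave_series c"
proof -
  define c where "c k = 1 / of_real ((2 * pi) ^ DIM('a)) * torus_integral (\<lambda>z. f z * wave (- k) z)" for k
  have c: "rapidly_decreasing c"
    unfolding rapidly_decreasing_def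
  proof
    fix q
    obtain M where M: "seminorm_le q M f" using seminorm_le_exists[OF f] .
    show "\<exists>C. \<forall>k\<in>lattice. norm (c k) * (1 + norm k) ^ q \<le> C"
    proof (intro exI ballI)
      fix k :: 'a assume "k \<in> lattice"
      have "norm (pdiffs (replicate m b) f z) \<le> M" if "b \<in> Basis" "m \<le> q" for b m z
      proof -
        have "replicate m b \<in> lists Basis" "length (replicate m b) \<le> q" using that by auto
        then show ?thesis using M unfolding seminorm_le_def by blast
      qed
      from fourier_decay[OF f lattice_uminus[OF \<open>k \<in> lattice\<close>] this]
      have "norm (torus_integral (\<lambda>z. f z * wave (- k) z)) * (1 + norm k) ^ q
        \<le> (1 + real DIM('a)) ^ q * (2 * pi) ^ DIM('a) * M" by simp
      from mult_left_mono[OF this, of "1 / (2 * pi) ^ DIM('a)"]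
      show "norm (c k) * (1 + norm k) ^ q \<le>
        1 / (2 * pi) ^ DIM('a) * ((1 + real DIM('a)) ^ q * (2 * pi) ^ DIM('a) * M)"
        by (simp add: c_def norm_mult norm_divide norm_power)
    qed
  qed
  have "f = wave_series c"
  proof
    fix z
    have "f z - wave_series c z = 0"
    proof (rule fourier_uniqueness[where F = "\<lambda>z. f z - wave_series c z"])
      show "torus_smooth (\<lambda>z. f z - wave_series c z)"
        by (intro torus_smooth_diff f torus_smooth_wave_series c)
      fix l :: 'a assume l: "l \<in> lattice"
      have "torus_integral (\<lambda>z. (f z - wave_series c z) * wave l z) =
          torus_integral (\<lambda>z. f z * wave l z + (- 1) * (wave_series c z * wave l z))"
        by (simp add: algebra_simps)
      also have "\<dots> = torus_integral (\<lambda>z. f z * wave l z) + torus_integral (\<lambda>z. (- 1) * (wave_series c z * wave l z))"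
        by (intro torus_integral_add continuous_intros torus_smooth_continuous_on torus_smooth_wave_series c f)
      also have "\<dots> = 0"
        unfolding torus_integral_cmult torus_integral_wave_series[OF c l] by (simp add: c_def)
      finally show "torus_integral (\<lambda>z. (f z - wave_series c z) * wave l z) = 0" .
    qed
    then show "f z = wave_series c z" by simp
  qed
  with c show thesis by (rule that)
qed

section \<open>Distributions and their Fourier coefficients\<close>

lemma distribution_add_arg:
  "distribution u \<Longrightarrow> torus_smooth f \<Longrightarrow> torus_smooth g \<Longrightarrow> u (\<lambda>z. f z + g z) = u f + u g"
  by (simp add: distribution_def)

lemma distribution_cmult_arg:
  "distribution u \<Longrightarrow> torus_smooth f \<Longrightarrow> u (\<lambda>z. c * f z) = c * u f"
  by (simp add: distribution_def)

lemma distribution_zero_arg: "distribution u \<Longrightarrow> u (\<lambda>z. 0) = 0"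
  using distribution_cmult_arg[of u "\<lambda>z. 0" 0] torus_smooth_const[of 0] by simp

lemma distribution_sum_arg:
  assumes "distribution u" "\<And>i. i \<in> I \<Longrightarrow> torus_smooth (f i)"
  shows "u (\<lambda>z. \<Sum>i\<in>I. f i z) = (\<Sum>i\<in>I. u (f i))"
  using assms(2)
  by (induction I rule: infinite_finite_induct)
    (simp_all add: distribution_zero_arg[OF assms(1)] distribution_add_arg[OF assms(1)] torus_smooth_sum)

text \<open>The sum of suprema in the definition is exchanged for a uniform bound \<open>D\<close>
  on the derivatives, at the cost of the number of multi-indices. \<open>distributionI\<close> goes
  back; all estimates below are made in this form.\<close>

lemma distribution_bound:
  fixes u :: "'n::finite functional"
  assumes "distribution u"
  obtains C N where "C \<ge> 0" "\<And>f D. seminorm_le N D f \<Longrightarrow> norm (u f) \<le> C * D"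
proof -
  obtain C N where CN: "\<And>f. torus_smooth f \<Longrightarrow> norm (u f) \<le>
      C * (\<Sum>bs | bs \<in> lists Basis \<and> length bs \<le> N. SUP z. norm (pdiffs bs f z))"
    using assms unfolding distribution_def by blast
  let ?I = "{bs. bs \<in> lists (Basis :: (real \<times> (real ^ 'n)) set) \<and> length bs \<le> N}"
  show ?thesis
  proof (rule that[of "\<bar>C\<bar> * card ?I" N])
    fix f :: "real \<times> (real ^ 'n) \<Rightarrow> complex" and D assume f: "seminorm_le N D f"
    have "norm (u f) \<le> C * (\<Sum>bs\<in>?I. SUP z. norm (pdiffs bs f z))"
      using CN f by (auto simp: seminorm_le_def)
    also have "\<dots> \<le> \<bar>C\<bar> * (\<Sum>bs\<in>?I. D)"
    proof (intro mult_mono sum_mono)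
      show "(SUP z. norm (pdiffs bs f z)) \<le> D" if "bs \<in> ?I" for bs
        using that f by (intro cSUP_least) (auto simp: seminorm_le_def)
      have "0 \<le> (SUP z. norm (pdiffs bs f z))" if "bs \<in> ?I" for bs
        using that f by (intro cSUP_upper2[where x = 0] bdd_above_torus_smooth torus_smooth_pdiffs)
          (auto simp: seminorm_le_def)
      then show "0 \<le> (\<Sum>bs\<in>?I. SUP z. norm (pdiffs bs f z))" by (rule sum_nonneg)
    qed auto
    finally show "norm (u f) \<le> \<bar>C\<bar> * card ?I * D" by simp
  qed simp
qed

lemma distributionI:
  fixes u :: "'n::finite functional"
  assumes "\<And>f g. torus_smooth f \<Longrightarrow> torus_smooth g \<Longrightarrow> u (\<lambda>z. f z + g z) = u f + u g"
    and "\<And>c f. torus_smooth f \<Longrightarrow> u (\<lambda>z. c * f z) = c * u f"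
    and bound: "\<And>f D. seminorm_le N D f \<Longrightarrow> norm (u f) \<le> C * D"
  shows "distribution u"
proof -
  let ?I = "{bs. bs \<in> lists (Basis :: (real \<times> (real ^ 'n)) set) \<and> length bs \<le> N}"
  have "norm (u f) \<le> C * (\<Sum>bs\<in>?I. SUP z. norm (pdiffs bs f z))" if f: "torus_smooth f" for f
  proof (rule bound)
    show "seminorm_le N (\<Sum>bs\<in>?I. SUP z. norm (pdiffs bs f z)) f"
      unfolding seminorm_le_def
    proof (intro conjI ballI impI allI f)
      fix bs :: "(real \<times> (real ^ 'n)) list" and z assume bs: "bs \<in> lists Basis" "length bs \<le> N"
      have nonneg: "0 \<le> (SUP z. norm (pdiffs cs f z))" if "cs \<in> ?I" for cs
        using that f by (intro cSUP_upper2[where x = 0] bdd_above_torus_smooth torus_smooth_pdiffs) auto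
      have "norm (pdiffs bs f z) \<le> (SUP z. norm (pdiffs bs f z))"
        using bs f by (intro cSUP_upper bdd_above_torus_smooth torus_smooth_pdiffs) auto
      also have "\<dots> \<le> (\<Sum>bs\<in>?I. SUP z. norm (pdiffs bs f z))"
        using bs nonneg by (intro member_le_sum finite_multiindices) auto
      finally show "norm (pdiffs bs f z) \<le> (\<Sum>bs\<in>?I. SUP z. norm (pdiffs bs f z))" .
    qed
  qed
  then show ?thesis unfolding distribution_def using assms by blast
qed

section \<open>Operations on distributions, density of characters and smooth distributions\<close>

lemma distribution_add:
  fixes u w :: "'n::finite functional"
  assumes "distribution u" "distribution w"
  shows "distribution (\<lambda>\<phi>. u \<phi> + w \<phi>)"
proof -
  obtain C N where u: "\<And>f D. seminorm_le N D f \<Longrightarrow> norm (u f) \<le> C * D"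
    using distribution_bound[OF assms(1)] by metis
  obtain C' N' where w: "\<And>f D. seminorm_le N' D f \<Longrightarrow> norm (w f) \<le> C' * D"
    using distribution_bound[OF assms(2)] by metis
  show ?thesis
  proof (rule distributionI[where N = "max N N'" and C = "C + C'"])
    fix f :: "real \<times> (real ^ 'n) \<Rightarrow> complex" and D assume "seminorm_le (max N N') D f"
    then have "seminorm_le N D f" "seminorm_le N' D f" by (auto elim: seminorm_le_mono)
    then show "norm (u f + w f) \<le> (C + C') * D"
      using norm_triangle_mono[OF u w] by (simp add: distrib_right)
  qed (use assms in \<open>auto simp: distribution_add_arg distribution_cmult_arg algebra_simps\<close>)
qed

lemma distribution_cmult:
  fixes u :: "'n::finite functional"
  assumes "distribution u"
  shows "distribution (\<lambda>\<phi>. c * u \<phi>)"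
proof -
  obtain C N where u: "\<And>f D. seminorm_le N D f \<Longrightarrow> norm (u f) \<le> C * D"
    using distribution_bound[OF assms(1)] by metis
  show ?thesis
  proof (rule distributionI[where N = N and C = "norm c * C"])
    fix f :: "real \<times> (real ^ 'n) \<Rightarrow> complex" and D assume "seminorm_le N D f"
    then show "norm (c * u f) \<le> norm c * C * D"
      using mult_left_mono[OF u, of _ _ "norm c"] by (simp add: norm_mult mult.assoc)
  qed (use assms in \<open>auto simp: distribution_add_arg distribution_cmult_arg algebra_simps\<close>)
qed

lemma distribution_sum:
  assumes "\<And>i. i \<in> I \<Longrightarrow> distribution (u i)"
  shows "distribution (\<lambda>\<phi>. \<Sum>i\<in>I. u i \<phi>)"
proof -
  have "distribution (\<lambda>\<phi>. 0)" by (rule distributionI[where C = 0]) auto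
  then show ?thesis
    using assms by (induction I rule: infinite_finite_induct) (auto intro: distribution_add)
qed

lemma distribution_D_t:
  fixes u :: "'n::finite functional"
  assumes "distribution u"
  shows "distribution (D_t u)"
proof -
  have B: "(1, 0) \<in> (Basis :: (real \<times> (real ^ 'n)) set)" by (simp add: Basis_prod_def)
  obtain C N where u: "\<And>f D. seminorm_le N D f \<Longrightarrow> norm (u f) \<le> C * D"
    using distribution_bound[OF assms(1)] by metis
  have eq: "D_t u f = \<i> * u (pdiff (1, 0) f)" if "torus_smooth f" for f
    unfolding D_t_def
    by (subst distribution_cmult_arg[OF assms torus_smooth_pdiff[OF that B]]) simp
  show ?thesis
  proof (rule distributionI[where N = "Suc N" and C = C])
    fix f g :: "real \<times> (real ^ 'n) \<Rightarrow> complex" assume fg: "torus_smooth f" "torus_smooth g"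
    have "pdiff (1, 0) (\<lambda>z. f z + g z) = (\<lambda>z. pdiff (1, 0) f z + pdiff (1, 0) g z)"
      using pdiff_add[OF fg] by auto
    then show "D_t u (\<lambda>z. f z + g z) = D_t u f + D_t u g"
      by (simp add: eq fg torus_smooth_add distribution_add_arg[OF assms] torus_smooth_pdiff B distrib_left)
  next
    fix c and f :: "real \<times> (real ^ 'n) \<Rightarrow> complex" assume f: "torus_smooth f"
    have "pdiff (1, 0) (\<lambda>z. c * f z) = (\<lambda>z. c * pdiff (1, 0) f z)"
      using pdiff_cmult[OF f] by auto
    then show "D_t u (\<lambda>z. c * f z) = c * D_t u f"
      by (simp add: eq f torus_smooth_cmult distribution_cmult_arg[OF assms] torus_smooth_pdiff B)
  next
    fix f :: "real \<times> (real ^ 'n) \<Rightarrow> complex" and D assume f: "seminorm_le (Suc N) D f"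
    from seminorm_le_pdiff[OF f B] have "seminorm_le N D (pdiff (1, 0) f)" .
    from u[OF this] show "norm (D_t u f) \<le> C * D"
      using f by (simp add: eq seminorm_le_def norm_mult)
  qed
qed

text \<open>Trigonometric polynomials are dense in the smooth topology: removing finitely many terms
  from the Fourier series of \<open>f\<close> leaves a function whose seminorm of order
  \<open>N\<close> is a tail of a convergent series, and \<open>u\<close> vanishes on the removed
  terms.\<close>

lemma distribution_density:
  fixes u :: "'n::finite functional"
  assumes u: "distribution u" and zero: "\<And>k. k \<in> lattice \<Longrightarrow> u (wave k) = 0" and f: "torus_smooth f"
  shows "u f = 0"
proof -
  obtain C N where C: "C \<ge> 0" and bound: "\<And>f D. seminorm_le N D f \<Longrightarrow> norm (u f) \<le> C * D"
    using distribution_bound[OF u] by metis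
  obtain c where c: "rapidly_decreasing c" "f = wave_series c"
    using torus_smooth_fourier_series[OF f] .
  let ?w = "\<lambda>k. norm (c k) * (1 + norm k) ^ N"
  have summ: "?w summable_on lattice" by (rule rapidly_decreasing_summable[OF c(1)])
  have "norm (u f) \<le> C * e" if "e > 0" for e
  proof -
    obtain F where F: "finite F" "F \<subseteq> lattice" "dist (sum ?w F) (infsum ?w lattice) \<le> e"
      using infsum_finite_approximation[OF summ \<open>e > 0\<close>] by blast
    define d where "d k = (if k \<in> F then 0 else c k)" for k
    have "d = (\<lambda>k. (if k \<in> F then 0 else 1) * c k)" by (auto simp: d_def)
    then have d: "rapidly_decreasing d"
      using rapidly_decreasing_bounded_mult[OF c(1), of "\<lambda>k. if k \<in> F then 0 else 1" 1 0] by simp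
    have split: "f z = (\<Sum>k\<in>F. c k * wave k z) + wave_series d z" for z
    proof -
      have s: "(\<lambda>k. c k * wave k z) summable_on lattice"
        using rapidly_decreasing_has_sum[OF c(1), of "\<lambda>k. wave k z" 1 0]
        by (auto simp: mult.commute summable_on_def)
      have "wave_series d z = infsum (\<lambda>k. c k * wave k z) (lattice - F)"
        unfolding wave_series_def by (rule infsum_cong_neutral) (auto simp: d_def)
      also have "\<dots> = f z - (\<Sum>k\<in>F. c k * wave k z)"
        using infsum_Diff[OF s _ F(2)] F(1) by (simp add: c(2) wave_series_def)
      finally show ?thesis by simp
    qed
    have "u (\<lambda>z. \<Sum>k\<in>F. c k * wave k z) = (\<Sum>k\<in>F. u (\<lambda>z. c k * wave k z))"
      using F(2) by (intro distribution_sum_arg[OF u] torus_smooth_cmult torus_smooth_wave) auto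
    also have "\<dots> = 0"
      using F(2) zero by (intro sum.neutral) (auto simp: distribution_cmult_arg[OF u] torus_smooth_wave)
    moreover have "u f = u (\<lambda>z. \<Sum>k\<in>F. c k * wave k z) + u (wave_series d)"
      unfolding split[abs_def] using F(2)
      by (intro distribution_add_arg[OF u] torus_smooth_wave_series d torus_smooth_sum torus_smooth_cmult
          torus_smooth_wave) auto
    ultimately have "u f = u (wave_series d)" by simp
    moreover have "seminorm_le N (\<Sum>\<^sub>\<infinity>k\<in>lattice. norm (d k) * (1 + norm k) ^ N) (wave_series d)"
      unfolding seminorm_le_def using d by (auto intro: torus_smooth_wave_series norm_pdiffs_wave_series_le)
    ultimately have "norm (u f) \<le> C * (\<Sum>\<^sub>\<infinity>k\<in>lattice. norm (d k) * (1 + norm k) ^ N)"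
      using bound by simp
    also have "(\<Sum>\<^sub>\<infinity>k\<in>lattice. norm (d k) * (1 + norm k) ^ N) = infsum ?w (lattice - F)"
      by (rule infsum_cong_neutral) (auto simp: d_def)
    also have "\<dots> = infsum ?w lattice - sum ?w F"
      using infsum_Diff[OF summ _ F(2)] F(1) by simp
    also have "\<dots> \<le> e" using F(3) by (simp add: dist_real_def)
    finally show ?thesis using C mult_left_mono by fastforce
  qed
  then have "norm (u f) \<le> e" if "e > 0" for e
  proof -
    \<comment> \<open>Dividing by \<open>C + 1\<close> rather than \<open>C\<close> covers
      \<open>C = 0\<close>.\<close>
    have "norm (u f) \<le> C * (e / (C + 1))" using that C by (intro \<open>\<And>e. e > 0 \<Longrightarrow> norm (u f) \<le> C * e\<close>) simp
    also have "\<dots> \<le> e" using that C by (simp add: field_simps)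
    finally show ?thesis .
  qed
  then have "norm (u f) \<le> 0" by (rule field_le_epsilon) simp
  then show ?thesis by simp
qed

lemma distribution_eqI:
  fixes u w :: "'n::finite functional"
  assumes "distribution u" "distribution w" "\<And>k. k \<in> lattice \<Longrightarrow> u (wave k) = w (wave k)" "torus_smooth f"
  shows "u f = w f"
proof -
  have "distribution (\<lambda>\<phi>. u \<phi> + (- 1) * w \<phi>)"
    using assms by (intro distribution_add distribution_cmult)
  from distribution_density[OF this _ assms(4)] assms(3) show ?thesis by simp
qed

lemma distribution_torus_integral:
  fixes f :: "real \<times> (real ^ 'n::finite) \<Rightarrow> complex"
  assumes f: "torus_smooth f"
  shows "distribution (\<lambda>\<phi>. torus_integral (\<lambda>z. f z * \<phi> z))"
proof -
  obtain M where M: "M \<ge> 0" "\<And>z. norm (f z) \<le> M" using torus_smooth_bounded[OF f] by blast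
  show ?thesis
  proof (rule distributionI[where N = 0 and C = "(2 * pi) ^ DIM(real \<times> (real ^ 'n)) * M"])
    fix g h :: "real \<times> (real ^ 'n) \<Rightarrow> complex" assume "torus_smooth g" "torus_smooth h"
    then show "torus_integral (\<lambda>z. f z * (g z + h z)) = torus_integral (\<lambda>z. f z * g z) + torus_integral (\<lambda>z. f z * h z)"
      unfolding distrib_left
      by (intro torus_integral_add torus_smooth_continuous_on torus_smooth_mult f)
  next
    fix c and g :: "real \<times> (real ^ 'n) \<Rightarrow> complex" assume "torus_smooth g"
    show "torus_integral (\<lambda>z. f z * (c * g z)) = c * torus_integral (\<lambda>z. f z * g z)"
      using torus_integral_cmult[of c "\<lambda>z. f z * g z"] by (simp add: mult.left_commute)
  next
    fix g :: "real \<times> (real ^ 'n) \<Rightarrow> complex" and D assume g: "seminorm_le 0 D g"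
    have "norm (torus_integral (\<lambda>z. f z * g z)) \<le> (2 * pi) ^ DIM(real \<times> (real ^ 'n)) * (M * D)"
    proof (rule norm_torus_integral_le)
      show "continuous_on UNIV (\<lambda>z. f z * g z)"
        using g f by (auto simp: seminorm_le_def intro!: torus_smooth_continuous_on torus_smooth_mult)
      have "norm (g z) \<le> D" for z using g unfolding seminorm_le_def by (metis le0 list.size(3) lists.Nil pdiffs_Nil)
      then show "norm (f z * g z) \<le> M * D" for z
        unfolding norm_mult using M by (intro mult_mono) auto
    qed
    then show "norm (torus_integral (\<lambda>z. f z * g z)) \<le> (2 * pi) ^ DIM(real \<times> (real ^ 'n)) * M * D"
      by (simp add: mult.assoc)
  qed
qed

text \<open>The density is the Fourier series of \<open>w\<close>. Its coefficient at
  \<open>k\<close> is taken from \<open>wave (- k)\<close>, because the pairing of function and test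
  function is bilinear.\<close>

lemma smooth_distributionI:
  fixes w :: "'n::finite functional"
  assumes w: "distribution w" and rapid: "rapidly_decreasing (\<lambda>k. w (wave k))"
  shows "smooth_distribution w"
proof -
  let ?V = "complex_of_real ((2 * pi) ^ DIM(real \<times> (real ^ 'n)))"
  define c where "c k = w (wave (- k)) / ?V" for k
  have c: "rapidly_decreasing c"
    unfolding rapidly_decreasing_def
  proof
    fix q
    obtain C where C: "\<And>k. k \<in> lattice \<Longrightarrow> norm (w (wave k)) * (1 + norm k) ^ q \<le> C"
      using rapid unfolding rapidly_decreasing_def by blast
    have "norm (c k) * (1 + norm k) ^ q \<le> C / norm ?V" if "k \<in> lattice" for k
      using C[OF lattice_uminus[OF that]] by (simp add: c_def norm_divide divide_right_mono)
    then show "\<exists>C. \<forall>k\<in>lattice. norm (c k) * (1 + norm k) ^ q \<le> C" by blast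
  qed
  have "w \<phi> = torus_integral (\<lambda>z. wave_series c z * \<phi> z)" if "torus_smooth \<phi>" for \<phi>
  proof (rule distribution_eqI[OF w _ _ that])
    show "distribution (\<lambda>\<phi>. torus_integral (\<lambda>z. wave_series c z * \<phi> z))"
      by (intro distribution_torus_integral torus_smooth_wave_series c)
    show "w (wave k) = torus_integral (\<lambda>z. wave_series c z * wave k z)" if "k \<in> lattice" for k
      unfolding torus_integral_wave_series[OF c that] by (simp add: c_def)
  qed
  then show ?thesis
    unfolding smooth_distribution_def using torus_smooth_wave_series[OF c] by blast
qed

lemma smooth_distribution_add:
  assumes "smooth_distribution u" "smooth_distribution w"
  shows "smooth_distribution (\<lambda>\<phi>. u \<phi> + w \<phi>)"
proof -
  obtain f g where f: "torus_smooth f" "\<And>\<phi>. torus_smooth \<phi> \<Longrightarrow> u \<phi> = torus_integral (\<lambda>z. f z * \<phi> z)"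
    and g: "torus_smooth g" "\<And>\<phi>. torus_smooth \<phi> \<Longrightarrow> w \<phi> = torus_integral (\<lambda>z. g z * \<phi> z)"
    using assms unfolding smooth_distribution_def by blast
  have "torus_integral (\<lambda>z. (f z + g z) * \<phi> z) = u \<phi> + w \<phi>" if "torus_smooth \<phi>" for \<phi>
    unfolding distrib_right f(2)[OF that] g(2)[OF that]
    by (intro torus_integral_add torus_smooth_continuous_on torus_smooth_mult f g that)
  then show ?thesis
    unfolding smooth_distribution_def
    by (intro exI[of _ "\<lambda>z. f z + g z"]) (auto intro: torus_smooth_add f g)
qed

lemma smooth_distribution_sum:
  fixes u :: "'i \<Rightarrow> 'n::finite functional"
  assumes "\<And>i. i \<in> I \<Longrightarrow> smooth_distribution (u i)"
  shows "smooth_distribution (\<lambda>\<phi>. \<Sum>i\<in>I. u i \<phi>)"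
proof -
  have "torus_integral (\<lambda>z :: real \<times> (real ^ 'n). 0) = 0"
    using torus_integral_const[of 0, where 'a = "real \<times> (real ^ 'n)"] by simp
  then have "smooth_distribution ((\<lambda>\<phi>. 0) :: 'n functional)"
    unfolding smooth_distribution_def by (intro exI[of _ "\<lambda>z. 0"]) (auto simp: torus_smooth_const)
  then show ?thesis
    using assms by (induction I rule: infinite_finite_induct) (auto intro: smooth_distribution_add)
qed

lemma smooth_distribution_cong:
  assumes "smooth_distribution u" "\<And>\<phi>. torus_smooth \<phi> \<Longrightarrow> u \<phi> = w \<phi>"
  shows "smooth_distribution w"
  using assms unfolding smooth_distribution_def by metis

section \<open>Partial Fourier coefficients\<close>

lemma Basis_prod_cases:
  assumes "b \<in> (Basis :: (real \<times> 'b::euclidean_space) set)"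
  obtains "b = (1, 0)" | c where "c \<in> Basis" "b = (0, c)"
  using assms by (auto simp: Basis_prod_def)

lemma time_Basis: "(1, 0) \<in> (Basis :: (real \<times> 'b::euclidean_space) set)"
  and space_Basis: "c \<in> Basis \<Longrightarrow> (0, c) \<in> (Basis :: (real \<times> 'b::euclidean_space) set)"
  by (auto simp: Basis_prod_def)

definition tensor :: "(real \<Rightarrow> complex) \<Rightarrow> 'b::euclidean_space \<Rightarrow> real \<times> 'b \<Rightarrow> complex" where
  "tensor \<theta> l = (\<lambda>z. \<theta> (fst z) * wave l (snd z))"

lemma torus_smooth_fst:
  fixes \<theta> :: "real \<Rightarrow> complex"
  assumes "torus_smooth \<theta>"
  shows "torus_smooth (\<lambda>z :: real \<times> 'b::euclidean_space. \<theta> (fst z))"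
proof -
  have "fst b \<in> Basis \<or> fst b = 0" if "b \<in> Basis" for b :: "real \<times> 'b"
    using that by (rule Basis_prod_cases) auto
  from torus_smooth_affine[OF assms bounded_linear_fst this, of 0] show ?thesis by simp
qed

lemma torus_smooth_snd:
  fixes g :: "'b::euclidean_space \<Rightarrow> complex"
  assumes "torus_smooth g"
  shows "torus_smooth (\<lambda>z :: real \<times> 'b. g (snd z))"
proof -
  have "snd b \<in> Basis \<or> snd b = 0" if "b \<in> Basis" for b :: "real \<times> 'b"
    using that by (rule Basis_prod_cases) auto
  from torus_smooth_affine[OF assms bounded_linear_snd this, of 0] show ?thesis by simp
qed

lemma torus_smooth_tensor: "torus_smooth \<theta> \<Longrightarrow> l \<in> lattice \<Longrightarrow> torus_smooth (tensor \<theta> l)"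
  unfolding tensor_def by (intro torus_smooth_mult torus_smooth_fst torus_smooth_snd torus_smooth_wave)

lemma pdiff_fst: "torus_smooth \<theta> \<Longrightarrow> pdiff b (\<lambda>z. \<theta> (fst z)) z = pdiff (fst b) \<theta> (fst z)"
  using pdiff_affine[of \<theta> fst b 0 z] by (simp add: bounded_linear_fst)

lemma pdiff_tensor:
  assumes "torus_smooth \<theta>" "l \<in> lattice"
  shows "pdiff (1, 0) (tensor \<theta> l) = tensor (pdiff 1 \<theta>) l"
    and "c \<in> Basis \<Longrightarrow> pdiff (0, c) (tensor \<theta> l) = (\<lambda>z. \<i> * of_real (l \<bullet> c) * tensor \<theta> l z)"
proof -
  have "pdiff b (\<lambda>z. wave l (snd z)) z = \<i> * of_real (l \<bullet> snd b) * wave l (snd z)" for b z :: "real \<times> 'a"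
    using pdiff_affine[OF torus_smooth_wave[OF assms(2)] bounded_linear_snd, of b 0 z] by (simp add: pdiff_wave)
  then have "pdiff b (tensor \<theta> l) z =
      pdiff (fst b) \<theta> (fst z) * wave l (snd z) + \<theta> (fst z) * (\<i> * of_real (l \<bullet> snd b) * wave l (snd z))" for b z
    unfolding tensor_def using assms
    by (subst pdiff_mult) (auto intro: torus_smooth_fst torus_smooth_snd torus_smooth_wave simp: pdiff_fst)
  then show "pdiff (1, 0) (tensor \<theta> l) = tensor (pdiff 1 \<theta>) l"
    and "c \<in> Basis \<Longrightarrow> pdiff (0, c) (tensor \<theta> l) = (\<lambda>z. \<i> * of_real (l \<bullet> c) * tensor \<theta> l z)"
    by (auto simp: tensor_def pdiff_0[OF assms(1)])
qed

lemma tensor_wave: "tensor (wave \<tau>) l = wave (\<tau>, l)"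
  by (auto simp: tensor_def wave_def cis_mult inner_prod_def mult.commute)

text \<open>A time derivative falls on \<theta>, a space derivative multiplies by i times a
  coordinate of \<open>l\<close>. Hence at most \<open>K\<close> powers of the frequency are
  lost.\<close>

lemma seminorm_le_tensor:
  assumes \<theta>: "seminorm_le K D \<theta>" and l: "l \<in> lattice"
  shows "seminorm_le K ((1 + norm l) ^ K * D) (tensor \<theta> l)"
  unfolding seminorm_le_def
proof (intro conjI ballI impI allI)
  have sm: "torus_smooth \<theta>" using \<theta> by (simp add: seminorm_le_def)
  then show "torus_smooth (tensor \<theta> l)" using l by (rule torus_smooth_tensor)
  have *: "\<exists>\<beta>\<le>length bs. \<exists>m. norm m \<le> (1 + norm l) ^ length bs \<and>
      pdiffs bs (tensor \<theta> l) = (\<lambda>z. m * tensor ((pdiff 1 ^^ \<beta>) \<theta>) l z)"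
    if "bs \<in> lists Basis" for bs
    using that
  proof (induction bs)
    case Nil
    show ?case by (intro exI[of _ 0] conjI exI[of _ 1]) auto
  next
    case (Cons b bs)
    then obtain \<beta> m where IH: "\<beta> \<le> length bs" "norm m \<le> (1 + norm l) ^ length bs"
      "pdiffs bs (tensor \<theta> l) = (\<lambda>z. m * tensor ((pdiff 1 ^^ \<beta>) \<theta>) l z)" by auto
    have sm': "torus_smooth ((pdiff 1 ^^ \<beta>) \<theta>)" using sm by (intro torus_smooth_funpow) auto
    have eq: "pdiffs (b # bs) (tensor \<theta> l) = (\<lambda>z. m * pdiff b (tensor ((pdiff 1 ^^ \<beta>) \<theta>) l) z)"
      unfolding pdiffs_Cons IH(3) by (rule ext) (rule pdiff_cmult[OF torus_smooth_tensor[OF sm' l]])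
    from Cons.hyps have "b \<in> Basis" by simp
    then show ?case
    proof (cases rule: Basis_prod_cases)
      case 1
      have "(1 + norm l) ^ length bs \<le> (1 + norm l) ^ length (b # bs)" by (intro power_increasing) auto
      then show ?thesis
        unfolding eq unfolding 1 pdiff_tensor(1)[OF sm' l] using IH by (intro exI[of _ "Suc \<beta>"] conjI exI[of _ m]) auto
    next
      case (2 c)
      have "norm (m * (\<i> * of_real (l \<bullet> c))) \<le> (1 + norm l) ^ length bs * (1 + norm l)"
        unfolding norm_mult[of m] using IH(2) 2(1)
        by (intro mult_mono) (auto simp: norm_mult intro: order_trans[OF Basis_le_norm])
      then show ?thesis
        unfolding eq unfolding 2(2) pdiff_tensor(2)[OF sm' l 2(1)] using IH(1)
        by (intro exI[of _ \<beta>] conjI exI[of _ "m * (\<i> * of_real (l \<bullet> c))"]) (auto simp: mult_ac)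
    qed
  qed
  fix bs :: "(real \<times> 'a) list" and z assume bs: "bs \<in> lists Basis" "length bs \<le> K"
  then obtain \<beta> m where m: "\<beta> \<le> length bs" "norm m \<le> (1 + norm l) ^ length bs"
      "pdiffs bs (tensor \<theta> l) = (\<lambda>z. m * tensor ((pdiff 1 ^^ \<beta>) \<theta>) l z)" using * by blast
  have "norm (tensor ((pdiff 1 ^^ \<beta>) \<theta>) l z) \<le> D"
    using \<theta> m(1) bs(2) by (simp add: tensor_def norm_mult seminorm_le_real)
  moreover have "norm m \<le> (1 + norm l) ^ K"
    using m(2) power_increasing[OF bs(2), of "1 + norm l"] by simp
  ultimately show "norm (pdiffs bs (tensor \<theta> l) z) \<le> (1 + norm l) ^ K * D"
    unfolding m(3) norm_mult by (intro mult_mono) auto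
qed

text \<open>The partial Fourier transform on the side of test functions: the character has the sign
  opposite to that in \<open>fourier_coeff\<close>, which also carries the normalizing
  factor.\<close>

definition xhat :: "(real \<times> 'b::euclidean_space \<Rightarrow> complex) \<Rightarrow> 'b \<Rightarrow> real \<Rightarrow> complex" where
  "xhat \<phi> l = (\<lambda>t. torus_integral (\<lambda>x. \<phi> (t, x) * wave l x))"

lemma xhat_has_vector_derivative:
  fixes \<phi> :: "real \<times> 'b::euclidean_space \<Rightarrow> complex"
  assumes \<phi>: "torus_smooth \<phi>"
  shows "(xhat \<phi> l has_vector_derivative xhat (pdiff (1, 0) \<phi>) l t) (at t)"
  unfolding xhat_def torus_integral_def
proof (rule leibniz_rule_vector_derivative)
  fix s :: real and x :: 'b
  have lin: "(frechet_derivative \<phi> (at w)) (h, 0) = h *\<^sub>R frechet_derivative \<phi> (at w) (1, 0)" for w and h :: real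
  proof -
    have "(h, 0) = h *\<^sub>R (1 :: real, 0 :: 'b)" by simp
    then show ?thesis
      by (simp only: linear_scale[OF linear_frechet_derivative[OF torus_smooth_differentiable[OF \<phi>]]])
  qed
  have "((\<lambda>s. (s, x)) has_derivative (\<lambda>h. (h, 0))) (at s)"
    by (auto intro!: derivative_eq_intros)
  from has_derivative_compose[OF this torus_smooth_has_derivative[OF \<phi>]]
  have "((\<lambda>s. \<phi> (s, x)) has_vector_derivative pdiff (1, 0) \<phi> (s, x)) (at s)"
    by (simp only: has_vector_derivative_def pdiff_def lin[symmetric])
  then show "((\<lambda>s. \<phi> (s, x) * wave l x) has_vector_derivative pdiff (1, 0) \<phi> (s, x) * wave l x) (at s)"
    by (rule has_vector_derivative_mult_left)
next
  show "(\<lambda>x. \<phi> (s, x) * wave l x) integrable_on torus_box" for s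
    by (intro torus_integrable continuous_on_mult continuous_on_wave
        continuous_on_compose2[OF torus_smooth_continuous_on[OF \<phi>, of UNIV]] continuous_intros) auto
  show "continuous_on (UNIV \<times> torus_box) (\<lambda>(s, x). pdiff (1, 0) \<phi> (s, x) * wave l x)"
    unfolding split_beta prod.collapse
    by (intro continuous_on_mult torus_smooth_continuous_on torus_smooth_pdiff \<phi> time_Basis
        continuous_on_compose2[OF continuous_on_wave[of UNIV]] continuous_intros) auto
qed auto

lemma pdiff_xhat: "torus_smooth \<phi> \<Longrightarrow> pdiff 1 (xhat \<phi> l) = xhat (pdiff (1, 0) \<phi>) l"
  by (rule ext, rule pdiff_eqI[OF xhat_has_vector_derivative[unfolded has_vector_derivative_def], THEN trans]) auto

lemma torus_smooth_xhat:
  fixes \<phi> :: "real \<times> 'b::euclidean_space \<Rightarrow> complex"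
  assumes "torus_smooth \<phi>"
  shows "torus_smooth (xhat \<phi> l)"
proof -
  have "\<exists>\<psi>. torus_smooth \<psi> \<and> xhat \<phi> l = xhat \<psi> l" using assms by blast
  then show ?thesis
  proof (rule torus_smooth_coinduct[where X = "\<lambda>f. \<exists>\<psi>. torus_smooth \<psi> \<and> f = xhat \<psi> l"])
    fix f assume "\<exists>\<psi>. torus_smooth \<psi> \<and> f = xhat \<psi> l"
    then obtain \<psi> where \<psi>: "torus_smooth \<psi>" "f = xhat \<psi> l" by blast
    have "\<psi> (t + 2 * pi, x) = \<psi> (t, x)" for t x
      using torus_smooth_periodic[OF \<psi>(1)] time_Basis[where 'b = 'b]
      unfolding torus_periodic_def by (force dest: spec[of _ "(t, x)"])
    then show "torus_periodic f" by (simp add: torus_periodic_def \<psi>(2) xhat_def)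
    show "f differentiable (at t)" for t
      unfolding \<psi>(2) using xhat_has_vector_derivative[OF \<psi>(1)] by (rule differentiableI_vector)
    show "\<exists>\<rho>. torus_smooth \<rho> \<and> pdiff b f = xhat \<rho> l" if "b \<in> Basis" for b
      using that pdiff_xhat[OF \<psi>(1)] torus_smooth_pdiff[OF \<psi>(1) time_Basis] \<psi>(2) by auto
  qed
qed

text \<open>The order of the seminorm of \<phi> is split: \<open>K\<close> derivatives in time pass
  under the integral, and \<open>q\<close> derivatives in space are spent on decay in the
  frequency.\<close>

lemma seminorm_le_xhat:
  fixes \<phi> :: "real \<times> 'b::euclidean_space \<Rightarrow> complex"
  assumes \<phi>: "seminorm_le (K + q) D \<phi>" and l: "l \<in> lattice"
  shows "seminorm_le K ((1 + real DIM('b)) ^ q * (2 * pi) ^ DIM('b) * D / (1 + norm l) ^ q) (xhat \<phi> l)"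
  unfolding seminorm_le_real
proof (intro conjI allI impI)
  have sm: "torus_smooth \<phi>" using \<phi> by (simp add: seminorm_le_def)
  then show "torus_smooth (xhat \<phi> l)" by (rule torus_smooth_xhat)
  fix \<beta> t assume \<beta>: "\<beta> \<le> K"
  let ?g = "(pdiff (1, 0) ^^ \<beta>) \<phi>"
  have g: "torus_smooth ?g" using sm time_Basis by (rule torus_smooth_funpow)
  have "(pdiff 1 ^^ \<beta>) (xhat \<phi> l) = xhat ?g l"
  proof (induction \<beta>)
    case (Suc \<beta>)
    then show ?case by (simp add: pdiff_xhat torus_smooth_funpow sm time_Basis)
  qed simp
  then have eq: "(pdiff 1 ^^ \<beta>) (xhat \<phi> l) t = torus_integral (\<lambda>x. ?g (t, x) * wave l x)" by (simp add: xhat_def)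
  have slice: "torus_smooth (\<lambda>x. h (t, x))" if "torus_smooth h" for h :: "real \<times> 'b \<Rightarrow> complex"
    using torus_smooth_affine[OF that, of "Pair 0" "(t, 0)"] space_Basis
    by (auto simp: bounded_linear_Pair bounded_linear_zero bounded_linear_ident)
  have pdiff_slice: "pdiff b (\<lambda>x. h (t, x)) = (\<lambda>x. pdiff (0, b) h (t, x))"
    if "torus_smooth h" for h :: "real \<times> 'b \<Rightarrow> complex" and b
    using pdiff_affine[OF that, of "Pair 0" b "(t, 0)"]
    by (auto simp: bounded_linear_Pair bounded_linear_zero bounded_linear_ident)
  have pdiffs_slice: "pdiffs (replicate m b) (\<lambda>x. ?g (t, x)) = (\<lambda>x. pdiffs (replicate m (0, b)) ?g (t, x))"
    if "b \<in> Basis" for m b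
  proof (induction m)
    case (Suc m)
    have "torus_smooth (pdiffs (replicate m (0, b)) ?g)"
      using that space_Basis g by (intro torus_smooth_pdiffs) auto
    then show ?case using Suc pdiff_slice by simp
  qed simp
  have "norm (torus_integral (\<lambda>x. ?g (t, x) * wave l x)) * (1 + norm l) ^ q \<le>
      (1 + real DIM('b)) ^ q * (2 * pi) ^ DIM('b) * D"
  proof (rule fourier_decay[OF slice[OF g] l])
    fix b :: 'b and m x assume b: "b \<in> Basis" and m: "m \<le> q"
    \<comment> \<open>The time derivatives stand innermost, because the slice is taken of a function
      already differentiated in time.\<close>
    have "replicate m (0, b) @ replicate \<beta> (1, 0) \<in> lists (Basis :: (real \<times> 'b) set)"
      using space_Basis[OF b] time_Basis by (auto simp: in_lists_conv_set)
    moreover have "length (replicate m (0, b) @ replicate \<beta> (1 :: real, 0 :: 'b)) \<le> K + q" using m \<beta> by simp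
    ultimately have "norm (pdiffs (replicate m (0, b) @ replicate \<beta> (1, 0)) \<phi> (t, x)) \<le> D"
      using \<phi> unfolding seminorm_le_def by blast
    then show "norm (pdiffs (replicate m b) (\<lambda>x. ?g (t, x)) x) \<le> D"
      unfolding pdiffs_slice[OF b] by (simp add: pdiffs_append pdiff_funpow)
  qed
  then show "norm ((pdiff 1 ^^ \<beta>) (xhat \<phi> l) t) \<le> (1 + real DIM('b)) ^ q * (2 * pi) ^ DIM('b) * D / (1 + norm l) ^ q"
    unfolding eq by (subst pos_le_divide_eq) (auto intro!: zero_less_power add_pos_nonneg)
qed

lemma xhat_tensor: "xhat (tensor \<theta> k) l = (\<lambda>t. \<theta> t * torus_integral (wave (k + l)))"
proof
  fix t
  have "xhat (tensor \<theta> k) l t = torus_integral (\<lambda>x. \<theta> t * wave (k + l) x)"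
    by (simp add: xhat_def tensor_def wave_add mult.assoc)
  then show "xhat (tensor \<theta> k) l t = \<theta> t * torus_integral (wave (k + l))"
    by (simp only: torus_integral_cmult)
qed

section \<open>Integer frequencies and the coefficients of a distribution\<close>

lemma freq_lattice: "freq \<xi> \<in> lattice"
  by (auto simp: lattice_def freq_def Basis_vec_def inner_axis)

lemma bij_betw_freq: "bij_betw freq (UNIV :: (int ^ 'n::finite) set) lattice"
  unfolding bij_betw_def
proof
  show "inj freq" by (auto simp: inj_def freq_def vec_eq_iff)
  show "range freq = (lattice :: (real ^ 'n) set)"
  proof (intro equalityI subsetI)
    fix l :: "real ^ 'n" assume l: "l \<in> lattice"
    have "l $ i \<in> \<int>" for i
    proof -
      have "l \<bullet> axis i 1 \<in> \<int>" using l by (auto simp: lattice_def Basis_vec_def)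
      then show ?thesis by (simp add: inner_axis)
    qed
    then have "l = freq (\<chi> i. \<lfloor>l $ i\<rfloor>)" by (simp add: freq_def vec_eq_iff of_int_floor)
    then show "l \<in> range freq" by blast
  qed (auto simp: freq_lattice)
qed

lemma lattice_freqE:
  assumes "l \<in> (lattice :: (real ^ 'n::finite) set)"
  obtains \<xi> where "l = - freq \<xi>"
  using bij_betw_freq lattice_uminus[OF assms] unfolding bij_betw_def by (metis imageE minus_minus)

lemma fourier_coeff_tensor:
  "fourier_coeff w \<xi> \<theta> = w (tensor \<theta> (- freq \<xi>)) / of_real ((2 * pi) ^ CARD('n))"
  for w :: "'n::finite functional"
proof -
  have "(\<lambda>(t, x). \<theta> t * cis (- (x \<bullet> freq \<xi>))) = tensor \<theta> (- freq \<xi>)"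
    by (auto simp: tensor_def wave_def)
  then show ?thesis by (simp add: fourier_coeff_def)
qed

lemma fourier_coeff_add:
  assumes "distribution w" "torus_smooth f" "torus_smooth g"
  shows "fourier_coeff w \<xi> (\<lambda>t. f t + g t) = fourier_coeff w \<xi> f + fourier_coeff w \<xi> g"
proof -
  have "tensor (\<lambda>t. f t + g t) l = (\<lambda>z. tensor f l z + tensor g l z)" for l :: "real ^ 'a"
    by (simp add: tensor_def distrib_right)
  then show ?thesis
    using assms by (simp add: fourier_coeff_tensor distribution_add_arg torus_smooth_tensor
        lattice_uminus freq_lattice add_divide_distrib)
qed

lemma fourier_coeff_cmult:
  assumes "distribution w" "torus_smooth f"
  shows "fourier_coeff w \<xi> (\<lambda>t. c * f t) = c * fourier_coeff w \<xi> f"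
proof -
  have "tensor (\<lambda>t. c * f t) l = (\<lambda>z. c * tensor f l z)" for l :: "real ^ 'a"
    by (simp add: tensor_def mult.assoc)
  then show ?thesis
    using assms by (simp add: fourier_coeff_tensor distribution_cmult_arg torus_smooth_tensor
        lattice_uminus freq_lattice)
qed

lemma fourier_coeff_sum:
  assumes "distribution w" "\<And>i. i \<in> I \<Longrightarrow> torus_smooth (f i)"
  shows "fourier_coeff w \<xi> (\<lambda>t. \<Sum>i\<in>I. f i t) = (\<Sum>i\<in>I. fourier_coeff w \<xi> (f i))"
proof -
  have "fourier_coeff w \<xi> (\<lambda>t. 0) = 0"
    using fourier_coeff_cmult[OF assms(1), of "\<lambda>t. 0" \<xi> 0] torus_smooth_const[of 0] by simp
  then show ?thesis
    using assms(2) by (induction I rule: infinite_finite_induct)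
      (auto simp: fourier_coeff_add[OF assms(1)] torus_smooth_sum)
qed

lemma fourier_coeff_bound:
  fixes w :: "'n::finite functional"
  assumes "distribution w"
  obtains C K where "C \<ge> 0" "\<And>\<xi> \<theta> D. seminorm_le K D \<theta> \<Longrightarrow>
    norm (fourier_coeff w \<xi> \<theta>) \<le> C * (1 + norm (freq \<xi>)) ^ K * D"
proof -
  obtain C K where C: "C \<ge> 0" "\<And>f D. seminorm_le K D f \<Longrightarrow> norm (w f) \<le> C * D"
    using distribution_bound[OF assms] by metis
  show ?thesis
  proof (rule that[of "C / (2 * pi) ^ CARD('n)" K])
    fix \<xi> :: "int ^ 'n" and \<theta> :: "real \<Rightarrow> complex" and D assume \<theta>: "seminorm_le K D \<theta>"
    from C(2)[OF seminorm_le_tensor[OF this lattice_uminus[OF freq_lattice]], of \<xi>]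
    have "norm (w (tensor \<theta> (- freq \<xi>))) \<le> C * ((1 + norm (freq \<xi>)) ^ K * D)" by simp
    then show "norm (fourier_coeff w \<xi> \<theta>) \<le> C / (2 * pi) ^ CARD('n) * (1 + norm (freq \<xi>)) ^ K * D"
      by (simp add: fourier_coeff_tensor norm_divide norm_mult norm_power divide_right_mono mult.assoc)
  qed (use C in simp)
qed

lemma fourier_coeff_D_t:
  assumes "distribution w" "torus_smooth \<theta>"
  shows "fourier_coeff (D_t w) \<xi> \<theta> = \<i> * fourier_coeff w \<xi> (pdiff 1 \<theta>)"
proof -
  have l: "- freq \<xi> \<in> lattice" by (intro lattice_uminus freq_lattice)
  have "D_t w (tensor \<theta> (- freq \<xi>)) = \<i> * w (tensor (pdiff 1 \<theta>) (- freq \<xi>))"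
    unfolding D_t_def pdiff_tensor[OF assms(2) l]
    by (subst distribution_cmult_arg[OF assms(1) torus_smooth_tensor[OF torus_smooth_pdiff[OF assms(2)] l]]) auto
  then show ?thesis by (simp add: fourier_coeff_tensor)
qed

text \<open>Every character of the product torus is the tensor of a character in time with one in
  space of frequency \<open>- freq \<xi>\<close>. The partial coefficients therefore determine the
  values on all characters, which determine a distribution.\<close>

lemma fourier_coeff_eqI:
  fixes u w :: "'n::finite functional"
  assumes "distribution u" "distribution w" "torus_smooth \<phi>"
    and eq: "\<And>\<xi> \<theta>. torus_smooth \<theta> \<Longrightarrow> fourier_coeff u \<xi> \<theta> = fourier_coeff w \<xi> \<theta>"
  shows "u \<phi> = w \<phi>"
proof (rule distribution_eqI[OF assms(1,2) _ assms(3)])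
  fix k :: "real \<times> (real ^ 'n)" assume k: "k \<in> lattice"
  obtain \<tau> l where \<tau>l: "k = (\<tau>, l)" by (cases k)
  have \<tau>: "\<tau> \<in> lattice"
    using k time_Basis[where 'b = "real ^ 'n"] by (force simp: lattice_def \<tau>l)
  have "l \<in> lattice"
    using k space_Basis[where 'b = "real ^ 'n"] by (force simp: lattice_def \<tau>l)
  then obtain \<xi> where "l = - freq \<xi>" by (rule lattice_freqE)
  then show "u (wave k) = w (wave k)"
    using eq[OF torus_smooth_wave[OF \<tau>], of \<xi>] by (simp add: \<tau>l fourier_coeff_tensor tensor_wave)
qed

section \<open>Symbols\<close>

text \<open>The weight 1 + |\<xi>| and the quantifier over all \<xi> replace the large frequencies
  of the conditions (A) and (B), so that negative exponents are harmless at 0. The exponent is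
  attached to a number \<open>K\<close> of derivatives, since it may increase with it.\<close>

definition symbol_le :: "nat \<Rightarrow> real \<Rightarrow> (real \<Rightarrow> int ^ 'n::finite \<Rightarrow> complex) \<Rightarrow> bool" where
  "symbol_le K s a \<longleftrightarrow> (\<exists>C. \<forall>\<xi>. seminorm_le K (C * (1 + norm (freq \<xi>)) powr s) (\<lambda>t. a t \<xi>))"

definition moderate_symbol :: "(real \<Rightarrow> int ^ 'n::finite \<Rightarrow> complex) \<Rightarrow> bool" where
  "moderate_symbol a \<longleftrightarrow> (\<forall>K. \<exists>s. symbol_le K s a)"

definition rapid_symbol :: "(real \<Rightarrow> int ^ 'n::finite \<Rightarrow> complex) \<Rightarrow> bool" where
  "rapid_symbol a \<longleftrightarrow> (\<forall>K s. symbol_le K s a)"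

lemma weight_mono: "s \<le> s' \<Longrightarrow> (1 + norm x) powr s \<le> (1 + norm x) powr s'"
  by (rule powr_mono) auto

lemma weight_pos: "0 < (1 + norm x) powr s"
proof -
  have "0 < 1 + norm x" by (simp add: add_pos_nonneg)
  then show ?thesis by simp
qed

lemma symbol_leE:
  assumes "symbol_le K s a"
  obtains C where "C \<ge> 0" "\<And>\<xi>. seminorm_le K (C * (1 + norm (freq \<xi>)) powr s) (\<lambda>t. a t \<xi>)"
proof -
  obtain C where C: "\<And>\<xi>. seminorm_le K (C * (1 + norm (freq \<xi>)) powr s) (\<lambda>t. a t \<xi>)"
    using assms unfolding symbol_le_def by blast
  have "0 \<le> C * (1 + norm (freq (0 :: int ^ 'a))) powr s" by (rule seminorm_le_nonneg[OF C])
  then have "0 \<le> C" by (metis mult_neg_pos not_less weight_pos)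
  then show ?thesis using that C by blast
qed

lemma symbol_le_mono:
  assumes "symbol_le K s a" "s \<le> s'"
  shows "symbol_le K s' a"
proof -
  obtain C where C: "C \<ge> 0" "\<And>\<xi>. seminorm_le K (C * (1 + norm (freq \<xi>)) powr s) (\<lambda>t. a t \<xi>)"
    using assms(1) by (rule symbol_leE) blast
  have "seminorm_le K (C * (1 + norm (freq \<xi>)) powr s') (\<lambda>t. a t \<xi>)" for \<xi>
    by (rule seminorm_le_mono[OF C(2)]) (auto intro!: mult_left_mono weight_mono C assms)
  then show ?thesis unfolding symbol_le_def by blast
qed

lemma symbol_le_add:
  assumes "symbol_le K s a" "symbol_le K s b"
  shows "symbol_le K s (\<lambda>t \<xi>. a t \<xi> + b t \<xi>)"
proof -
  obtain C where C: "\<And>\<xi>. seminorm_le K (C * (1 + norm (freq \<xi>)) powr s) (\<lambda>t. a t \<xi>)"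
    using assms(1) by (rule symbol_leE) blast
  obtain D where D: "\<And>\<xi>. seminorm_le K (D * (1 + norm (freq \<xi>)) powr s) (\<lambda>t. b t \<xi>)"
    using assms(2) by (rule symbol_leE) blast
  show ?thesis
    unfolding symbol_le_def using seminorm_le_add[OF C D]
    by (intro exI[of _ "C + D"]) (simp add: distrib_right)
qed

lemma symbol_le_mult:
  assumes "symbol_le K s a" "symbol_le K s' b"
  shows "symbol_le K (s + s') (\<lambda>t \<xi>. a t \<xi> * b t \<xi>)"
proof -
  obtain C where C: "\<And>\<xi>. seminorm_le K (C * (1 + norm (freq \<xi>)) powr s) (\<lambda>t. a t \<xi>)"
    using assms(1) by (rule symbol_leE) blast
  obtain D where D: "\<And>\<xi>. seminorm_le K (D * (1 + norm (freq \<xi>)) powr s') (\<lambda>t. b t \<xi>)"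
    using assms(2) by (rule symbol_leE) blast
  show ?thesis
    unfolding symbol_le_def using seminorm_le_mult[OF C D]
    by (intro exI[of _ "2 ^ K * C * D"]) (simp add: powr_add mult_ac)
qed

lemma moderate_symbol_add:
  assumes "moderate_symbol a" "moderate_symbol b"
  shows "moderate_symbol (\<lambda>t \<xi>. a t \<xi> + b t \<xi>)"
  unfolding moderate_symbol_def
proof
  fix K
  obtain s s' where "symbol_le K s a" "symbol_le K s' b"
    using assms unfolding moderate_symbol_def by blast
  then have "symbol_le K (max s s') a" "symbol_le K (max s s') b" by (auto elim: symbol_le_mono)
  then show "\<exists>s. symbol_le K s (\<lambda>t \<xi>. a t \<xi> + b t \<xi>)" using symbol_le_add by blast
qed

lemma moderate_symbol_mult:
  "moderate_symbol a \<Longrightarrow> moderate_symbol b \<Longrightarrow> moderate_symbol (\<lambda>t \<xi>. a t \<xi> * b t \<xi>)"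
  unfolding moderate_symbol_def using symbol_le_mult by blast

lemma symbol_le_0: "symbol_le K s (\<lambda>t \<xi>. 0)"
  unfolding symbol_le_def using seminorm_le_const[of _ 0] by (intro exI[of _ 0]) simp

lemma moderate_symbol_0: "moderate_symbol (\<lambda>t \<xi>. 0)"
  unfolding moderate_symbol_def using symbol_le_0 by blast

lemma moderate_symbol_sum:
  "(\<And>i. i \<in> I \<Longrightarrow> moderate_symbol (a i)) \<Longrightarrow> moderate_symbol (\<lambda>t \<xi>. \<Sum>i\<in>I. a i t \<xi>)"
  by (induction I rule: infinite_finite_induct) (auto simp: moderate_symbol_0 moderate_symbol_add)

lemma moderate_symbol_const: "moderate_symbol (\<lambda>t (\<xi> :: int ^ 'n::finite). c)"
proof -
  have "symbol_le K 0 (\<lambda>t (\<xi> :: int ^ 'n). c)" for K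
    unfolding symbol_le_def using seminorm_le_const[of K c]
    by (intro exI[of _ "norm c"]) (simp add: add_nonneg_eq_0_iff)
  then show ?thesis unfolding moderate_symbol_def by blast
qed

lemma moderate_symbol_cmult: "moderate_symbol a \<Longrightarrow> moderate_symbol (\<lambda>t \<xi>. c * a t \<xi>)"
  by (intro moderate_symbol_mult moderate_symbol_const)

lemma moderate_symbol_smooth: "moderate_symbol a \<Longrightarrow> torus_smooth (\<lambda>t. a t \<xi>)"
  unfolding moderate_symbol_def symbol_le_def seminorm_le_def by blast

lemma moderate_symbol_pdiff:
  assumes "moderate_symbol a"
  shows "moderate_symbol (\<lambda>t \<xi>. pdiff 1 (\<lambda>s. a s \<xi>) t)"
  unfolding moderate_symbol_def
proof
  fix K
  obtain s where "symbol_le (Suc K) s a" using assms unfolding moderate_symbol_def by blast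
  then obtain C where "\<And>\<xi>. seminorm_le (Suc K) (C * (1 + norm (freq \<xi>)) powr s) (\<lambda>t. a t \<xi>)"
    by (rule symbol_leE) blast
  from seminorm_le_pdiff[OF this, of 1] have "symbol_le K s (\<lambda>t \<xi>. pdiff 1 (\<lambda>s. a s \<xi>) t)"
    unfolding symbol_le_def by (intro exI[of _ C]) simp
  then show "\<exists>s. symbol_le K s (\<lambda>t \<xi>. pdiff 1 (\<lambda>s. a s \<xi>) t)" by blast
qed

lemma rapid_imp_moderate_symbol: "rapid_symbol a \<Longrightarrow> moderate_symbol a"
  by (simp add: rapid_symbol_def moderate_symbol_def)

section \<open>Operators defined by symbols\<close>

lemma symbol_op_xhat:
  "symbol_op a w \<phi> = (\<Sum>\<^sub>\<infinity>\<xi>. fourier_coeff w \<xi> (\<lambda>t. a t \<xi> * xhat \<phi> (freq \<xi>) t))"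
  by (simp add: symbol_op_def xhat_def wave_def)

lemma summable_freq:
  "(\<lambda>\<xi> :: int ^ 'n::finite. 1 / (1 + norm (freq \<xi>)) ^ (2 * CARD('n))) summable_on UNIV"
  using summable_on_reindex_bij_betw[OF bij_betw_freq[where 'n = 'n], of "\<lambda>k. 1 / (1 + norm k) ^ (2 * CARD('n))"]
    summable_lattice[where 'a = "real ^ 'n"] by simp

lemma symbol_op_term_bound:
  fixes w :: "'n::finite functional"
  assumes w: "distribution w" and a: "moderate_symbol a"
  obtains B N where "\<And>\<phi> D \<xi>. seminorm_le N D \<phi> \<Longrightarrow>
    norm (fourier_coeff w \<xi> (\<lambda>t. a t \<xi> * xhat \<phi> (freq \<xi>) t)) \<le> B * D * (1 / (1 + norm (freq \<xi>)) ^ (2 * CARD('n)))"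
proof -
  obtain C K where C: "C \<ge> 0" "\<And>\<xi> \<theta> D. seminorm_le K D \<theta> \<Longrightarrow>
      norm (fourier_coeff w \<xi> \<theta>) \<le> C * (1 + norm (freq \<xi>)) ^ K * D"
    using fourier_coeff_bound[OF w] by metis
  obtain s where "symbol_le K s a" using a unfolding moderate_symbol_def by blast
  then have "symbol_le K (real (nat \<lceil>s\<rceil>)) a" by (rule symbol_le_mono) linarith
  then obtain E where E: "E \<ge> 0" "\<And>\<xi>. seminorm_le K (E * (1 + norm (freq \<xi>)) powr real (nat \<lceil>s\<rceil>)) (\<lambda>t. a t \<xi>)"
    by (rule symbol_leE) blast
  define M where "M = nat \<lceil>s\<rceil>"
  \<comment> \<open>The \<open>q\<close> space derivatives of \<phi> pay for the growth
    \<open>K\<close> of the coefficients, the growth \<open>M\<close> of the symbol and the summable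
    weight of exponent \<open>2 * CARD('n)\<close>.\<close>
  define q where "q = K + M + 2 * CARD('n)"
  let ?A = "(1 + real CARD('n)) ^ q * (2 * pi) ^ CARD('n)"
  show ?thesis
  proof (rule that[of "K + q" "C * 2 ^ K * E * ?A"])
    fix \<phi> :: "real \<times> (real ^ 'n) \<Rightarrow> complex" and D and \<xi> :: "int ^ 'n"
    assume \<phi>: "seminorm_le (K + q) D \<phi>"
    define x where "x = 1 + norm (freq \<xi>)"
    have x: "x > 0" by (simp add: x_def add_pos_nonneg)
    have 1: "seminorm_le K (E * x ^ M) (\<lambda>t. a t \<xi>)"
      using E(2)[of \<xi>] x by (simp add: x_def M_def powr_realpow)
    have 2: "seminorm_le K (?A * D / x ^ q) (xhat \<phi> (freq \<xi>))"
      using seminorm_le_xhat[OF \<phi> freq_lattice, of \<xi>] by (simp add: x_def)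
    have "norm (fourier_coeff w \<xi> (\<lambda>t. a t \<xi> * xhat \<phi> (freq \<xi>) t)) \<le>
        C * x ^ K * (2 ^ K * (E * x ^ M) * (?A * D / x ^ q))"
      using C(2)[OF seminorm_le_mult[OF 1 2]] by (simp add: x_def)
    also have "\<dots> = C * 2 ^ K * E * ?A * D * (1 / x ^ (2 * CARD('n)))"
      using x by (simp add: q_def power_add field_simps)
    finally show "norm (fourier_coeff w \<xi> (\<lambda>t. a t \<xi> * xhat \<phi> (freq \<xi>) t)) \<le>
        C * 2 ^ K * E * ?A * D * (1 / (1 + norm (freq \<xi>)) ^ (2 * CARD('n)))" by (simp add: x_def)
  qed
qed

lemma symbol_op_has_sum:
  fixes w :: "'n::finite functional"
  assumes w: "distribution w" and a: "moderate_symbol a" and \<phi>: "torus_smooth \<phi>"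
  shows "((\<lambda>\<xi>. fourier_coeff w \<xi> (\<lambda>t. a t \<xi> * xhat \<phi> (freq \<xi>) t)) has_sum symbol_op a w \<phi>) UNIV"
proof -
  obtain B N where BN: "\<And>\<phi> D \<xi>. seminorm_le N D \<phi> \<Longrightarrow>
    norm (fourier_coeff w \<xi> (\<lambda>t. a t \<xi> * xhat \<phi> (freq \<xi>) t)) \<le> B * D * (1 / (1 + norm (freq \<xi>)) ^ (2 * CARD('n)))"
    using symbol_op_term_bound[OF w a] by metis
  obtain D where D: "seminorm_le N D \<phi>" using seminorm_le_exists[OF \<phi>] .
  have "(\<lambda>\<xi>. norm (fourier_coeff w \<xi> (\<lambda>t. a t \<xi> * xhat \<phi> (freq \<xi>) t))) summable_on UNIV"
    by (rule summable_on_comparison_test[OF summable_on_cmult_right[OF summable_freq, of "B * D"]])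
      (use BN[OF D] in auto)
  then show ?thesis
    unfolding symbol_op_xhat by (rule has_sum_infsum[OF abs_summable_summable])
qed

lemma xhat_add:
  assumes "torus_smooth f" "torus_smooth g"
  shows "xhat (\<lambda>z. f z + g z) l = (\<lambda>t. xhat f l t + xhat g l t)"
proof
  fix t
  have cont: "continuous_on UNIV (\<lambda>x. h (t, x) * wave l x)" if "torus_smooth h" for h :: "real \<times> 'a \<Rightarrow> complex"
    by (intro continuous_on_mult continuous_on_wave
        continuous_on_compose2[OF torus_smooth_continuous_on[OF that, of UNIV]] continuous_intros) auto
  show "xhat (\<lambda>z. f z + g z) l t = xhat f l t + xhat g l t"
    unfolding xhat_def distrib_right by (intro torus_integral_add cont assms)
qed

lemma xhat_cmult: "xhat (\<lambda>z. c * f z) l = (\<lambda>t. c * xhat f l t)"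
  unfolding xhat_def mult.assoc by (simp add: torus_integral_cmult)

lemma distribution_symbol_op:
  fixes w :: "'n::finite functional"
  assumes w: "distribution w" and a: "moderate_symbol a"
  shows "distribution (symbol_op a w)"
proof -
  let ?T = "\<lambda>\<phi> \<xi>. fourier_coeff w \<xi> (\<lambda>t. a t \<xi> * xhat \<phi> (freq \<xi>) t)"
  note sum = symbol_op_has_sum[OF w a]
  have smooth: "torus_smooth (\<lambda>t. a t \<xi> * xhat \<phi> (freq \<xi>) t)" if "torus_smooth \<phi>" for \<phi> \<xi>
    using that a by (intro torus_smooth_mult torus_smooth_xhat moderate_symbol_smooth)
  obtain B N where BN: "\<And>\<phi> D \<xi>. seminorm_le N D \<phi> \<Longrightarrow>
    norm (?T \<phi> \<xi>) \<le> B * D * (1 / (1 + norm (freq \<xi>)) ^ (2 * CARD('n)))"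
    using symbol_op_term_bound[OF w a] by metis
  let ?S = "\<Sum>\<^sub>\<infinity>\<xi> :: int ^ 'n. 1 / (1 + norm (freq \<xi>)) ^ (2 * CARD('n))"
  show ?thesis
  proof (rule distributionI[where N = N and C = "B * ?S"])
    fix f g :: "real \<times> (real ^ 'n) \<Rightarrow> complex" assume fg: "torus_smooth f" "torus_smooth g"
    have "?T (\<lambda>z. f z + g z) \<xi> = ?T f \<xi> + ?T g \<xi>" for \<xi>
      unfolding xhat_add[OF fg] distrib_left by (rule fourier_coeff_add[OF w smooth[OF fg(1)] smooth[OF fg(2)]])
    then show "symbol_op a w (\<lambda>z. f z + g z) = symbol_op a w f + symbol_op a w g"
      using has_sum_add[OF sum[OF fg(1)] sum[OF fg(2)]] by (simp add: symbol_op_xhat[of _ _ "\<lambda>z. f z + g z"] infsumI)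
  next
    fix c and f :: "real \<times> (real ^ 'n) \<Rightarrow> complex" assume f: "torus_smooth f"
    have "?T (\<lambda>z. c * f z) \<xi> = c * ?T f \<xi>" for \<xi>
      unfolding xhat_cmult mult.left_commute[of _ c] by (rule fourier_coeff_cmult[OF w smooth[OF f]])
    then show "symbol_op a w (\<lambda>z. c * f z) = c * symbol_op a w f"
      by (simp add: symbol_op_xhat infsum_cmult_right')
  next
    fix f :: "real \<times> (real ^ 'n) \<Rightarrow> complex" and D assume f: "seminorm_le N D f"
    have "norm (symbol_op a w f) \<le> B * D * ?S"
    proof (rule norm_infsum_le)
      show "(?T f has_sum symbol_op a w f) UNIV" using f by (intro sum) (simp add: seminorm_le_def)
      show "((\<lambda>\<xi> :: int ^ 'n. B * D * (1 / (1 + norm (freq \<xi>)) ^ (2 * CARD('n)))) has_sum B * D * ?S) UNIV"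
        by (intro has_sum_cmult_right has_sum_infsum summable_freq)
      show "norm (?T f \<xi>) \<le> B * D * (1 / (1 + norm (freq \<xi>)) ^ (2 * CARD('n)))" for \<xi>
        by (rule BN[OF f])
    qed
    then show "norm (symbol_op a w f) \<le> B * ?S * D" by (simp add: mult_ac)
  qed
qed

text \<open>On a tensor, orthogonality of characters leaves a single term of the series. The volume
  factor from the integral of \<open>wave 0\<close> cancels the normalization of the
  coefficient.\<close>

lemma fourier_coeff_symbol_op:
  fixes w :: "'n::finite functional"
  assumes w: "distribution w" and a: "\<And>\<xi>. torus_smooth (\<lambda>t. a t \<xi>)" and \<theta>: "torus_smooth \<theta>"
  shows "fourier_coeff (symbol_op a w) \<xi> \<theta> = fourier_coeff w \<xi> (\<lambda>t. a t \<xi> * \<theta> t)"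
proof -
  let ?V = "complex_of_real ((2 * pi) ^ CARD('n))"
  let ?T = "\<lambda>\<eta>. fourier_coeff w \<eta> (\<lambda>t. a t \<eta> * xhat (tensor \<theta> (- freq \<xi>)) (freq \<eta>) t)"
  have lat: "- freq \<xi> + freq \<eta> \<in> lattice" for \<eta> by (intro lattice_add lattice_uminus freq_lattice)
  have eq: "(- freq \<xi> + freq \<eta> = 0) = (\<eta> = \<xi>)" for \<eta> :: "int ^ 'n"
    using bij_betw_freq unfolding bij_betw_def inj_def by (metis add.commute add.right_inverse add_left_imp_eq)
  have T: "?T \<eta> = (if \<eta> = \<xi> then ?V * fourier_coeff w \<xi> (\<lambda>t. a t \<xi> * \<theta> t) else 0)" for \<eta>
  proof (cases "\<eta> = \<xi>")
    case True
    have "?T \<xi> = fourier_coeff w \<xi> (\<lambda>t. ?V * (a t \<xi> * \<theta> t))"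
      unfolding xhat_tensor torus_integral_wave[OF lat] by (simp add: mult_ac)
    also have "\<dots> = ?V * fourier_coeff w \<xi> (\<lambda>t. a t \<xi> * \<theta> t)"
      by (intro fourier_coeff_cmult w torus_smooth_mult a \<theta>)
    finally show ?thesis using True by simp
  next
    case False
    then have "?T \<eta> = fourier_coeff w \<eta> (\<lambda>t. 0 * 0)"
      unfolding xhat_tensor torus_integral_wave[OF lat] eq by simp
    also have "\<dots> = 0 * fourier_coeff w \<eta> (\<lambda>t. 0)"
      by (intro fourier_coeff_cmult w torus_smooth_const)
    finally show ?thesis using False by simp
  qed
  have "symbol_op a w (tensor \<theta> (- freq \<xi>)) = infsum ?T UNIV" by (rule symbol_op_xhat)
  also have "\<dots> = infsum ?T {\<xi>}" by (rule infsum_cong_neutral) (auto simp: T)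
  also have "\<dots> = ?V * fourier_coeff w \<xi> (\<lambda>t. a t \<xi> * \<theta> t)" by (simp add: T)
  finally show ?thesis by (simp add: fourier_coeff_tensor[of "symbol_op a w"])
qed

section \<open>Regularity in the time variable\<close>

text \<open>\<open>m\<close> is the growth exponent in the frequency and \<open>K\<close> the order in time. As the \<open>p\<close>-th derivative
  of \<open>\<theta>\<close> is tested, the estimate for all \<open>p\<close> with a common \<open>K\<close> expresses smoothness in time. The
  number \<open>J\<close> of derivatives of \<open>a\<close> is kept explicit because the growth of a symbol may depend on
  the number of derivatives taken: smoothness in \<open>x\<close> requires all \<open>m\<close> with one \<open>J\<close>.\<close>

definition functional_bound ::
  "nat \<Rightarrow> nat \<Rightarrow> nat \<Rightarrow> real \<Rightarrow> (int ^ 'n::finite \<Rightarrow> (real \<Rightarrow> complex) \<Rightarrow> complex) \<Rightarrow> bool" where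
  "functional_bound J K p m F \<longleftrightarrow> (\<exists>C\<ge>0. \<forall>\<xi> a \<theta> A D. seminorm_le J A a \<longrightarrow> seminorm_le K D \<theta> \<longrightarrow>
     norm (F \<xi> (\<lambda>t. a t * (pdiff 1 ^^ p) \<theta> t)) \<le> C * (1 + norm (freq \<xi>)) powr m * A * D)"

lemma functional_boundE:
  assumes "functional_bound J K p m F"
  obtains C where "C \<ge> 0" "\<And>\<xi> a \<theta> A D. seminorm_le J A a \<Longrightarrow> seminorm_le K D \<theta> \<Longrightarrow>
     norm (F \<xi> (\<lambda>t. a t * (pdiff 1 ^^ p) \<theta> t)) \<le> C * (1 + norm (freq \<xi>)) powr m * A * D"
  using assms unfolding functional_bound_def by blast

lemma functional_boundI:
  assumes "C \<ge> 0" "\<And>\<xi> a \<theta> A D. seminorm_le J A a \<Longrightarrow> seminorm_le K D \<theta> \<Longrightarrow>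
     norm (F \<xi> (\<lambda>t. a t * (pdiff 1 ^^ p) \<theta> t)) \<le> C * (1 + norm (freq \<xi>)) powr m * A * D"
  shows "functional_bound J K p m F"
  using assms unfolding functional_bound_def by blast

lemma functional_bound_mono:
  assumes "functional_bound J K p m F" "J \<le> J'" "K \<le> K'" "m \<le> m'"
  shows "functional_bound J' K' p m' F"
proof -
  obtain C where C: "C \<ge> 0" "\<And>\<xi> a \<theta> A D. seminorm_le J A a \<Longrightarrow> seminorm_le K D \<theta> \<Longrightarrow>
     norm (F \<xi> (\<lambda>t. a t * (pdiff 1 ^^ p) \<theta> t)) \<le> C * (1 + norm (freq \<xi>)) powr m * A * D"
    using assms(1) by (rule functional_boundE) blast
  show ?thesis
  proof (rule functional_boundI[OF C(1)])
    fix \<xi> :: "int ^ 'a" and a \<theta> :: "real \<Rightarrow> complex" and A D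
    assume a: "seminorm_le J' A a" and \<theta>: "seminorm_le K' D \<theta>"
    have "seminorm_le J A a" "seminorm_le K D \<theta>" using a \<theta> assms by (auto elim: seminorm_le_mono)
    from C(2)[OF this, of \<xi>]
    have "norm (F \<xi> (\<lambda>t. a t * (pdiff 1 ^^ p) \<theta> t)) \<le> C * (1 + norm (freq \<xi>)) powr m * A * D" .
    also have "\<dots> \<le> C * (1 + norm (freq \<xi>)) powr m' * A * D"
      using C(1) a \<theta> assms(4)
      by (intro mult_right_mono mult_left_mono weight_mono) (auto intro: seminorm_le_nonneg)
    finally show "norm (F \<xi> (\<lambda>t. a t * (pdiff 1 ^^ p) \<theta> t)) \<le> C * (1 + norm (freq \<xi>)) powr m' * A * D" .
  qed
qed

lemma functional_bound_cong:
  assumes "functional_bound J K p m F" "\<And>\<xi> \<theta>. torus_smooth \<theta> \<Longrightarrow> G \<xi> \<theta> = F \<xi> \<theta>"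
  shows "functional_bound J K p m G"
proof -
  obtain C where C: "C \<ge> 0" "\<And>\<xi> a \<theta> A D. seminorm_le J A a \<Longrightarrow> seminorm_le K D \<theta> \<Longrightarrow>
     norm (F \<xi> (\<lambda>t. a t * (pdiff 1 ^^ p) \<theta> t)) \<le> C * (1 + norm (freq \<xi>)) powr m * A * D"
    using assms(1) by (rule functional_boundE) blast
  show ?thesis
  proof (rule functional_boundI[OF C(1)])
    fix \<xi> :: "int ^ 'a" and a \<theta> :: "real \<Rightarrow> complex" and A D
    assume a: "seminorm_le J A a" and \<theta>: "seminorm_le K D \<theta>"
    then have "torus_smooth (\<lambda>t. a t * (pdiff 1 ^^ p) \<theta> t)"
      by (auto simp: seminorm_le_def intro!: torus_smooth_mult torus_smooth_funpow)
    then show "norm (G \<xi> (\<lambda>t. a t * (pdiff 1 ^^ p) \<theta> t)) \<le> C * (1 + norm (freq \<xi>)) powr m * A * D"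
      using C(2)[OF a \<theta>] assms(2) by simp
  qed
qed

lemma functional_bound_add:
  assumes "functional_bound J K p m F" "functional_bound J K p m G"
  shows "functional_bound J K p m (\<lambda>\<xi> \<theta>. F \<xi> \<theta> + G \<xi> \<theta>)"
proof -
  obtain C where C: "C \<ge> 0" "\<And>\<xi> a \<theta> A D. seminorm_le J A a \<Longrightarrow> seminorm_le K D \<theta> \<Longrightarrow>
     norm (F \<xi> (\<lambda>t. a t * (pdiff 1 ^^ p) \<theta> t)) \<le> C * (1 + norm (freq \<xi>)) powr m * A * D"
    using assms(1) by (rule functional_boundE) blast
  obtain C' where C': "C' \<ge> 0" "\<And>\<xi> a \<theta> A D. seminorm_le J A a \<Longrightarrow> seminorm_le K D \<theta> \<Longrightarrow>
     norm (G \<xi> (\<lambda>t. a t * (pdiff 1 ^^ p) \<theta> t)) \<le> C' * (1 + norm (freq \<xi>)) powr m * A * D"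
    using assms(2) by (rule functional_boundE) blast
  show ?thesis
  proof (rule functional_boundI[of "C + C'"])
    fix \<xi> :: "int ^ 'a" and a \<theta> :: "real \<Rightarrow> complex" and A D
    assume a: "seminorm_le J A a" and \<theta>: "seminorm_le K D \<theta>"
    from norm_triangle_mono[OF C(2)[OF a \<theta>] C'(2)[OF a \<theta>]]
    show "norm (F \<xi> (\<lambda>t. a t * (pdiff 1 ^^ p) \<theta> t) + G \<xi> (\<lambda>t. a t * (pdiff 1 ^^ p) \<theta> t)) \<le>
        (C + C') * (1 + norm (freq \<xi>)) powr m * A * D"
      by (simp add: distrib_right)
  qed (use C C' in simp)
qed

lemma functional_bound_cmult:
  assumes "functional_bound J K p m F"
  shows "functional_bound J K p m (\<lambda>\<xi> \<theta>. c * F \<xi> \<theta>)"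
proof -
  obtain C where C: "C \<ge> 0" "\<And>\<xi> a \<theta> A D. seminorm_le J A a \<Longrightarrow> seminorm_le K D \<theta> \<Longrightarrow>
     norm (F \<xi> (\<lambda>t. a t * (pdiff 1 ^^ p) \<theta> t)) \<le> C * (1 + norm (freq \<xi>)) powr m * A * D"
    using assms(1) by (rule functional_boundE) blast
  show ?thesis
  proof (rule functional_boundI[of "norm c * C"])
    fix \<xi> :: "int ^ 'a" and a \<theta> :: "real \<Rightarrow> complex" and A D
    assume a: "seminorm_le J A a" and \<theta>: "seminorm_le K D \<theta>"
    from mult_left_mono[OF C(2)[OF a \<theta>], of "norm c" \<xi>]
    show "norm (c * F \<xi> (\<lambda>t. a t * (pdiff 1 ^^ p) \<theta> t)) \<le> norm c * C * (1 + norm (freq \<xi>)) powr m * A * D"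
      by (simp add: norm_mult mult.assoc)
  qed (use C in simp)
qed

lemma functional_bound_0: "functional_bound J K p m (\<lambda>\<xi> \<theta>. 0)"
  by (rule functional_boundI[of 0]) auto

lemma functional_bound_sum:
  "(\<And>i. i \<in> I \<Longrightarrow> functional_bound J K p m (F i)) \<Longrightarrow> functional_bound J K p m (\<lambda>\<xi> \<theta>. \<Sum>i\<in>I. F i \<xi> \<theta>)"
  by (induction I rule: infinite_finite_induct) (auto intro: functional_bound_add functional_bound_0)

lemma functional_bound_uniform:
  fixes F :: "'i::finite \<Rightarrow> _"
  assumes "\<And>i. \<exists>J m. functional_bound J K p m (F i)"
  obtains J m where "\<And>i. functional_bound J K p m (F i)"
proof -
  obtain f h where fh: "\<And>i. functional_bound (h i) K p (f i) (F i)" using assms by metis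
  have "f i \<le> (\<Sum>i\<in>UNIV. \<bar>f i\<bar>)" "h i \<le> (\<Sum>i\<in>UNIV. h i)" for i
    using member_le_sum[of i UNIV "\<lambda>i. \<bar>f i\<bar>"] member_le_sum[of i UNIV h] by simp_all
  then have "functional_bound (\<Sum>i\<in>UNIV. h i) K p (\<Sum>i\<in>UNIV. \<bar>f i\<bar>) (F i)" for i
    using functional_bound_mono[OF fh _ order_refl] by blast
  then show ?thesis by (rule that)
qed

text \<open>The reason for the factor \<open>a\<close> in the bound: a symbol is merged into it, so
  that neither \<open>p\<close> nor \<open>K\<close> changes and only the exponent is
  shifted.\<close>

lemma functional_bound_symbol:
  assumes F: "functional_bound J K p m F" and b: "symbol_le J s b"
  shows "functional_bound J K p (s + m) (\<lambda>\<xi> \<theta>. F \<xi> (\<lambda>t. b t \<xi> * \<theta> t))"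
proof -
  obtain C where C: "C \<ge> 0" "\<And>\<xi> a \<theta> A D. seminorm_le J A a \<Longrightarrow> seminorm_le K D \<theta> \<Longrightarrow>
     norm (F \<xi> (\<lambda>t. a t * (pdiff 1 ^^ p) \<theta> t)) \<le> C * (1 + norm (freq \<xi>)) powr m * A * D"
    using F by (rule functional_boundE) blast
  obtain B where B: "B \<ge> 0" "\<And>\<xi>. seminorm_le J (B * (1 + norm (freq \<xi>)) powr s) (\<lambda>t. b t \<xi>)"
    using b by (rule symbol_leE) blast
  show ?thesis
  proof (rule functional_boundI[of "C * 2 ^ J * B"])
    fix \<xi> :: "int ^ 'a" and a \<theta> :: "real \<Rightarrow> complex" and A D
    assume a: "seminorm_le J A a" and \<theta>: "seminorm_le K D \<theta>"
    have "norm (F \<xi> (\<lambda>t. (b t \<xi> * a t) * (pdiff 1 ^^ p) \<theta> t)) \<le>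
        C * (1 + norm (freq \<xi>)) powr m * (2 ^ J * (B * (1 + norm (freq \<xi>)) powr s) * A) * D"
      by (rule C(2)[OF seminorm_le_mult[OF B(2) a] \<theta>])
    then show "norm (F \<xi> (\<lambda>t. b t \<xi> * (a t * (pdiff 1 ^^ p) \<theta> t))) \<le>
        C * 2 ^ J * B * (1 + norm (freq \<xi>)) powr (s + m) * A * D"
      by (simp add: powr_add mult_ac)
  qed (use C B in simp)
qed

text \<open>Since \<open>a \<psi>' = (a \<psi>)' - a' \<psi>\<close>, a derivative of \<open>\<theta>\<close> can be traded for one of the functional.\<close>

lemma functional_bound_Suc:
  assumes F: "functional_bound J K p m F" and dF: "functional_bound J K p m (\<lambda>\<xi> \<theta>. F \<xi> (pdiff 1 \<theta>))"
    and add: "\<And>\<xi> f g. torus_smooth f \<Longrightarrow> torus_smooth g \<Longrightarrow> F \<xi> (\<lambda>t. f t + g t) = F \<xi> f + F \<xi> g"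
  shows "functional_bound (Suc J) K (Suc p) m F"
proof -
  obtain C where C: "C \<ge> 0" "\<And>\<xi> a \<theta> A D. seminorm_le J A a \<Longrightarrow> seminorm_le K D \<theta> \<Longrightarrow>
     norm (F \<xi> (\<lambda>t. a t * (pdiff 1 ^^ p) \<theta> t)) \<le> C * (1 + norm (freq \<xi>)) powr m * A * D"
    using F by (rule functional_boundE) blast
  obtain C' where C': "C' \<ge> 0" "\<And>\<xi> a \<theta> A D. seminorm_le J A a \<Longrightarrow> seminorm_le K D \<theta> \<Longrightarrow>
     norm (F \<xi> (pdiff 1 (\<lambda>t. a t * (pdiff 1 ^^ p) \<theta> t))) \<le> C' * (1 + norm (freq \<xi>)) powr m * A * D"
    using dF by (rule functional_boundE) blast
  show ?thesis
  proof (rule functional_boundI[of "C' + C"])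
    fix \<xi> :: "int ^ 'a" and a \<theta> :: "real \<Rightarrow> complex" and A D
    assume a: "seminorm_le (Suc J) A a" and \<theta>: "seminorm_le K D \<theta>"
    let ?\<psi> = "(pdiff 1 ^^ p) \<theta>"
    have sm: "torus_smooth a" "torus_smooth ?\<psi>"
      using a \<theta> by (auto simp: seminorm_le_def intro: torus_smooth_funpow)
    have a': "seminorm_le J A a" "seminorm_le J A (pdiff 1 a)"
      using a by (auto elim!: seminorm_le_mono intro: seminorm_le_pdiff)
    have "pdiff 1 (\<lambda>t. a t * ?\<psi> t) = (\<lambda>t. pdiff 1 a t * ?\<psi> t + a t * pdiff 1 ?\<psi> t)"
      using pdiff_mult[OF sm] by blast
    then have "F \<xi> (pdiff 1 (\<lambda>t. a t * ?\<psi> t)) =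
        F \<xi> (\<lambda>t. pdiff 1 a t * ?\<psi> t) + F \<xi> (\<lambda>t. a t * pdiff 1 ?\<psi> t)"
      using sm by (simp add: add torus_smooth_mult torus_smooth_pdiff)
    then have "F \<xi> (\<lambda>t. a t * (pdiff 1 ^^ Suc p) \<theta> t) =
        F \<xi> (pdiff 1 (\<lambda>t. a t * ?\<psi> t)) - F \<xi> (\<lambda>t. pdiff 1 a t * ?\<psi> t)" by simp
    also have "norm \<dots> \<le> C' * (1 + norm (freq \<xi>)) powr m * A * D + C * (1 + norm (freq \<xi>)) powr m * A * D"
      by (rule order_trans[OF norm_triangle_ineq4 add_mono[OF C'(2)[OF a'(1) \<theta>] C(2)[OF a'(2) \<theta>]]])
    finally show "norm (F \<xi> (\<lambda>t. a t * (pdiff 1 ^^ Suc p) \<theta> t)) \<le>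
        (C' + C) * (1 + norm (freq \<xi>)) powr m * A * D" by (simp add: distrib_right)
  qed (use C C' in simp)
qed

lemma functional_bound_distribution:
  fixes w :: "'n::finite functional"
  assumes "distribution w"
  obtains J K m where "functional_bound J K 0 m (fourier_coeff w)"
proof -
  obtain C K where C: "C \<ge> 0" "\<And>\<xi> \<theta> D. seminorm_le K D \<theta> \<Longrightarrow>
      norm (fourier_coeff w \<xi> \<theta>) \<le> C * (1 + norm (freq \<xi>)) ^ K * D"
    using fourier_coeff_bound[OF assms] by metis
  have "functional_bound K K 0 (real K) (fourier_coeff w)"
  proof (rule functional_boundI[of "C * 2 ^ K"])
    fix \<xi> :: "int ^ 'n" and a \<theta> :: "real \<Rightarrow> complex" and A D
    assume "seminorm_le K A a" "seminorm_le K D \<theta>"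
    from C(2)[OF seminorm_le_mult[OF this], of \<xi>]
    show "norm (fourier_coeff w \<xi> (\<lambda>t. a t * (pdiff 1 ^^ 0) \<theta> t)) \<le>
        C * 2 ^ K * (1 + norm (freq \<xi>)) powr real K * A * D"
      by (simp add: powr_realpow add_pos_nonneg mult_ac)
  qed (use C in simp)
  then show ?thesis by (rule that)
qed

text \<open>The order of the quantifiers is essential: one \<open>K\<close> for all
  \<open>p\<close>, and for each \<open>p\<close> one \<open>J\<close> for all \<open>m\<close>. For
  distributions this characterizes smoothness, and it is stable under symbols whose growth depends
  on \<open>J\<close>.\<close>

definition fully_regular :: "'n::finite functional \<Rightarrow> bool" where
  "fully_regular w \<longleftrightarrow> (\<exists>K. \<forall>p. \<exists>J. \<forall>m. functional_bound J K p m (fourier_coeff w))"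

text \<open>Decay in \<xi> comes from space derivatives of \<open>f\<close> alone, as the factor and
  \<theta> depend only on time. Each of the \<open>p\<close> time derivatives is then integrated by
  parts onto \<open>f\<close> or onto the factor, which accounts for \<open>J = p\<close>, and no
  derivative stays on \<theta>.\<close>

lemma functional_bound_torus_integral:
  fixes f :: "real \<times> (real ^ 'n::finite) \<Rightarrow> complex"
  assumes "torus_smooth f"
  shows "functional_bound p 0 p m (\<lambda>\<xi> \<theta>. torus_integral (\<lambda>z. f z * tensor \<theta> (- freq \<xi>) z))"
  using assms
proof (induction p arbitrary: f)
  case (0 f)
  \<comment> \<open>Chosen so that \<open>- real q \<le> m\<close>, also when \<open>m\<close> is
    positive.\<close>
  define q where "q = nat \<lceil>- m\<rceil>"
  obtain B where B: "seminorm_le q B f" using seminorm_le_exists[OF 0] .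
  let ?C = "(1 + real DIM(real \<times> (real ^ 'n))) ^ q * (2 * pi) ^ DIM(real \<times> (real ^ 'n)) * B"
  show ?case
  proof (rule functional_boundI[of ?C])
    show "0 \<le> ?C" using seminorm_le_nonneg[OF B] by simp
    fix \<xi> :: "int ^ 'n" and a \<theta> :: "real \<Rightarrow> complex" and A D
    assume a: "seminorm_le 0 A a" and \<theta>: "seminorm_le 0 D \<theta>"
    let ?h = "\<lambda>t. a t * \<theta> t"
    \<comment> \<open>The time component is 0, so that \<open>fourier_decay\<close> asks for no time
      derivative of the factor \<open>?h\<close>, of which only the supremum is controlled.\<close>
    let ?k = "(0, - freq \<xi>) :: real \<times> (real ^ 'n)"
    have h: "torus_smooth ?h" using a \<theta> by (auto simp: seminorm_le_def intro: torus_smooth_mult)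
    have hb: "norm (?h t) \<le> A * D" for t
      using a \<theta> seminorm_le_nonneg[OF a] by (auto simp: seminorm_le_real norm_mult intro!: mult_mono)
    have k: "?k \<in> lattice"
      using lattice_uminus[OF freq_lattice, of \<xi>] by (auto simp: lattice_def elim!: Basis_prod_cases)
    have g: "torus_smooth (\<lambda>z. f z * ?h (fst z))" by (intro torus_smooth_mult 0 torus_smooth_fst[OF h])
    have "norm (torus_integral (\<lambda>z. f z * ?h (fst z) * wave ?k z)) * (1 + norm ?k) ^ q \<le>
        (1 + real DIM(real \<times> (real ^ 'n))) ^ q * (2 * pi) ^ DIM(real \<times> (real ^ 'n)) * (B * (A * D))"
    proof (rule fourier_decay[OF g k])
      fix b :: "real \<times> (real ^ 'n)" and j z
      assume b: "b \<in> Basis" "j \<le> q" "j = 0 \<or> ?k \<bullet> b \<noteq> 0"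
      have "pdiffs (replicate j b) (\<lambda>z. f z * ?h (fst z)) = (\<lambda>z. pdiffs (replicate j b) f z * ?h (fst z))"
        using b(1)
      proof (cases rule: Basis_prod_cases)
        case 1
        then show ?thesis using b(3) by simp
      next
        case (2 c)
        show ?thesis
        proof (induction j)
          case (Suc j)
          have "torus_smooth (pdiffs (replicate j b) f)" using b(1) 0 by (intro torus_smooth_pdiffs) auto
          then have "pdiff b (\<lambda>z. pdiffs (replicate j b) f z * ?h (fst z)) z = pdiffs (replicate (Suc j) b) f z * ?h (fst z)" for z
            using 2 pdiff_fst[OF h, of b z] by (subst pdiff_mult) (auto intro: torus_smooth_fst h simp: pdiff_0[OF h])
          then show ?case using Suc by auto
        qed simp
      qed
      moreover have "norm (pdiffs (replicate j b) f z) \<le> B"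
      proof -
        have "replicate j b \<in> lists Basis" "length (replicate j b) \<le> q" using b(1,2) by auto
        then show ?thesis using B unfolding seminorm_le_def by blast
      qed
      ultimately show "norm (pdiffs (replicate j b) (\<lambda>z. f z * ?h (fst z)) z) \<le> B * (A * D)"
        using hb[of "fst z"] seminorm_le_nonneg[OF B] by (simp add: norm_mult mult_mono)
    qed
    then have "norm (torus_integral (\<lambda>z. f z * tensor ?h (- freq \<xi>) z)) * (1 + norm (freq \<xi>)) ^ q \<le> ?C * A * D"
      by (simp add: tensor_def wave_def inner_prod_def norm_Pair mult_ac)
    then have "norm (torus_integral (\<lambda>z. f z * tensor ?h (- freq \<xi>) z)) \<le> ?C * A * D / (1 + norm (freq \<xi>)) ^ q"
      by (subst pos_le_divide_eq) (auto intro!: zero_less_power add_pos_nonneg)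
    also have "\<dots> = ?C * A * D * (1 + norm (freq \<xi>)) powr (- real q)"
      by (simp add: powr_minus powr_realpow add_pos_nonneg divide_inverse)
    also have "\<dots> \<le> ?C * A * D * (1 + norm (freq \<xi>)) powr m"
    proof (intro mult_left_mono weight_mono)
      show "- real q \<le> m" unfolding q_def by linarith
      show "0 \<le> ?C * A * D"
        using seminorm_le_nonneg[OF B] seminorm_le_nonneg[OF a] seminorm_le_nonneg[OF \<theta>] by simp
    qed
    finally show "norm (torus_integral (\<lambda>z. f z * tensor (\<lambda>t. a t * (pdiff 1 ^^ 0) \<theta> t) (- freq \<xi>) z)) \<le>
        ?C * (1 + norm (freq \<xi>)) powr m * A * D" by (simp add: mult_ac)
  qed
next
  case (Suc p f)
  have l: "- freq \<xi> \<in> lattice" for \<xi> :: "int ^ 'n" by (intro lattice_uminus freq_lattice)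
  show ?case
  proof (rule functional_bound_Suc[OF Suc.IH[OF Suc.prems]])
    have f': "torus_smooth (pdiff (1, 0) f)" by (intro torus_smooth_pdiff Suc.prems time_Basis)
    show "functional_bound p 0 p m (\<lambda>\<xi> \<theta>. torus_integral (\<lambda>z. f z * tensor (pdiff 1 \<theta>) (- freq \<xi>) z))"
    proof (rule functional_bound_cong[OF functional_bound_cmult[OF Suc.IH[OF f'], of "- 1"]])
      fix \<xi> :: "int ^ 'n" and \<theta> :: "real \<Rightarrow> complex" assume \<theta>: "torus_smooth \<theta>"
      show "torus_integral (\<lambda>z. f z * tensor (pdiff 1 \<theta>) (- freq \<xi>) z) =
          - 1 * torus_integral (\<lambda>z. pdiff (1, 0) f z * tensor \<theta> (- freq \<xi>) z)"
        using torus_integral_by_parts[OF Suc.prems torus_smooth_tensor[OF \<theta> l] time_Basis]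
        unfolding pdiff_tensor(1)[OF \<theta> l] by simp
    qed
  next
    fix \<xi> :: "int ^ 'n" and g h :: "real \<Rightarrow> complex" assume gh: "torus_smooth g" "torus_smooth h"
    have "tensor (\<lambda>t. g t + h t) (- freq \<xi>) z = tensor g (- freq \<xi>) z + tensor h (- freq \<xi>) z" for z
      by (simp add: tensor_def distrib_right)
    then show "torus_integral (\<lambda>z. f z * tensor (\<lambda>t. g t + h t) (- freq \<xi>) z) =
        torus_integral (\<lambda>z. f z * tensor g (- freq \<xi>) z) + torus_integral (\<lambda>z. f z * tensor h (- freq \<xi>) z)"
      by (simp add: distrib_left) (intro torus_integral_add torus_smooth_continuous_on torus_smooth_mult
          Suc.prems torus_smooth_tensor gh l)
  qed
qed

lemma smooth_imp_fully_regular: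
  fixes w :: "'n::finite functional"
  assumes "smooth_distribution w"
  shows "fully_regular w"
proof -
  obtain f where f: "torus_smooth f" "\<And>\<phi>. torus_smooth \<phi> \<Longrightarrow> w \<phi> = torus_integral (\<lambda>z. f z * \<phi> z)"
    using assms unfolding smooth_distribution_def by blast
  have "functional_bound p 0 p m (fourier_coeff w)" for p m
    by (rule functional_bound_cong[OF functional_bound_cmult[OF functional_bound_torus_integral[OF f(1)],
            of _ _ "1 / of_real ((2 * pi) ^ CARD('n))"]])
      (simp add: fourier_coeff_tensor f(2) torus_smooth_tensor lattice_uminus freq_lattice)
  then show ?thesis unfolding fully_regular_def by blast
qed

lemma funpow_pdiff_wave: "(pdiff 1 ^^ p) (wave \<tau>) = (\<lambda>t. (\<i> * of_real \<tau>) ^ p * wave \<tau> t)" for \<tau> :: real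
proof (induction p)
  case (Suc p)
  have "((\<lambda>t. (\<i> * of_real \<tau>) ^ p * wave \<tau> t) has_derivative
      (\<lambda>h. (\<i> * of_real \<tau>) ^ p * (\<i> * of_real (h \<bullet> \<tau>) * wave \<tau> t))) (at t)" for t
    by (intro has_derivative_mult_right wave_has_derivative)
  from pdiff_eqI[OF this, of 1] show ?case using Suc by (auto simp: mult_ac)
qed simp

text \<open>Testing with \<theta> = \<open>wave \<tau>\<close> and factor 1, the p-th derivative
  produces |\<tau>|^p on the left, while the seminorm of order \<open>K\<close> costs only (1 +
  |\<tau>|)^K on the right. As \<open>K\<close> is the same for all \<open>p\<close>, taking p = q +
  K leaves decay of order q in \<tau>; the exponent m = - q gives the decay in \<xi>.\<close>

lemma fully_regular_imp_smooth:
  fixes w :: "'n::finite functional"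
  assumes w: "distribution w" and reg: "fully_regular w"
  shows "smooth_distribution w"
proof (rule smooth_distributionI[OF w])
  obtain K where K: "\<And>p. \<exists>J. \<forall>m. functional_bound J K p m (fourier_coeff w)"
    using reg unfolding fully_regular_def by blast
  have est: "\<exists>C\<ge>0. \<forall>\<xi> \<tau>. \<tau> \<in> lattice \<longrightarrow> norm (w (wave (\<tau>, - freq \<xi>))) * (1 + norm (freq \<xi>)) ^ q * \<bar>\<tau>\<bar> ^ p \<le>
      C * (1 + \<bar>\<tau>\<bar>) ^ K" for p q
  proof -
    obtain J where "functional_bound J K p (- real q) (fourier_coeff w)" using K by blast
    then obtain C where C: "C \<ge> 0" "\<And>\<xi> a \<theta> A D. seminorm_le J A a \<Longrightarrow> seminorm_le K D \<theta> \<Longrightarrow>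
       norm (fourier_coeff w \<xi> (\<lambda>t. a t * (pdiff 1 ^^ p) \<theta> t)) \<le> C * (1 + norm (freq \<xi>)) powr (- real q) * A * D"
      by (rule functional_boundE) blast
    obtain A where A: "seminorm_le J A (\<lambda>t :: real. 1 :: complex)" using seminorm_le_exists[OF torus_smooth_const] .
    let ?V = "(2 * pi) ^ CARD('n)"
    have "norm (w (wave (\<tau>, - freq \<xi>))) * (1 + norm (freq \<xi>)) ^ q * \<bar>\<tau>\<bar> ^ p \<le> (?V * C * A) * (1 + \<bar>\<tau>\<bar>) ^ K"
      if \<tau>: "\<tau> \<in> lattice" for \<xi> and \<tau> :: real
    proof -
      have "norm (\<i> * complex_of_real \<tau>) ^ j \<le> (1 + \<bar>\<tau>\<bar>) ^ K" if "j \<le> K" for j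
      proof -
        have "norm (\<i> * complex_of_real \<tau>) ^ j \<le> (1 + \<bar>\<tau>\<bar>) ^ j" by (intro power_mono) (auto simp: norm_mult)
        also have "\<dots> \<le> (1 + \<bar>\<tau>\<bar>) ^ K" using that by (intro power_increasing) auto
        finally show ?thesis .
      qed
      then have "seminorm_le K ((1 + \<bar>\<tau>\<bar>) ^ K) (wave \<tau>)"
        unfolding seminorm_le_real funpow_pdiff_wave using torus_smooth_wave[OF \<tau>]
        by (simp add: norm_mult norm_power)
      from C(2)[OF A this, of \<xi>]
      have "norm (fourier_coeff w \<xi> (\<lambda>t. (\<i> * of_real \<tau>) ^ p * wave \<tau> t)) \<le>
          C * (1 + norm (freq \<xi>)) powr (- real q) * A * (1 + \<bar>\<tau>\<bar>) ^ K"
        by (simp add: funpow_pdiff_wave)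
      moreover have "norm (fourier_coeff w \<xi> (\<lambda>t. (\<i> * of_real \<tau>) ^ p * wave \<tau> t)) =
          \<bar>\<tau>\<bar> ^ p * (norm (w (wave (\<tau>, - freq \<xi>))) / ?V)"
        by (subst fourier_coeff_cmult[OF w torus_smooth_wave[OF \<tau>]])
          (simp add: fourier_coeff_tensor tensor_wave norm_mult norm_divide norm_power)
      ultimately have "\<bar>\<tau>\<bar> ^ p * (norm (w (wave (\<tau>, - freq \<xi>))) / ?V) \<le>
          C * (1 + norm (freq \<xi>)) powr (- real q) * A * (1 + \<bar>\<tau>\<bar>) ^ K" by simp
      from mult_right_mono[OF this, of "?V * (1 + norm (freq \<xi>)) ^ q"]
      have "\<bar>\<tau>\<bar> ^ p * (norm (w (wave (\<tau>, - freq \<xi>))) / ?V) * (?V * (1 + norm (freq \<xi>)) ^ q) \<le>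
          C * (1 + norm (freq \<xi>)) powr (- real q) * A * (1 + \<bar>\<tau>\<bar>) ^ K * (?V * (1 + norm (freq \<xi>)) ^ q)"
        by (simp add: zero_le_mult_iff)
      also have "\<dots> = ?V * C * A * (1 + \<bar>\<tau>\<bar>) ^ K * ((1 + norm (freq \<xi>)) powr (- real q) * (1 + norm (freq \<xi>)) ^ q)"
        by (simp add: mult_ac)
      also have "(1 + norm (freq \<xi>)) powr (- real q) * (1 + norm (freq \<xi>)) ^ q = 1"
      proof -
        have "0 < 1 + norm (freq \<xi>)" by (simp add: add_pos_nonneg)
        then show ?thesis by (simp add: powr_minus powr_realpow less_imp_neq[symmetric])
      qed
      finally show ?thesis by (simp add: mult_ac)
    qed
    moreover have "0 \<le> ?V * C * A" using C seminorm_le_nonneg[OF A] by simp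
    ultimately show ?thesis by blast
  qed
  show "rapidly_decreasing (\<lambda>k. w (wave k))"
    unfolding rapidly_decreasing_def
  proof
    fix q
    \<comment> \<open>The case p = 0 controls small \<tau>, where the power |\<tau>|^p gives
      nothing; p = q + K controls large \<tau>. The two estimates are added.\<close>
    obtain C0 where C0: "C0 \<ge> 0" "\<And>\<xi> \<tau>. \<tau> \<in> lattice \<Longrightarrow> norm (w (wave (\<tau>, - freq \<xi>))) * (1 + norm (freq \<xi>)) ^ q * \<bar>\<tau>\<bar> ^ 0 \<le>
      C0 * (1 + \<bar>\<tau>\<bar>) ^ K" using est[of q 0] by blast
    obtain C1 where C1: "C1 \<ge> 0" "\<And>\<xi> \<tau>. \<tau> \<in> lattice \<Longrightarrow> norm (w (wave (\<tau>, - freq \<xi>))) * (1 + norm (freq \<xi>)) ^ q * \<bar>\<tau>\<bar> ^ (q + K) \<le>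
      C1 * (1 + \<bar>\<tau>\<bar>) ^ K" using est[of q "q + K"] by blast
    have "norm (w (wave k)) * (1 + norm k) ^ q \<le> 2 ^ (q + K) * (C0 + C1)" if k: "k \<in> lattice" for k
    proof -
      obtain \<tau> l where \<tau>l: "k = (\<tau>, l)" by (cases k)
      have \<tau>: "\<tau> \<in> lattice"
        using k time_Basis[where 'b = "real ^ 'n"] by (force simp: lattice_def \<tau>l)
      have "l \<in> lattice"
        using k space_Basis[where 'b = "real ^ 'n"] by (force simp: lattice_def \<tau>l)
      then obtain \<xi> where l: "l = - freq \<xi>" by (rule lattice_freqE)
      define x where "x = norm (w (wave (\<tau>, - freq \<xi>))) * (1 + norm (freq \<xi>)) ^ q"
      have x: "x \<ge> 0" by (simp add: x_def)
      have pos: "(1 + \<bar>\<tau>\<bar>) ^ K > 0" by (intro zero_less_power) auto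
      have *: "(1 + \<bar>\<tau>\<bar>) ^ (q + K) \<le> 2 ^ (q + K) * (1 + \<bar>\<tau>\<bar> ^ (q + K))"
      proof (cases "\<bar>\<tau>\<bar> \<le> 1")
        case True
        then have "(1 + \<bar>\<tau>\<bar>) ^ (q + K) \<le> 2 ^ (q + K) * 1" unfolding mult_1_right by (intro power_mono) auto
        also have "\<dots> \<le> 2 ^ (q + K) * (1 + \<bar>\<tau>\<bar> ^ (q + K))" by (intro mult_left_mono) auto
        finally show ?thesis .
      next
        case False
        then have "(1 + \<bar>\<tau>\<bar>) ^ (q + K) \<le> (2 * \<bar>\<tau>\<bar>) ^ (q + K)" by (intro power_mono) auto
        also have "\<dots> \<le> 2 ^ (q + K) * (1 + \<bar>\<tau>\<bar> ^ (q + K))"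
          unfolding power_mult_distrib by (intro mult_left_mono) auto
        finally show ?thesis .
      qed
      have "x * (1 + \<bar>\<tau>\<bar>) ^ q * (1 + \<bar>\<tau>\<bar>) ^ K = x * (1 + \<bar>\<tau>\<bar>) ^ (q + K)" by (simp add: power_add)
      also have "\<dots> \<le> x * (2 ^ (q + K) * (1 + \<bar>\<tau>\<bar> ^ (q + K)))" using * x by (rule mult_left_mono)
      also have "\<dots> = 2 ^ (q + K) * (x * \<bar>\<tau>\<bar> ^ 0 + x * \<bar>\<tau>\<bar> ^ (q + K))" by (simp add: algebra_simps)
      also have "\<dots> \<le> 2 ^ (q + K) * (C0 * (1 + \<bar>\<tau>\<bar>) ^ K + C1 * (1 + \<bar>\<tau>\<bar>) ^ K)"
        using C0(2)[OF \<tau>, of \<xi>] C1(2)[OF \<tau>, of \<xi>] unfolding x_def by (intro mult_left_mono add_mono) auto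
      finally have "x * (1 + \<bar>\<tau>\<bar>) ^ q * (1 + \<bar>\<tau>\<bar>) ^ K \<le> 2 ^ (q + K) * (C0 + C1) * (1 + \<bar>\<tau>\<bar>) ^ K"
        by (simp add: algebra_simps)
      then have x_le: "x * (1 + \<bar>\<tau>\<bar>) ^ q \<le> 2 ^ (q + K) * (C0 + C1)" using pos by (simp only: mult_le_cancel_right_pos)
      have "norm k \<le> \<bar>\<tau>\<bar> + norm (freq \<xi>)" using norm_Pair_le[of \<tau> "- freq \<xi>"] by (simp add: \<tau>l l)
      moreover have "(1 + norm (freq \<xi>)) * (1 + \<bar>\<tau>\<bar>) = 1 + \<bar>\<tau>\<bar> + norm (freq \<xi>) + \<bar>\<tau>\<bar> * norm (freq \<xi>)"
        by (simp add: algebra_simps)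
      moreover have "0 \<le> \<bar>\<tau>\<bar> * norm (freq \<xi>)" by simp
      ultimately have "1 + norm k \<le> (1 + norm (freq \<xi>)) * (1 + \<bar>\<tau>\<bar>)" by linarith
      then have "(1 + norm k) ^ q \<le> ((1 + norm (freq \<xi>)) * (1 + \<bar>\<tau>\<bar>)) ^ q" by (intro power_mono) auto
      then have "norm (w (wave k)) * (1 + norm k) ^ q \<le> norm (w (wave k)) * ((1 + norm (freq \<xi>)) * (1 + \<bar>\<tau>\<bar>)) ^ q"
        by (intro mult_left_mono) auto
      also have "\<dots> = x * (1 + \<bar>\<tau>\<bar>) ^ q" by (simp add: x_def \<tau>l l power_mult_distrib mult_ac)
      finally show ?thesis using x_le by linarith
    qed
    then show "\<exists>C. \<forall>k\<in>lattice. norm (w (wave k)) * (1 + norm k) ^ q \<le> C" by blast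
  qed
qed

text \<open>Here the exponent of \<open>w\<close> may depend on \<open>p\<close>. Once
  \<open>p\<close> has fixed \<open>J\<close> and \<open>m'\<close>, the symbol with
  \<open>J\<close> derivatives decays at the rate \<open>m - m'\<close> for whatever
  \<open>m\<close> is wanted, and \<open>J\<close> remains the same.\<close>

lemma smooth_symbol_op_rapid:
  fixes w :: "'n::finite functional"
  assumes w: "distribution w" and reg: "\<And>p. \<exists>J m. functional_bound J K p m (fourier_coeff w)" and b: "rapid_symbol b"
  shows "smooth_distribution (symbol_op b w)"
proof (rule fully_regular_imp_smooth)
  have mod: "moderate_symbol b" using b by (rule rapid_imp_moderate_symbol)
  then show "distribution (symbol_op b w)" by (rule distribution_symbol_op[OF w])
  have "\<exists>J. \<forall>m. functional_bound J K p m (fourier_coeff (symbol_op b w))" for p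
  proof -
    obtain J m' where m': "functional_bound J K p m' (fourier_coeff w)" using reg by blast
    have "functional_bound J K p m (fourier_coeff (symbol_op b w))" for m
    proof -
      have "symbol_le J (m - m') b" using b by (simp add: rapid_symbol_def)
      from functional_bound_symbol[OF m' this]
      have "functional_bound J K p m (\<lambda>\<xi> \<theta>. fourier_coeff w \<xi> (\<lambda>t. b t \<xi> * \<theta> t))" by simp
      then show ?thesis
        by (rule functional_bound_cong) (rule fourier_coeff_symbol_op[OF w moderate_symbol_smooth[OF mod]])
    qed
    then show ?thesis by blast
  qed
  then show "fully_regular (symbol_op b w)" unfolding fully_regular_def by blast
qed

text \<open>In \<open>fully_regular\<close> the number \<open>J\<close> is fixed before
  \<open>m\<close>. It determines the growth exponent \<open>s\<close> of the symbol, and the bound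
  for \<open>w\<close> is then used with \<open>m - s\<close>.\<close>

lemma smooth_symbol_op_moderate:
  fixes w :: "'n::finite functional"
  assumes w: "distribution w" "smooth_distribution w" and b: "moderate_symbol b"
  shows "smooth_distribution (symbol_op b w)"
proof (rule fully_regular_imp_smooth)
  show "distribution (symbol_op b w)" by (rule distribution_symbol_op[OF w(1) b])
  obtain K where K: "\<And>p. \<exists>J. \<forall>m. functional_bound J K p m (fourier_coeff w)"
    using smooth_imp_fully_regular[OF w(2)] unfolding fully_regular_def by blast
  have "\<exists>J. \<forall>m. functional_bound J K p m (fourier_coeff (symbol_op b w))" for p
  proof -
    obtain J where J: "\<And>m. functional_bound J K p m (fourier_coeff w)" using K by blast
    obtain s where s: "symbol_le J s b" using b by (auto simp: moderate_symbol_def)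
    have "functional_bound J K p m (fourier_coeff (symbol_op b w))" for m
    proof -
      from functional_bound_symbol[OF J[of "m - s"] s]
      have "functional_bound J K p m (\<lambda>\<xi> \<theta>. fourier_coeff w \<xi> (\<lambda>t. b t \<xi> * \<theta> t))" by simp
      then show ?thesis
        by (rule functional_bound_cong) (rule fourier_coeff_symbol_op[OF w(1) moderate_symbol_smooth[OF b]])
    qed
    then show ?thesis by blast
  qed
  then show "fully_regular (symbol_op b w)" unfolding fully_regular_def by blast
qed

text \<open>The equation expresses \<open>\<theta> \<mapsto> u\<^sub>\<xi>(\<theta>')\<close> through \<open>u\<^sub>\<xi>\<close> itself and a smooth term, so that
  estimates for the derivatives of the test function follow inductively without raising the order \<open>K\<close>.\<close>

lemma first_order_system_regularity:
  fixes u g :: "'m::finite \<Rightarrow> 'n::finite functional"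
  assumes u: "\<And>j. distribution (u j)" and a: "\<And>j k. moderate_symbol (a j k)"
    and g: "\<And>j. smooth_distribution (g j)"
    and eq: "\<And>j \<xi> \<theta>. torus_smooth \<theta> \<Longrightarrow> fourier_coeff (g j) \<xi> \<theta> =
      \<i> * fourier_coeff (u j) \<xi> (pdiff 1 \<theta>) + (\<Sum>k\<in>UNIV. fourier_coeff (u k) \<xi> (\<lambda>t. a j k t \<xi> * \<theta> t))"
  obtains K where "\<And>p j. \<exists>J m. functional_bound J K p m (fourier_coeff (u j))"
proof -
  have "\<exists>J K m. functional_bound J K 0 m (fourier_coeff (u j))" for j
    using functional_bound_distribution[OF u] by metis
  then obtain Ju Ku mu where Ku: "\<And>j. functional_bound (Ju j) (Ku j) 0 (mu j) (fourier_coeff (u j))" by metis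
  have "\<exists>K. \<forall>p. \<exists>J. \<forall>m. functional_bound J K p m (fourier_coeff (g j))" for j
    using smooth_imp_fully_regular[OF g] unfolding fully_regular_def by blast
  then obtain Kg where Kg: "\<And>j p. \<exists>J. \<forall>m. functional_bound J (Kg j) p m (fourier_coeff (g j))" by metis
  \<comment> \<open>One order for all components and all right-hand sides; the sum serves as a
    common upper bound.\<close>
  define K where "K = (\<Sum>j\<in>UNIV. Ku j + Kg j)"
  have K: "Ku j + Kg j \<le> K" for j unfolding K_def by (rule member_le_sum) auto
  have "\<exists>J m. functional_bound J K p m (fourier_coeff (u j))" for p j
  proof (induction p arbitrary: j)
    case 0
    have "functional_bound (Ju j) K 0 (mu j) (fourier_coeff (u j))"
      by (rule functional_bound_mono[OF Ku]) (use K[of j] in auto)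
    then show ?case by blast
  next
    case (Suc p)
    have ex: "\<exists>J m. functional_bound J K p m (\<lambda>\<xi> \<theta>. fourier_coeff (u k) \<xi> (\<lambda>t. a j k t \<xi> * \<theta> t))" for k
    proof -
      obtain J m where m: "functional_bound J K p m (fourier_coeff (u k))" using Suc by blast
      obtain s where "symbol_le J s (a j k)" using a[of j k] unfolding moderate_symbol_def by blast
      from functional_bound_symbol[OF m this] show ?thesis by blast
    qed
    obtain J1 m1 where 1: "\<And>k. functional_bound J1 K p m1 (\<lambda>\<xi> \<theta>. fourier_coeff (u k) \<xi> (\<lambda>t. a j k t \<xi> * \<theta> t))"
      using functional_bound_uniform[of K p "\<lambda>k \<xi> \<theta>. fourier_coeff (u k) \<xi> (\<lambda>t. a j k t \<xi> * \<theta> t)", OF ex] by blast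
    obtain J2 m2 where 2: "functional_bound J2 K p m2 (fourier_coeff (u j))" using Suc by blast
    \<comment> \<open>For the smooth right-hand side every exponent is available; 0 is chosen and
      enters \<open>m\<close> through the maximum.\<close>
    obtain J3 where 3: "functional_bound J3 (Kg j) p 0 (fourier_coeff (g j))" using Kg by blast
    define J where "J = J1 + J2 + J3"
    define m where "m = max 0 (max m1 m2)"
    have sum: "functional_bound J K p m (\<lambda>\<xi> \<theta>. \<Sum>k\<in>UNIV. fourier_coeff (u k) \<xi> (\<lambda>t. a j k t \<xi> * \<theta> t))"
      by (rule functional_bound_mono[OF functional_bound_sum[OF 1]]) (auto simp: J_def m_def)
    have uj: "functional_bound J K p m (fourier_coeff (u j))"
      by (rule functional_bound_mono[OF 2]) (auto simp: J_def m_def)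
    have gj: "functional_bound J K p m (fourier_coeff (g j))"
      by (rule functional_bound_mono[OF 3]) (use K[of j] in \<open>auto simp: J_def m_def\<close>)
    \<comment> \<open>The equation is solved for its derivative term: - i inverts the factor i in
      front of \<open>fourier_coeff (u j) \<xi> (pdiff 1 \<theta>)\<close>.\<close>
    have "functional_bound J K p m (\<lambda>\<xi> \<theta>. - \<i> * (fourier_coeff (g j) \<xi> \<theta> + (- 1) *
        (\<Sum>k\<in>UNIV. fourier_coeff (u k) \<xi> (\<lambda>t. a j k t \<xi> * \<theta> t))))"
      by (intro functional_bound_cmult functional_bound_add gj sum)
    then have "functional_bound J K p m (\<lambda>\<xi> \<theta>. fourier_coeff (u j) \<xi> (pdiff 1 \<theta>))"
      by (rule functional_bound_cong) (simp add: eq)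
    with uj have "functional_bound (Suc J) K (Suc p) m (fourier_coeff (u j))"
      by (rule functional_bound_Suc) (rule fourier_coeff_add[OF u])
    then show ?case by blast
  qed
  then show ?thesis by (rule that)
qed

section \<open>Matrix operators\<close>

definition moderate_matrix :: "('n::finite, 'm::finite) matrix_symbol \<Rightarrow> bool" where
  "moderate_matrix A \<longleftrightarrow> (\<forall>j k. moderate_symbol (\<lambda>t \<xi>. A t \<xi> $ j $ k))"

definition first_order :: "('n::finite, 'm::finite) matrix_symbol \<Rightarrow> ('n, 'm) system" where
  "first_order A u = (\<lambda>j \<phi>. D_t (u j) \<phi> + matrix_op A u j \<phi>)"

lemma moderate_matrixD: "moderate_matrix A \<Longrightarrow> moderate_symbol (\<lambda>t \<xi>. A t \<xi> $ j $ k)"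
  by (simp add: moderate_matrix_def)

lemma moderate_matrix_add:
  "moderate_matrix A \<Longrightarrow> moderate_matrix B \<Longrightarrow> moderate_matrix (\<lambda>t \<xi>. A t \<xi> + B t \<xi>)"
  by (simp add: moderate_matrix_def moderate_symbol_add)

lemma moderate_matrix_minus:
  assumes "moderate_matrix A"
  shows "moderate_matrix (\<lambda>t \<xi>. - A t \<xi>)"
  unfolding moderate_matrix_def
proof (intro allI)
  show "moderate_symbol (\<lambda>t \<xi>. (- A t \<xi>) $ j $ k)" for j k
    using moderate_symbol_cmult[OF moderate_matrixD[OF assms, of j k], of "- 1"] by simp
qed

lemma moderate_matrix_smooth: "moderate_matrix A \<Longrightarrow> torus_smooth (\<lambda>t. A t \<xi> $ j $ k)"
  by (rule moderate_symbol_smooth[OF moderate_matrixD])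

lemma moderate_matrix_mult:
  "moderate_matrix A \<Longrightarrow> moderate_matrix B \<Longrightarrow> moderate_matrix (\<lambda>t \<xi>. A t \<xi> ** B t \<xi>)"
  unfolding moderate_matrix_def matrix_matrix_mult_def
  by (simp add: moderate_symbol_sum moderate_symbol_mult)

lemma fourier_coeff_add_functional:
  "fourier_coeff (\<lambda>\<phi>. u \<phi> + w \<phi>) \<xi> \<theta> = fourier_coeff u \<xi> \<theta> + fourier_coeff w \<xi> \<theta>"
  by (simp add: fourier_coeff_def add_divide_distrib)

lemma fourier_coeff_sum_functional:
  "fourier_coeff (\<lambda>\<phi>. \<Sum>i\<in>I. u i \<phi>) \<xi> \<theta> = (\<Sum>i\<in>I. fourier_coeff (u i) \<xi> \<theta>)"
  by (simp add: fourier_coeff_def sum_divide_distrib)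

lemma distribution_matrix_op:
  assumes "\<And>j. distribution (u j)" "moderate_matrix A"
  shows "distribution (matrix_op A u j)"
  unfolding matrix_op_def using assms
  by (intro distribution_sum distribution_symbol_op) (auto simp: moderate_matrix_def)

lemma fourier_coeff_matrix_op:
  assumes "\<And>j. distribution (u j)" "moderate_matrix A" "torus_smooth \<theta>"
  shows "fourier_coeff (matrix_op A u j) \<xi> \<theta> = (\<Sum>k\<in>UNIV. fourier_coeff (u k) \<xi> (\<lambda>t. A t \<xi> $ j $ k * \<theta> t))"
  unfolding matrix_op_def fourier_coeff_sum_functional
  by (intro sum.cong refl fourier_coeff_symbol_op assms moderate_matrix_smooth)

lemma distribution_first_order:
  "(\<And>j. distribution (u j)) \<Longrightarrow> moderate_matrix A \<Longrightarrow> distribution (first_order A u j)"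
  unfolding first_order_def by (intro distribution_add distribution_D_t distribution_matrix_op)

lemma fourier_coeff_first_order:
  assumes "\<And>j. distribution (u j)" "moderate_matrix A" "torus_smooth \<theta>"
  shows "fourier_coeff (first_order A u j) \<xi> \<theta> =
    \<i> * fourier_coeff (u j) \<xi> (pdiff 1 \<theta>) + (\<Sum>k\<in>UNIV. fourier_coeff (u k) \<xi> (\<lambda>t. A t \<xi> $ j $ k * \<theta> t))"
  unfolding first_order_def fourier_coeff_add_functional
  by (simp only: fourier_coeff_D_t fourier_coeff_matrix_op assms)

lemma smooth_matrix_op:
  assumes "\<And>j. distribution (u j)" "\<And>j. smooth_distribution (u j)" "moderate_matrix A"
  shows "smooth_distribution (matrix_op A u j)"
  unfolding matrix_op_def
  by (intro smooth_distribution_sum smooth_symbol_op_moderate assms moderate_matrixD)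

lemma smooth_distribution_fourier_cong:
  assumes "distribution u" "distribution w" "smooth_distribution u"
    and "\<And>\<xi> \<theta>. torus_smooth \<theta> \<Longrightarrow> fourier_coeff u \<xi> \<theta> = fourier_coeff w \<xi> \<theta>"
  shows "smooth_distribution w"
  by (rule smooth_distribution_cong[OF assms(3)]) (rule fourier_coeff_eqI[OF assms(1,2) _ assms(4)])

section \<open>Global hypoellipticity under perturbation and conjugation\<close>

lemma globally_hypoellipticD:
  "globally_hypoelliptic A \<Longrightarrow> (\<And>j. distribution (u j)) \<Longrightarrow> (\<And>j. smooth_distribution (A u j)) \<Longrightarrow>
    smooth_distribution (u j)"
  unfolding globally_hypoelliptic_def by blast

text \<open>Functionals are unconstrained off the smooth periodic functions, so identities between
  operators are available only on smooth test functions. Global hypoellipticity does not see the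
  difference.\<close>

lemma globally_hypoelliptic_cong:
  assumes "\<And>u j \<phi>. (\<And>j. distribution (u j)) \<Longrightarrow> torus_smooth \<phi> \<Longrightarrow> X u j \<phi> = Y u j \<phi>"
  shows "globally_hypoelliptic X \<longleftrightarrow> globally_hypoelliptic Y"
proof -
  have "smooth_distribution (X u j) \<longleftrightarrow> smooth_distribution (Y u j)" if "\<And>j. distribution (u j)" for u j
    using smooth_distribution_cong[of "X u j" "Y u j"] smooth_distribution_cong[of "Y u j" "X u j"]
      assms[of u, OF that] by auto
  then show ?thesis unfolding globally_hypoelliptic_def by blast
qed

lemma fourier_coeff_matrix_add:
  assumes "\<And>j. distribution (u j)" "moderate_matrix A" "moderate_matrix B" "torus_smooth \<theta>"
  shows "(\<Sum>k\<in>UNIV. fourier_coeff (u k) \<xi> (\<lambda>t. (A t \<xi> + B t \<xi>) $ j $ k * \<theta> t)) =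
    (\<Sum>k\<in>UNIV. fourier_coeff (u k) \<xi> (\<lambda>t. A t \<xi> $ j $ k * \<theta> t)) +
    (\<Sum>k\<in>UNIV. fourier_coeff (u k) \<xi> (\<lambda>t. B t \<xi> $ j $ k * \<theta> t))"
  unfolding sum.distrib[symmetric] vector_add_component distrib_right
  by (intro sum.cong refl fourier_coeff_add torus_smooth_mult assms moderate_matrix_smooth)

lemma matrix_op_add:
  assumes "\<And>j. distribution (u j)" "moderate_matrix A" "moderate_matrix B" "torus_smooth \<phi>"
  shows "matrix_op (\<lambda>t \<xi>. A t \<xi> + B t \<xi>) u j \<phi> = matrix_op A u j \<phi> + matrix_op B u j \<phi>"
  by (rule fourier_coeff_eqI[OF distribution_matrix_op distribution_add[OF distribution_matrix_op distribution_matrix_op]])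
    (simp_all add: assms moderate_matrix_add fourier_coeff_add_functional fourier_coeff_matrix_op fourier_coeff_matrix_add
      del: vector_add_component)

text \<open>Regularity in time is extracted from the equation with \<open>A\<close> alone. It makes
  \<open>matrix_op B u\<close> smooth, so the equation with \<open>A + B\<close> also has a smooth
  right-hand side. Since \<open>B\<close> may be replaced by its negative, one implication
  suffices.\<close>

lemma globally_hypoelliptic_perturbation:
  fixes A B :: "('n::finite, 'm::finite) matrix_symbol"
  assumes A: "moderate_matrix A" and B: "\<And>j k. rapid_symbol (\<lambda>t \<xi>. B t \<xi> $ j $ k)"
    and gh: "globally_hypoelliptic (first_order (\<lambda>t \<xi>. A t \<xi> + B t \<xi>))"
  shows "globally_hypoelliptic (first_order A)"
  unfolding globally_hypoelliptic_def
proof (intro allI impI, elim conjE)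
  fix u :: "'m \<Rightarrow> 'n functional" and j
  assume "\<forall>j. distribution (u j)" "\<forall>j. smooth_distribution (first_order A u j)"
  then have u: "\<And>j. distribution (u j)" and g: "\<And>j. smooth_distribution (first_order A u j)" by blast+
  have Bm: "moderate_matrix B"
    unfolding moderate_matrix_def using B by (auto intro: rapid_imp_moderate_symbol)
  obtain K where K: "\<And>p j. \<exists>J m. functional_bound J K p m (fourier_coeff (u j))"
    using first_order_system_regularity[of u "\<lambda>j k t \<xi>. A t \<xi> $ j $ k" "first_order A u",
        OF u moderate_matrixD[OF A] g fourier_coeff_first_order[OF u A]] by blast
  have Bu: "smooth_distribution (matrix_op B u j)" for j
    unfolding matrix_op_def by (intro smooth_distribution_sum smooth_symbol_op_rapid[OF u K B])
  have "smooth_distribution (first_order (\<lambda>t \<xi>. A t \<xi> + B t \<xi>) u j)" for j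
  proof (rule smooth_distribution_cong[OF smooth_distribution_add[OF g Bu]])
    fix \<phi> :: "real \<times> (real ^ 'n) \<Rightarrow> complex" assume "torus_smooth \<phi>"
    from matrix_op_add[of u, OF u A Bm this]
    show "first_order A u j \<phi> + matrix_op B u j \<phi> = first_order (\<lambda>t \<xi>. A t \<xi> + B t \<xi>) u j \<phi>"
      by (simp add: first_order_def)
  qed
  then show "smooth_distribution (u j)" by (rule globally_hypoellipticD[OF gh u])
qed

text \<open>On each Fourier mode in x the operators multiply by functions of t. Hence the symbol of
  a composition is exactly the matrix product, without lower-order terms.\<close>

lemma matrix_op_compose:
  assumes u: "\<And>j. distribution (u j)" and A: "moderate_matrix A" and B: "moderate_matrix B" and \<phi>: "torus_smooth \<phi>"
  shows "matrix_op A (matrix_op B u) j \<phi> = matrix_op (\<lambda>t \<xi>. A t \<xi> ** B t \<xi>) u j \<phi>"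
proof (rule fourier_coeff_eqI[OF _ _ \<phi>])
  have Bu: "distribution (matrix_op B u j)" for j by (intro distribution_matrix_op u B)
  then show "distribution (matrix_op A (matrix_op B u) j)" by (rule distribution_matrix_op[OF _ A])
  show "distribution (matrix_op (\<lambda>t \<xi>. A t \<xi> ** B t \<xi>) u j)"
    by (intro distribution_matrix_op u moderate_matrix_mult A B)
  fix \<xi> and \<theta> :: "real \<Rightarrow> complex" assume \<theta>: "torus_smooth \<theta>"
  have sm: "torus_smooth (\<lambda>t. A t \<xi> $ j $ k * \<theta> t)" "torus_smooth (\<lambda>t. B t \<xi> $ k $ l * (A t \<xi> $ j $ k * \<theta> t))" for k l
    by (intro torus_smooth_mult moderate_matrix_smooth A B \<theta>)+
  have "fourier_coeff (matrix_op A (matrix_op B u) j) \<xi> \<theta> =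
      (\<Sum>k\<in>UNIV. \<Sum>l\<in>UNIV. fourier_coeff (u l) \<xi> (\<lambda>t. B t \<xi> $ k $ l * (A t \<xi> $ j $ k * \<theta> t)))"
    by (simp add: fourier_coeff_matrix_op[OF Bu A \<theta>] fourier_coeff_matrix_op[OF u B sm(1)])
  also have "\<dots> = (\<Sum>l\<in>UNIV. fourier_coeff (u l) \<xi> (\<lambda>t. \<Sum>k\<in>UNIV. B t \<xi> $ k $ l * (A t \<xi> $ j $ k * \<theta> t)))"
    by (subst sum.swap) (intro sum.cong refl fourier_coeff_sum[symmetric] u sm)
  also have "\<dots> = fourier_coeff (matrix_op (\<lambda>t \<xi>. A t \<xi> ** B t \<xi>) u j) \<xi> \<theta>"
    unfolding fourier_coeff_matrix_op[OF u moderate_matrix_mult[OF A B] \<theta>]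
    by (simp add: matrix_matrix_mult_def sum_distrib_right sum_distrib_left mult_ac)
  finally show "fourier_coeff (matrix_op A (matrix_op B u) j) \<xi> \<theta> =
      fourier_coeff (matrix_op (\<lambda>t \<xi>. A t \<xi> ** B t \<xi>) u j) \<xi> \<theta>" .
qed

lemma moderate_matrix_one: "moderate_matrix (\<lambda>t \<xi>. mat 1)"
  by (simp add: moderate_matrix_def moderate_symbol_const)

lemma matrix_op_one:
  assumes u: "\<And>j. distribution (u j)" and \<phi>: "torus_smooth \<phi>"
  shows "matrix_op (\<lambda>t \<xi>. mat 1) u j \<phi> = u j \<phi>"
proof (rule fourier_coeff_eqI[OF distribution_matrix_op[OF u moderate_matrix_one] u \<phi>])
  fix \<xi> and \<theta> :: "real \<Rightarrow> complex" assume \<theta>: "torus_smooth \<theta>"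
  have "fourier_coeff (u k) \<xi> (\<lambda>t. (mat 1 :: complex ^ 'a ^ 'a) $ j $ k * \<theta> t) = (if k = j then fourier_coeff (u j) \<xi> \<theta> else 0)" for k
    using fourier_coeff_cmult[OF u torus_smooth_const, of k \<xi> 0 0] by (auto simp: mat_def)
  then show "fourier_coeff (matrix_op (\<lambda>t \<xi>. mat 1) u j) \<xi> \<theta> = fourier_coeff (u j) \<xi> \<theta>"
    by (simp add: fourier_coeff_matrix_op[OF u moderate_matrix_one \<theta>])
qed

definition matrix_D_t :: "('n::finite, 'm::finite) matrix_symbol \<Rightarrow> ('n, 'm) matrix_symbol" where
  "matrix_D_t S t \<xi> = (\<chi> j k. - \<i> * pdiff 1 (\<lambda>s. S s \<xi> $ j $ k) t)"

lemma moderate_matrix_D_t: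
  assumes "moderate_matrix S"
  shows "moderate_matrix (matrix_D_t S)"
  unfolding moderate_matrix_def
proof (intro allI)
  show "moderate_symbol (\<lambda>t \<xi>. matrix_D_t S t \<xi> $ j $ k)" for j k
    using moderate_symbol_cmult[OF moderate_symbol_pdiff[OF moderate_matrixD[OF assms, of j k]], of "- \<i>"]
    by (simp add: matrix_D_t_def)
qed

text \<open>By the Leibniz rule, moving \<open>D_t\<close> past \<open>S\<close> leaves a
  multiplication by the matrix \<open>matrix_D_t S\<close>; the hypothesis \<open>conj\<close> says
  that \<open>A'\<close> absorbs this term.\<close>

lemma first_order_matrix_op:
  fixes v :: "'m::finite \<Rightarrow> 'n::finite functional"
  assumes v: "\<And>j. distribution (v j)" and A: "moderate_matrix A" and A': "moderate_matrix A'" and S: "moderate_matrix S"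
    and conj: "\<And>t \<xi>. A t \<xi> ** S t \<xi> + matrix_D_t S t \<xi> = S t \<xi> ** A' t \<xi>" and \<phi>: "torus_smooth \<phi>"
  shows "first_order A (matrix_op S v) j \<phi> = matrix_op S (first_order A' v) j \<phi>"
proof (rule fourier_coeff_eqI[OF _ _ \<phi>])
  have Sv: "distribution (matrix_op S v j)" for j by (intro distribution_matrix_op v S)
  then show "distribution (first_order A (matrix_op S v) j)" by (rule distribution_first_order[OF _ A])
  have A'v: "distribution (first_order A' v j)" for j by (intro distribution_first_order v A')
  then show "distribution (matrix_op S (first_order A' v) j)" by (rule distribution_matrix_op[OF _ S])
  fix \<xi> and \<theta> :: "real \<Rightarrow> complex" assume \<theta>: "torus_smooth \<theta>"
  let ?F = "\<lambda>M. \<Sum>l\<in>UNIV. fourier_coeff (v l) \<xi> (\<lambda>t. M t \<xi> $ j $ l * \<theta> t)"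
  have S_sm: "torus_smooth (\<lambda>t. S t \<xi> $ j $ l)" for l by (intro moderate_matrix_smooth S)
  have S\<theta>: "torus_smooth (\<lambda>t. S t \<xi> $ j $ l * \<theta> t)" for l by (intro torus_smooth_mult S_sm \<theta>)
  have comp: "(\<Sum>k\<in>UNIV. fourier_coeff (matrix_op M v k) \<xi> (\<lambda>t. N t \<xi> $ j $ k * \<theta> t)) = ?F (\<lambda>t \<xi>. N t \<xi> ** M t \<xi>)"
    if M: "moderate_matrix M" and N: "moderate_matrix N" for M N :: "('n, 'm) matrix_symbol"
  proof -
    have Mv: "distribution (matrix_op M v j)" for j by (intro distribution_matrix_op v M)
    have "torus_smooth \<psi> \<Longrightarrow> matrix_op N (matrix_op M v) j \<psi> = matrix_op (\<lambda>t \<xi>. N t \<xi> ** M t \<xi>) v j \<psi>" for \<psi>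
      by (rule matrix_op_compose[OF v N M])
    from this[OF torus_smooth_tensor[OF \<theta> lattice_uminus[OF freq_lattice]]]
    have "fourier_coeff (matrix_op N (matrix_op M v) j) \<xi> \<theta> = fourier_coeff (matrix_op (\<lambda>t \<xi>. N t \<xi> ** M t \<xi>) v j) \<xi> \<theta>"
      by (simp add: fourier_coeff_tensor)
    then show ?thesis
      by (simp only: fourier_coeff_matrix_op[OF Mv N \<theta>] fourier_coeff_matrix_op[OF v moderate_matrix_mult[OF N M] \<theta>])
  qed
  \<comment> \<open>In transposed form the derivative falls on S \<theta> instead of S v, so that
    \<open>matrix_D_t S\<close> enters with a minus sign.\<close>
  have deriv: "\<i> * fourier_coeff (v l) \<xi> (pdiff 1 (\<lambda>t. S t \<xi> $ j $ l * \<theta> t)) =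
      - fourier_coeff (v l) \<xi> (\<lambda>t. matrix_D_t S t \<xi> $ j $ l * \<theta> t) + \<i> * fourier_coeff (v l) \<xi> (\<lambda>t. S t \<xi> $ j $ l * pdiff 1 \<theta> t)" for l
  proof -
    have sm: "torus_smooth (\<lambda>t. pdiff 1 (\<lambda>t. S t \<xi> $ j $ l) t * \<theta> t)" "torus_smooth (\<lambda>t. S t \<xi> $ j $ l * pdiff 1 \<theta> t)"
      by (intro torus_smooth_mult torus_smooth_pdiff S_sm \<theta>; simp)+
    have "pdiff 1 (\<lambda>t. S t \<xi> $ j $ l * \<theta> t) = (\<lambda>t. pdiff 1 (\<lambda>t. S t \<xi> $ j $ l) t * \<theta> t + S t \<xi> $ j $ l * pdiff 1 \<theta> t)"
      using pdiff_mult[OF S_sm \<theta>] by blast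
    moreover have "fourier_coeff (v l) \<xi> (\<lambda>t. matrix_D_t S t \<xi> $ j $ l * \<theta> t) =
        - \<i> * fourier_coeff (v l) \<xi> (\<lambda>t. pdiff 1 (\<lambda>t. S t \<xi> $ j $ l) t * \<theta> t)"
      using fourier_coeff_cmult[OF v sm(1), of l \<xi> "- \<i>"] by (simp add: matrix_D_t_def mult.assoc)
    ultimately show ?thesis by (simp add: fourier_coeff_add[OF v sm] distrib_left)
  qed
  have "fourier_coeff (first_order A (matrix_op S v) j) \<xi> \<theta> =
      \<i> * (\<Sum>l\<in>UNIV. fourier_coeff (v l) \<xi> (\<lambda>t. S t \<xi> $ j $ l * pdiff 1 \<theta> t)) + ?F (\<lambda>t \<xi>. A t \<xi> ** S t \<xi>)"
    unfolding fourier_coeff_first_order[OF Sv A \<theta>] comp[OF S A]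
    by (subst fourier_coeff_matrix_op[OF v S torus_smooth_pdiff[OF \<theta>]]) simp_all
  moreover have "fourier_coeff (matrix_op S (first_order A' v) j) \<xi> \<theta> =
      (\<Sum>l\<in>UNIV. \<i> * fourier_coeff (v l) \<xi> (pdiff 1 (\<lambda>t. S t \<xi> $ j $ l * \<theta> t))) + ?F (\<lambda>t \<xi>. S t \<xi> ** A' t \<xi>)"
    unfolding fourier_coeff_matrix_op[OF A'v S \<theta>] fourier_coeff_first_order[OF v A' S\<theta>] sum.distrib
    by (simp only: comp[OF A' S, symmetric] fourier_coeff_matrix_op[OF v A' S\<theta>])
  moreover have "?F (\<lambda>t \<xi>. S t \<xi> ** A' t \<xi>) = ?F (\<lambda>t \<xi>. A t \<xi> ** S t \<xi>) + ?F (matrix_D_t S)"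
    using fourier_coeff_matrix_add[OF v moderate_matrix_mult[OF A S] moderate_matrix_D_t[OF S] \<theta>] by (simp only: conj)
  ultimately show "fourier_coeff (first_order A (matrix_op S v) j) \<xi> \<theta> = fourier_coeff (matrix_op S (first_order A' v) j) \<xi> \<theta>"
    by (simp only: deriv sum.distrib sum_negf sum_distrib_left) simp
qed

lemma matrix_op_cancel:
  fixes u :: "'m::finite \<Rightarrow> 'n::finite functional"
  assumes u: "\<And>j. distribution (u j)" and S: "moderate_matrix S" and R: "moderate_matrix R"
    and inv: "\<And>t \<xi>. R t \<xi> ** S t \<xi> = mat 1" and \<phi>: "torus_smooth \<phi>"
  shows "matrix_op R (matrix_op S u) j \<phi> = u j \<phi>"
  by (simp add: matrix_op_compose[OF u R S \<phi>] matrix_op_one[OF u \<phi>] inv)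

text \<open>Moderate operators preserve distributions and smoothness, and \<open>S\<close> and
  \<open>R\<close> are mutually inverse. Solutions are transported by S v in one direction and by v
  = R u in the other.\<close>

lemma globally_hypoelliptic_conjugation:
  fixes A A' S R :: "('n::finite, 'm::finite) matrix_symbol"
  assumes A: "moderate_matrix A" and A': "moderate_matrix A'" and S: "moderate_matrix S" and R: "moderate_matrix R"
    and RS: "\<And>t \<xi>. R t \<xi> ** S t \<xi> = mat 1" and SR: "\<And>t \<xi>. S t \<xi> ** R t \<xi> = mat 1"
    and conj: "\<And>t \<xi>. A t \<xi> ** S t \<xi> + matrix_D_t S t \<xi> = S t \<xi> ** A' t \<xi>"
  shows "globally_hypoelliptic (first_order A) \<longleftrightarrow> globally_hypoelliptic (first_order A')"
proof
  assume gh: "globally_hypoelliptic (first_order A)"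
  show "globally_hypoelliptic (first_order A')"
    unfolding globally_hypoelliptic_def
  proof (intro allI impI, elim conjE)
    fix v :: "'m \<Rightarrow> 'n functional" and j
    assume "\<forall>j. distribution (v j)" "\<forall>j. smooth_distribution (first_order A' v j)"
    then have v: "\<And>j. distribution (v j)" and g: "\<And>j. smooth_distribution (first_order A' v j)" by blast+
    have Sv: "distribution (matrix_op S v j)" for j by (intro distribution_matrix_op v S)
    have "smooth_distribution (first_order A (matrix_op S v) j)" for j
      by (rule smooth_distribution_cong[OF smooth_matrix_op[OF distribution_first_order[OF v A'] g S]])
        (rule first_order_matrix_op[OF v A A' S conj, symmetric])
    then have sm: "smooth_distribution (matrix_op S v j)" for j by (rule globally_hypoellipticD[OF gh Sv])
    show "smooth_distribution (v j)"
      by (rule smooth_distribution_cong[OF smooth_matrix_op[OF Sv sm R]]) (rule matrix_op_cancel[OF v S R RS])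
  qed
next
  assume gh: "globally_hypoelliptic (first_order A')"
  show "globally_hypoelliptic (first_order A)"
    unfolding globally_hypoelliptic_def
  proof (intro allI impI, elim conjE)
    fix u :: "'m \<Rightarrow> 'n functional" and j
    assume "\<forall>j. distribution (u j)" "\<forall>j. smooth_distribution (first_order A u j)"
    then have u: "\<And>j. distribution (u j)" and g: "\<And>j. smooth_distribution (first_order A u j)" by blast+
    let ?v = "matrix_op R u"
    have v: "distribution (?v j)" for j by (intro distribution_matrix_op u R)
    have Sv: "distribution (matrix_op S ?v j)" for j by (intro distribution_matrix_op v S)
    have Sv_eq: "matrix_op S ?v j \<phi> = u j \<phi>" if "torus_smooth \<phi>" for j \<phi>
      by (rule matrix_op_cancel[OF u R S SR that])
    have "smooth_distribution (first_order A (matrix_op S ?v) j)" for j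
    \<comment> \<open>S R u and u agree on smooth test functions but need not be equal as
      functionals. The two equations are therefore compared through their Fourier
      coefficients.\<close>
    proof (rule smooth_distribution_fourier_cong[OF distribution_first_order[OF u A] distribution_first_order[OF Sv A] g])
      fix \<xi> and \<theta> :: "real \<Rightarrow> complex" assume \<theta>: "torus_smooth \<theta>"
      have "fourier_coeff (matrix_op S ?v k) \<xi> \<psi> = fourier_coeff (u k) \<xi> \<psi>" if "torus_smooth \<psi>" for k \<psi>
        using Sv_eq[OF torus_smooth_tensor[OF that lattice_uminus[OF freq_lattice]]] by (simp add: fourier_coeff_tensor)
      moreover have "torus_smooth (\<lambda>t. A t \<xi> $ j $ k * \<theta> t)" for k
        by (intro torus_smooth_mult moderate_matrix_smooth A \<theta>)
      ultimately show "fourier_coeff (first_order A u j) \<xi> \<theta> = fourier_coeff (first_order A (matrix_op S ?v) j) \<xi> \<theta>"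
        using \<theta> by (simp add: fourier_coeff_first_order[OF u A] fourier_coeff_first_order[OF Sv A] torus_smooth_pdiff)
    qed
    then have sm: "smooth_distribution (matrix_op S (first_order A' ?v) j)" for j
      by (rule smooth_distribution_cong) (rule first_order_matrix_op[OF v A A' S conj])
    have A'v: "distribution (first_order A' ?v j)" for j by (intro distribution_first_order v A')
    \<comment> \<open>Smoothness is known for S applied to this system; applying \<open>R\<close>
      removes \<open>S\<close>.\<close>
    have "smooth_distribution (first_order A' ?v j)" for j
      by (rule smooth_distribution_cong[OF smooth_matrix_op[OF distribution_matrix_op[OF A'v S] sm R]])
        (rule matrix_op_cancel[OF A'v S R RS])
    then have sm': "smooth_distribution (?v j)" for j by (rule globally_hypoellipticD[OF gh v])
    show "smooth_distribution (u j)"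
      by (rule smooth_distribution_cong[OF smooth_matrix_op[OF v sm' S]]) (rule Sv_eq)
  qed
qed

section \<open>Strongly triangularizable symbols\<close>

lemma finite_freq_less: "finite {\<xi> :: int ^ 'n::finite. norm (freq \<xi>) < R}"
proof (rule finite_subset)
  let ?V = "{- \<lceil>R\<rceil>..\<lceil>R\<rceil>}"
  show "{\<xi> :: int ^ 'n. norm (freq \<xi>) < R} \<subseteq> vec_lambda ` (PiE UNIV (\<lambda>_. ?V))"
  proof
    fix \<xi> :: "int ^ 'n" assume \<xi>: "\<xi> \<in> {\<xi>. norm (freq \<xi>) < R}"
    have "\<xi> $ i \<in> ?V" for i
    proof -
      have "\<bar>real_of_int (\<xi> $ i)\<bar> \<le> norm (freq \<xi>)"
        using component_le_norm_cart[of "freq \<xi>" i] by (simp add: freq_def)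
      then show ?thesis using \<xi> by (simp add: abs_le_iff) linarith
    qed
    then have "($) \<xi> \<in> PiE UNIV (\<lambda>_. ?V)" by auto
    then have "vec_lambda (($) \<xi>) \<in> vec_lambda ` (PiE UNIV (\<lambda>_. ?V))" by (rule imageI)
    then show "\<xi> \<in> vec_lambda ` (PiE UNIV (\<lambda>_. ?V))" by simp
  qed
  show "finite (vec_lambda ` (PiE (UNIV :: 'n set) (\<lambda>_. ?V)))" by (intro finite_imageI finite_PiE) auto
qed

text \<open>Integer vectors have no small nonzero norms. Thus a threshold R > 0 already guarantees
  that powers of the norm increase with the exponent.\<close>

lemma freq_norm_ge_1:
  assumes "norm (freq \<xi>) > 0"
  shows "norm (freq \<xi>) \<ge> 1"
proof -
  have "freq \<xi> \<noteq> 0" using assms by auto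
  then obtain i where "\<xi> $ i \<noteq> 0" by (auto simp: freq_def vec_eq_iff)
  then have "1 \<le> \<bar>real_of_int (\<xi> $ i)\<bar>" by linarith
  also have "\<dots> \<le> norm (freq \<xi>)"
    using component_le_norm_cart[of "freq \<xi>" i] by (simp add: freq_def)
  finally show ?thesis .
qed

text \<open>The finitely many small frequencies are absorbed into the constant.\<close>

lemma dt_symbol_bound_all:
  fixes a :: "real \<Rightarrow> int ^ 'n::finite \<Rightarrow> complex"
  assumes a: "smooth_symbol a"
    and large: "\<And>\<xi> t. norm (freq \<xi>) \<ge> R \<Longrightarrow> norm (dt_symbol m a t \<xi>) \<le> C * (1 + norm (freq \<xi>)) powr s"
  shows "\<exists>C\<ge>0. \<forall>\<xi> t. norm (dt_symbol m a t \<xi>) \<le> C * (1 + norm (freq \<xi>)) powr s"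
proof -
  have "\<exists>D\<ge>0. \<forall>t. norm (dt_symbol m a t \<xi>) \<le> D" for \<xi>
  proof -
    have "torus_smooth (\<lambda>t. a t \<xi>)" using a by (simp add: smooth_symbol_def)
    then have "torus_smooth ((pdiff 1 ^^ m) (\<lambda>t. a t \<xi>))" by (rule torus_smooth_funpow) simp
    then show ?thesis unfolding dt_symbol_def using torus_smooth_bounded by metis
  qed
  then obtain D where D: "\<And>\<xi>. D \<xi> \<ge> 0" "\<And>\<xi> t. norm (dt_symbol m a t \<xi>) \<le> D \<xi>" by metis
  let ?w = "\<lambda>\<xi> :: int ^ 'n. (1 + norm (freq \<xi>)) powr s"
  \<comment> \<open>Dividing by the weight lets one constant serve all small frequencies, whatever
    the sign of \<open>s\<close>.\<close>
  let ?E = "\<Sum>\<xi> | norm (freq \<xi>) < R. D \<xi> / ?w \<xi>"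
  have E: "?E \<ge> 0" by (intro sum_nonneg divide_nonneg_nonneg) (auto intro: D)
  have "norm (dt_symbol m a t \<xi>) \<le> (\<bar>C\<bar> + ?E) * ?w \<xi>" for \<xi> t
  proof (cases "norm (freq \<xi>) < R")
    case True
    have "D \<xi> / ?w \<xi> \<le> ?E"
      using True D(1) by (intro member_le_sum finite_freq_less) auto
    then have "D \<xi> \<le> ?E * ?w \<xi>" using weight_pos[of "freq \<xi>" s] by (simp only: pos_divide_le_eq)
    also have "\<dots> \<le> (\<bar>C\<bar> + ?E) * ?w \<xi>" by (intro mult_right_mono) auto
    finally show ?thesis using D(2)[of t \<xi>] by linarith
  next
    case False
    then have "norm (dt_symbol m a t \<xi>) \<le> C * ?w \<xi>" using large by simp
    also have "\<dots> \<le> (\<bar>C\<bar> + ?E) * ?w \<xi>" using E by (intro mult_right_mono) auto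
    finally show ?thesis .
  qed
  moreover have "\<bar>C\<bar> + ?E \<ge> 0" using E by simp
  ultimately show ?thesis by blast
qed

lemma symbol_leI:
  fixes a :: "real \<Rightarrow> int ^ 'n::finite \<Rightarrow> complex"
  assumes a: "smooth_symbol a"
    and bound: "\<And>m. m \<le> K \<Longrightarrow> \<exists>C\<ge>0. \<forall>\<xi> t. norm (dt_symbol m a t \<xi>) \<le> C * (1 + norm (freq \<xi>)) powr s"
  shows "symbol_le K s a"
proof -
  obtain C where C: "\<And>m. m \<le> K \<Longrightarrow> C m \<ge> 0"
    "\<And>m \<xi> t. m \<le> K \<Longrightarrow> norm (dt_symbol m a t \<xi>) \<le> C m * (1 + norm (freq \<xi>)) powr s"
    using bound by metis
  have "norm (dt_symbol m a t \<xi>) \<le> (\<Sum>m\<le>K. C m) * (1 + norm (freq \<xi>)) powr s" if "m \<le> K" for m \<xi> t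
  proof -
    have "C m \<le> (\<Sum>m\<le>K. C m)" using that C(1) by (intro member_le_sum) auto
    then have "C m * (1 + norm (freq \<xi>)) powr s \<le> (\<Sum>m\<le>K. C m) * (1 + norm (freq \<xi>)) powr s"
      by (rule mult_right_mono) simp
    then show ?thesis using C(2)[OF that, of t \<xi>] by linarith
  qed
  then have "seminorm_le K ((\<Sum>m\<le>K. C m) * (1 + norm (freq \<xi>)) powr s) (\<lambda>t. a t \<xi>)" for \<xi>
    unfolding seminorm_le_real using a by (auto simp: smooth_symbol_def dt_symbol_def)
  then show ?thesis unfolding symbol_le_def by blast
qed

lemma moderate_symbolI:
  fixes a :: "real \<Rightarrow> int ^ 'n::finite \<Rightarrow> complex"
  assumes a: "smooth_symbol a"
    and bound: "\<And>m. \<exists>C \<mu> R. R > 0 \<and> (\<forall>\<xi>. norm (freq \<xi>) \<ge> R \<longrightarrow>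
      (\<forall>t. norm (dt_symbol m a t \<xi>) \<le> C * norm (freq \<xi>) powr \<mu>))"
  shows "moderate_symbol a"
  unfolding moderate_symbol_def
proof
  fix K
  have "\<exists>C s. 0 \<le> s \<and> 0 \<le> C \<and> (\<forall>\<xi> t. norm (dt_symbol m a t \<xi>) \<le> C * (1 + norm (freq \<xi>)) powr s)" for m
  proof -
    obtain C \<mu> R where R: "R > 0" and large: "\<And>\<xi> t. norm (freq \<xi>) \<ge> R \<Longrightarrow>
        norm (dt_symbol m a t \<xi>) \<le> C * norm (freq \<xi>) powr \<mu>"
      using bound[of m] by blast
    \<comment> \<open>Passing to |\<mu>| makes the exponent non-negative. This permits the larger
      weight 1 + |\<xi>|, and it makes the sum of the exponents over m \<le> K a common upper
      bound.\<close>
    have "norm (dt_symbol m a t \<xi>) \<le> \<bar>C\<bar> * (1 + norm (freq \<xi>)) powr \<bar>\<mu>\<bar>" if "norm (freq \<xi>) \<ge> R" for \<xi> t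
    proof -
      have 1: "norm (freq \<xi>) \<ge> 1" using that R by (intro freq_norm_ge_1) linarith
      have "norm (freq \<xi>) powr \<mu> \<le> norm (freq \<xi>) powr \<bar>\<mu>\<bar>" using 1 by (intro powr_mono) auto
      also have "\<dots> \<le> (1 + norm (freq \<xi>)) powr \<bar>\<mu>\<bar>" by (intro powr_mono2) auto
      finally have "C * norm (freq \<xi>) powr \<mu> \<le> \<bar>C\<bar> * (1 + norm (freq \<xi>)) powr \<bar>\<mu>\<bar>"
        by (intro mult_mono) auto
      then show ?thesis using large[OF that, of t] by linarith
    qed
    from dt_symbol_bound_all[OF a this] show ?thesis by (meson abs_ge_zero)
  qed
  then obtain C s where Cs: "\<And>m. 0 \<le> s m" "\<And>m. 0 \<le> C m"
    "\<And>m \<xi> t. norm (dt_symbol m a t \<xi>) \<le> C m * (1 + norm (freq \<xi>)) powr s m" by metis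
  have "symbol_le K (\<Sum>m\<le>K. s m) a"
  proof (rule symbol_leI[OF a])
    fix m assume "m \<le> K"
    then have "s m \<le> (\<Sum>m\<le>K. s m)" using Cs(1) by (intro member_le_sum) auto
    then have "C m * (1 + norm (freq \<xi>)) powr s m \<le> C m * (1 + norm (freq \<xi>)) powr (\<Sum>m\<le>K. s m)" for \<xi> :: "int ^ 'n"
      by (intro mult_left_mono weight_mono Cs)
    then show "\<exists>C\<ge>0. \<forall>\<xi> t. norm (dt_symbol m a t \<xi>) \<le> C * (1 + norm (freq \<xi>)) powr (\<Sum>m\<le>K. s m)"
      using Cs(2,3) order_trans by blast
  qed
  then show "\<exists>s. symbol_le K s a" by blast
qed

lemma rapid_symbolI:
  fixes a :: "real \<Rightarrow> int ^ 'n::finite \<Rightarrow> complex"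
  assumes a: "smooth_symbol a"
    and bound: "\<And>m M. M > (0 :: real) \<Longrightarrow> \<exists>C R. C > 0 \<and> R > 0 \<and> (\<forall>\<xi>. norm (freq \<xi>) \<ge> R \<longrightarrow>
      (\<forall>t. norm (dt_symbol m a t \<xi>) \<le> C * norm (freq \<xi>) powr (- M)))"
  shows "rapid_symbol a"
  unfolding rapid_symbol_def
proof (intro allI)
  fix K :: nat and s :: real
  \<comment> \<open>The decay hypothesis concerns positive \<open>M\<close>; the maximum with 1 also
    covers \<open>s \<ge> 0\<close>.\<close>
  define M where "M = max 1 (- s)"
  have M: "M > 0" "- M \<le> s" by (auto simp: M_def)
  show "symbol_le K s a"
  proof (rule symbol_leI[OF a])
    fix m
    obtain C R where R: "C > 0" "R > 0" and large: "\<And>\<xi> t. norm (freq \<xi>) \<ge> R \<Longrightarrow>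
        norm (dt_symbol m a t \<xi>) \<le> C * norm (freq \<xi>) powr (- M)"
      using bound[OF M(1), of m] by blast
    \<comment> \<open>The factor \<open>2 powr M\<close> comes from 1 + |\<xi>| \<le> 2 |\<xi>|,
      which holds for |\<xi>| \<ge> 1.\<close>
    have "norm (dt_symbol m a t \<xi>) \<le> (C * 2 powr M) * (1 + norm (freq \<xi>)) powr s" if "norm (freq \<xi>) \<ge> R" for \<xi> t
    proof -
      have 1: "norm (freq \<xi>) \<ge> 1" using that R by (intro freq_norm_ge_1) linarith
      have "norm (freq \<xi>) powr (- M) \<le> ((1 + norm (freq \<xi>)) / 2) powr (- M)"
        using 1 M(1) by (intro powr_mono2') auto
      also have "\<dots> = 2 powr M * (1 + norm (freq \<xi>)) powr (- M)"
        by (subst powr_divide) (auto simp: powr_minus_divide)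
      also have "\<dots> \<le> 2 powr M * (1 + norm (freq \<xi>)) powr s"
        by (intro mult_left_mono weight_mono M) auto
      finally have "C * norm (freq \<xi>) powr (- M) \<le> C * (2 powr M * (1 + norm (freq \<xi>)) powr s)"
        using R(1) by (intro mult_left_mono) auto
      then show ?thesis using large[OF that, of t] by (simp add: mult.assoc)
    qed
    then show "\<exists>C\<ge>0. \<forall>\<xi> t. norm (dt_symbol m a t \<xi>) \<le> C * (1 + norm (freq \<xi>)) powr s"
      by (rule dt_symbol_bound_all[OF a])
  qed
qed

lemma funpow_pdiff_linear:
  assumes "torus_smooth f" "bounded_linear h" "b \<in> Basis"
  shows "(pdiff b ^^ m) (\<lambda>z. h (f z)) = (\<lambda>z. h ((pdiff b ^^ m) f z))"
proof (induction m)
  case (Suc m)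
  then show ?case using pdiff_linear[OF torus_smooth_funpow[OF assms(1,3)] assms(2)] by auto
qed simp

lemma rapid_symbol_uminus:
  assumes "rapid_symbol a"
  shows "rapid_symbol (\<lambda>t \<xi>. - a t \<xi>)"
  unfolding rapid_symbol_def
proof (intro allI)
  fix K s
  obtain C where C: "\<And>\<xi>. seminorm_le K (C * (1 + norm (freq \<xi>)) powr s) (\<lambda>t. a t \<xi>)"
    using assms unfolding rapid_symbol_def symbol_le_def by blast
  have neg: "bounded_linear (\<lambda>z :: complex. - z)" by (intro bounded_linear_minus bounded_linear_ident)
  have "seminorm_le K D (\<lambda>t. - f t)" if "seminorm_le K D f" for D and f :: "real \<Rightarrow> complex"
    using that funpow_pdiff_linear[OF _ neg, of f 1]
    by (auto simp: seminorm_le_real torus_smooth_uminus)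
  then show "symbol_le K s (\<lambda>t \<xi>. - a t \<xi>)" unfolding symbol_le_def using C by blast
qed

text \<open>Smoothness of matrix symbols is an entrywise condition, whereas the bounds (B2) and (B3)
  differentiate the matrix as a whole. Writing the matrix as a sum of linear images of its entries
  connects the two.\<close>

lemma torus_smooth_matrix:
  fixes f :: "real \<Rightarrow> complex ^ 'm::finite ^ 'm"
  assumes "\<And>j k. torus_smooth (\<lambda>t. f t $ j $ k)"
  shows "torus_smooth f"
proof -
  have lin: "bounded_linear (\<lambda>z. axis j (axis k z) :: complex ^ 'm ^ 'm)" for j k
  proof (intro linear_conv_bounded_linear[THEN iffD1] linearI)
    show "axis j (axis k (x + y)) = (axis j (axis k x) + axis j (axis k y) :: complex ^ 'm ^ 'm)" for x y
      by (auto simp: axis_def vec_eq_iff)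
    show "axis j (axis k (r *\<^sub>R x)) = (r *\<^sub>R axis j (axis k x) :: complex ^ 'm ^ 'm)" for r x
      by (auto simp: axis_def vec_eq_iff)
  qed
  have "f = (\<lambda>t. \<Sum>j\<in>UNIV. \<Sum>k\<in>UNIV. axis j (axis k (f t $ j $ k)))"
  proof (rule ext)
    fix t
    have "(axis j (axis k z) :: complex ^ 'm ^ 'm) $ i $ l = (if i = j then if l = k then z else 0 else 0)" for i j k l z
      by (simp add: axis_def)
    moreover have "(\<Sum>k\<in>UNIV. if i = j then if l = k then f t $ j $ k else 0 else 0) = (if i = j then f t $ j $ l else 0)" for i j l
      by simp
    ultimately show "f t = (\<Sum>j\<in>UNIV. \<Sum>k\<in>UNIV. axis j (axis k (f t $ j $ k)))"
      by (simp add: vec_eq_iff)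
  qed
  moreover have "torus_smooth (\<lambda>t. \<Sum>j\<in>UNIV. \<Sum>k\<in>UNIV. axis j (axis k (f t $ j $ k)))"
    by (intro torus_smooth_sum torus_smooth_linear[OF assms lin])
  ultimately show ?thesis by simp
qed

lemma norm_dt_symbol_entry_le:
  fixes A :: "('n::finite, 'm::finite) matrix_symbol"
  assumes "smooth_matrix_symbol A"
  shows "norm (dt_symbol m (\<lambda>t \<xi>. A t \<xi> $ j $ k) t \<xi>) \<le> norm (dt_symbol m A t \<xi>)"
proof -
  have "torus_smooth (\<lambda>t. A t \<xi>)"
    using assms by (intro torus_smooth_matrix) (simp add: smooth_matrix_symbol_def smooth_symbol_def)
  moreover have "bounded_linear (\<lambda>M :: complex ^ 'm ^ 'm. M $ j $ k)"
    by (intro bounded_linear_compose[OF bounded_linear_vec_nth bounded_linear_vec_nth])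
  ultimately have "dt_symbol m (\<lambda>t \<xi>. A t \<xi> $ j $ k) t \<xi> = dt_symbol m A t \<xi> $ j $ k"
    unfolding dt_symbol_def by (subst funpow_pdiff_linear) auto
  then show ?thesis
    using order_trans[OF Finite_Cartesian_Product.norm_nth_le Finite_Cartesian_Product.norm_nth_le] by simp
qed

lemma moderate_matrixI:
  fixes A :: "('n::finite, 'm::finite) matrix_symbol"
  assumes A: "smooth_matrix_symbol A"
    and bound: "\<And>m. \<exists>C \<mu> R. R > 0 \<and> (\<forall>\<xi>. norm (freq \<xi>) \<ge> R \<longrightarrow>
      (\<forall>t. norm (dt_symbol m A t \<xi>) \<le> C * norm (freq \<xi>) powr \<mu>))"
  shows "moderate_matrix A"
  unfolding moderate_matrix_def
proof (intro allI moderate_symbolI)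
  fix j k m
  show "smooth_symbol (\<lambda>t \<xi>. A t \<xi> $ j $ k)" using A by (simp add: smooth_matrix_symbol_def)
  show "\<exists>C \<mu> R. R > 0 \<and> (\<forall>\<xi>. norm (freq \<xi>) \<ge> R \<longrightarrow>
      (\<forall>t. norm (dt_symbol m (\<lambda>t \<xi>. A t \<xi> $ j $ k) t \<xi>) \<le> C * norm (freq \<xi>) powr \<mu>))"
    using bound[of m] norm_dt_symbol_entry_le[OF A] order_trans by meson
qed

lemma moderate_coefficient:
  fixes c :: "real \<Rightarrow> complex" and q :: "int ^ 'n::finite \<Rightarrow> complex"
  assumes c: "torus_smooth c" and q: "\<And>\<xi>. \<xi> \<noteq> 0 \<Longrightarrow> norm (q \<xi>) \<le> C * norm (freq \<xi>) powr \<nu>"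
  shows "moderate_symbol (\<lambda>t \<xi>. c t * q \<xi>)"
proof (rule moderate_symbolI)
  show "smooth_symbol (\<lambda>t \<xi>. c t * q \<xi>)"
    unfolding smooth_symbol_def by (intro allI torus_smooth_mult c torus_smooth_const)
  fix m
  obtain D where D: "D \<ge> 0" "\<And>t. norm ((pdiff 1 ^^ m) c t) \<le> D"
    using torus_smooth_bounded[OF torus_smooth_funpow[OF c]] by (metis Basis_real_def singletonI)
  have "norm (dt_symbol m (\<lambda>t \<xi>. c t * q \<xi>) t \<xi>) \<le> (D * C) * norm (freq \<xi>) powr \<nu>" if "norm (freq \<xi>) \<ge> 1" for t \<xi>
  proof -
    \<comment> \<open>The threshold 1 excludes the frequency 0, where the bound on \<open>q\<close>
      says nothing.\<close>
    have "\<xi> \<noteq> 0" using that by (auto simp: freq_def zero_vec_def[symmetric])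
    then have "D * norm (q \<xi>) \<le> D * (C * norm (freq \<xi>) powr \<nu>)" using q D(1) by (intro mult_left_mono)
    moreover have "norm (dt_symbol m (\<lambda>t \<xi>. c t * q \<xi>) t \<xi>) = norm ((pdiff 1 ^^ m) c t) * norm (q \<xi>)"
      unfolding dt_symbol_def by (subst funpow_pdiff_linear[OF c bounded_linear_mult_left]) (auto simp: norm_mult)
    moreover have "\<dots> \<le> D * norm (q \<xi>)" using D(2) by (rule mult_right_mono) simp
    ultimately show ?thesis by (simp add: mult.assoc)
  qed
  then show "\<exists>C \<mu> R. R > 0 \<and> (\<forall>\<xi>. norm (freq \<xi>) \<ge> R \<longrightarrow>
      (\<forall>t. norm (dt_symbol m (\<lambda>t \<xi>. c t * q \<xi>) t \<xi>) \<le> C * norm (freq \<xi>) powr \<mu>))"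
    by (intro exI[of _ "D * C"] exI[of _ \<nu>] exI[of _ 1]) simp
qed

lemma matrix_inv_cancel:
  assumes "invertible A"
  shows "A ** matrix_inv A = mat 1" "matrix_inv A ** A = mat 1"
  using someI_ex[of "\<lambda>B. A ** B = mat 1 \<and> B ** A = mat 1"] assms
  unfolding invertible_def matrix_inv_def by blast+

theorem theorem3p8:
  fixes c :: "'m::{finite,linorder} \<Rightarrow> 'm \<Rightarrow> real \<Rightarrow> complex"
    and q :: "'m \<Rightarrow> 'm \<Rightarrow> int ^ 'n::finite \<Rightarrow> complex"
    and Q S N :: "('n, 'm) matrix_symbol"
    and lam :: "'m \<Rightarrow> real \<Rightarrow> int ^ 'n \<Rightarrow> complex"
    and P L T :: "('n, 'm) system"
  assumes c_smooth: "\<And>j k. torus_smooth (c j k)"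
    and q_bound: "\<And>j k. \<exists>C \<nu>. C > 0 \<and> (\<forall>\<xi>. \<xi> \<noteq> 0 \<longrightarrow> norm (q j k \<xi>) \<le> C * norm (freq \<xi>) powr \<nu>)"
    and Q_def: "Q = (\<lambda>t \<xi>. \<chi> j k. c j k t * q j k \<xi>)"
    and triang: "strong_triangularization Q lam S N"
    and P_def: "P = (\<lambda>u j \<phi>. D_t (u j) \<phi> + matrix_op Q u j \<phi>)"
    and L_def: "L = (\<lambda>u j \<phi>. D_t (u j) \<phi> + matrix_op (diag_symbol lam) u j \<phi> +
                  matrix_op N u j \<phi> + matrix_op (B_symbol S) u j \<phi>)"
    and T_def: "T = (\<lambda>u j \<phi>. D_t (u j) \<phi> + matrix_op (diag_symbol lam) u j \<phi> +
                  matrix_op N u j \<phi>)"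
  shows "(globally_hypoelliptic P \<longleftrightarrow> globally_hypoelliptic L) \<and>
         (globally_hypoelliptic L \<longleftrightarrow> globally_hypoelliptic T)"
proof -
  let ?\<Lambda> = "diag_symbol lam" and ?R = "inv_symbol S" and ?B = "B_symbol S"
  have inv: "invertible (S t \<xi>)" and tri: "?R t \<xi> ** Q t \<xi> ** S t \<xi> = ?\<Lambda> t \<xi> + N t \<xi>" for t \<xi>
    using triang by (auto simp: strong_triangularization_def)
  have SR: "S t \<xi> ** ?R t \<xi> = mat 1" and RS: "?R t \<xi> ** S t \<xi> = mat 1" for t \<xi>
    using matrix_inv_cancel[OF inv] by (auto simp: inv_symbol_def)
  have SR_bound: "\<exists>C R \<gamma>. C > 0 \<and> R > 0 \<and> \<gamma> > 0 \<and> (\<forall>\<xi>. norm (freq \<xi>) \<ge> R \<longrightarrow>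
        (\<forall>t. norm (dt_symbol m S t \<xi>) \<le> C * norm (freq \<xi>) powr \<gamma> \<and>
             norm (dt_symbol m ?R t \<xi>) \<le> C * norm (freq \<xi>) powr \<gamma>))" for m
    using triang by (simp add: strong_triangularization_def)
  have S: "moderate_matrix S"
    by (rule moderate_matrixI) (use triang SR_bound in \<open>(simp add: strong_triangularization_def; fail) | blast\<close>)+
  have R: "moderate_matrix ?R"
    by (rule moderate_matrixI) (use triang SR_bound in \<open>(simp add: strong_triangularization_def; fail) | blast\<close>)+
  have Q: "moderate_matrix Q"
    unfolding moderate_matrix_def
  proof (intro allI)
    fix j k
    obtain C \<nu> where "\<And>\<xi>. \<xi> \<noteq> 0 \<Longrightarrow> norm (q j k \<xi>) \<le> C * norm (freq \<xi>) powr \<nu>" using q_bound by blast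
    from moderate_coefficient[OF c_smooth this] show "moderate_symbol (\<lambda>t \<xi>. Q t \<xi> $ j $ k)" by (simp add: Q_def)
  qed
  have \<Lambda>: "moderate_matrix ?\<Lambda>"
    unfolding moderate_matrix_def
  proof (intro allI)
    fix j k
    have "moderate_symbol (lam j)"
      by (rule moderate_symbolI) (use triang in \<open>simp_all add: strong_triangularization_def condition_A_def\<close>)
    then show "moderate_symbol (\<lambda>t \<xi>. ?\<Lambda> t \<xi> $ j $ k)"
      by (cases "j = k") (simp_all add: diag_symbol_def moderate_symbol_0)
  qed
  \<comment> \<open>(B1) provides smoothness of \<open>N\<close> but no growth bounds. These come
    from solving the triangularization for \<open>N\<close>, since S, its inverse, Q and \<Lambda>
    are moderate.\<close>
  have "N = (\<lambda>t \<xi>. ?R t \<xi> ** Q t \<xi> ** S t \<xi> + - ?\<Lambda> t \<xi>)" by (simp add: tri fun_eq_iff)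
  then have N: "moderate_matrix N"
    using moderate_matrix_add[OF moderate_matrix_mult[OF moderate_matrix_mult[OF R Q] S] moderate_matrix_minus[OF \<Lambda>]]
    by simp
  have B_eq: "?B = (\<lambda>t \<xi>. ?R t \<xi> ** matrix_D_t S t \<xi>)"
    by (simp add: fun_eq_iff B_symbol_def matrix_D_t_def dt_symbol_def)
  \<comment> \<open>The product form yields smoothness of the entries of B, which is required before
    the decay (B3) of the matrix can be passed to its entries.\<close>
  have B: "moderate_matrix ?B" unfolding B_eq by (intro moderate_matrix_mult R moderate_matrix_D_t S)
  have B_smooth: "smooth_matrix_symbol ?B"
    unfolding smooth_matrix_symbol_def smooth_symbol_def by (intro allI moderate_matrix_smooth B)
  have B_rapid: "rapid_symbol (\<lambda>t \<xi>. ?B t \<xi> $ j $ k)" for j k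
  proof (rule rapid_symbolI)
    show "smooth_symbol (\<lambda>t \<xi>. ?B t \<xi> $ j $ k)" using B_smooth by (simp add: smooth_matrix_symbol_def)
    fix m and M :: real assume "M > 0"
    then have "\<exists>C R. C > 0 \<and> R > 0 \<and> (\<forall>\<xi>. norm (freq \<xi>) \<ge> R \<longrightarrow>
        (\<forall>t. norm (dt_symbol m ?B t \<xi>) \<le> C * norm (freq \<xi>) powr (- M)))"
      using triang by (simp add: strong_triangularization_def)
    then show "\<exists>C R. C > 0 \<and> R > 0 \<and> (\<forall>\<xi>. norm (freq \<xi>) \<ge> R \<longrightarrow>
        (\<forall>t. norm (dt_symbol m (\<lambda>t \<xi>. ?B t \<xi> $ j $ k) t \<xi>) \<le> C * norm (freq \<xi>) powr (- M)))"
      using norm_dt_symbol_entry_le[OF B_smooth] order_trans by meson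
  qed
  let ?T = "\<lambda>t \<xi>. ?\<Lambda> t \<xi> + N t \<xi>" and ?L = "\<lambda>t \<xi>. ?\<Lambda> t \<xi> + N t \<xi> + ?B t \<xi>"
  have T: "moderate_matrix ?T" and L: "moderate_matrix ?L"
    by (intro moderate_matrix_add \<Lambda> N B)+
  have P_eq: "P = first_order Q" by (simp add: P_def first_order_def fun_eq_iff)
  have T_iff: "globally_hypoelliptic T \<longleftrightarrow> globally_hypoelliptic (first_order ?T)"
    by (rule globally_hypoelliptic_cong) (simp add: T_def first_order_def matrix_op_add \<Lambda> N)
  have L_iff: "globally_hypoelliptic L \<longleftrightarrow> globally_hypoelliptic (first_order ?L)"
    by (rule globally_hypoelliptic_cong) (simp add: L_def first_order_def matrix_op_add \<Lambda> N T B)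
  \<comment> \<open>Multiplying by S undoes the inverse in both S^(-1) Q S and B = S^(-1) D_t S. The
    term B in L is thus exactly what the Leibniz rule produces under conjugation.\<close>
  have "S t \<xi> ** ?L t \<xi> = Q t \<xi> ** S t \<xi> + matrix_D_t S t \<xi>" for t \<xi>
  proof -
    have "S t \<xi> ** ?L t \<xi> = S t \<xi> ** (?R t \<xi> ** Q t \<xi> ** S t \<xi> + ?R t \<xi> ** matrix_D_t S t \<xi>)"
      by (simp only: tri B_eq)
    also have "\<dots> = (S t \<xi> ** ?R t \<xi>) ** (Q t \<xi> ** S t \<xi>) + (S t \<xi> ** ?R t \<xi>) ** matrix_D_t S t \<xi>"
      by (simp only: matrix_add_ldistrib matrix_mul_assoc)
    finally show ?thesis by (simp only: SR matrix_mul_lid)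
  qed
  then have PL: "globally_hypoelliptic P \<longleftrightarrow> globally_hypoelliptic L"
    unfolding P_eq L_iff by (intro globally_hypoelliptic_conjugation[OF Q L S R RS SR]) simp
  have "globally_hypoelliptic (first_order ?T)" if "globally_hypoelliptic (first_order ?L)"
    using T B_rapid that by (rule globally_hypoelliptic_perturbation)
  moreover have "globally_hypoelliptic (first_order ?L)" if "globally_hypoelliptic (first_order ?T)"
  \<comment> \<open>The converse is the same perturbation argument, with - B added to the symbol of
    L.\<close>
  proof (rule globally_hypoelliptic_perturbation[OF L, of "\<lambda>t \<xi>. - ?B t \<xi>"])
    show "rapid_symbol (\<lambda>t \<xi>. (- ?B t \<xi>) $ j $ k)" for j k
      using rapid_symbol_uminus[OF B_rapid] by simp
    show "globally_hypoelliptic (first_order (\<lambda>t \<xi>. ?L t \<xi> + - ?B t \<xi>))" using that by simp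
  qed
  ultimately show ?thesis using PL unfolding L_iff T_iff by blast
qed

end
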